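(* Let $s,L,Q>0$ and let $r\in\mathbb N$ satisfy $r+1\ge s$. For any $z\in\operatorname{Supp}P_Z$ let $\bar f(z)$ be the local polynomial estimator of degree $r$ with data-driven bandwidth $H_m(z)$ defined in the context. On the event $\{\lambda(\bar{\mathbf Z}_m(z))>0\}$, $$\sup_{f\in H(s,L)}E^m\big[(\bar f(z)-f(z))^2\,\big|\,Z_1^m\big]\le 2\,\lambda(\bar{\mathbf Z}_m(z))^{-2}L^2H_m(z)^{2s}.$$ Moreover, if $Z$ satisfies Assumption (D), then $$\sup_{f\in H^Q(s,L)}E^m\big[\|\tau_Q(\bar f)-f\|_{L^2(P_Z)}^2\big]\le C_2\,m^{-2s/(2s+1)}$$ for $m$ large enough, where $\tau_Q(u)=\max(-Q,\min(Q,u))$ is the truncation operator and $C_2>0$ is a constant depending on $s$, $Q$ and $P_Z$ only.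
   Context: **Univariate model.** $[(Z_i,Y_i);1\le i\le m]$ are i.i.d. copies of $(Z,Y)\in\mathbb R\times\mathbb R$ with $Y=f(Z)+\sigma(Z)\epsilon$, where $\epsilon\sim N(0,1)$ is independent of $Z$ and $\sigma:\mathbb R\to[\sigma_0,\sigma_1]\subset(0,+\infty)$. $P_Z$ is the law of $Z$, $E^m$ the expectation with respect to the joint law of the observations, $Z_1^m=(Z_1,\dots,Z_m)$, and $\|g\|_{L^2(P_Z)}^2=\int g^2\,dP_Z$. **Hölder classes.** $\lfloor s\rfloor$ is the largest integer (strictly) smaller than $s$. $H(s,L)$ is the set of $f:\mathbb R\to\mathbb R$ such that $|f^{(\lfloor s\rfloor)}(z_1)-f^{(\lfloor s\rfloor)}(z_2)|\le L|z_1-z_2|^{s-\lfloor s\rfloor}$ for all $z_1,z_2\in\mathbb R$. $H^Q(s,L):=H(s,L)\cap\{f:\sup_x|f(x)|\le Q\}$. **Estimator.** The smoothness $s$, the radius $L$ and $\sigma_1$ are known. $I(z,h)=[z-h,z+h]$; $\bar P_Z[A]=\frac1m\sum_{i=1}^m\mathbf 1_{Z_i\in A}$. $H_m(z)$ is the smallest $h\in(0,1)$ such that $Lh^s\ge\sigma_1/(m\bar P_Z[I(z,h)])^{1/2}$. $\bar{\mathbf Z}_m(z,h)$ is the symmetric matrix with entries $\frac1{m\bar P_Z[I(z,h)]}\sum_{i=1}^m\big(\frac{Z_i-z}{h}\big)^{a+b}\mathbf 1_{Z_i\in I(z,h)}$, $(a,b)\in\{0,\dots,r\}^2$, and $\bar{\mathbf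 Z}_m(z):=\bar{\mathbf Z}_m(z,H_m(z))$. $\lambda(M)$ is the smallest eigenvalue of a matrix $M$. If $\lambda(\bar{\mathbf Z}_m(z))>0$, $\bar f(z):=\bar P(0)$, where $\bar P$ is the unique minimizer, among real polynomials $P$ of degree at most $r$, of $\sum_{i=1}^m(Y_i-P(Z_i-z))^2\mathbf 1_{Z_i\in I(z,H_m(z))}$; otherwise $\bar f(z):=0$. If no $h\in(0,1)$ satisfies $Lh^s\ge\sigma_1/(m\bar P_Z[I(z,h)])^{1/2}$, the event $\{\lambda(\bar{\mathbf Z}_m(z))>0\}$ is understood to fail and $\bar f(z):=0$. **Assumption (D)** for a real random variable $Z$ with law $P_Z$: $P_Z$ has a continuous density $\mu$ with respect to Lebesgue measure; moreover (i) $\mu$ is compactly supported; (ii) there is a finite number of $z$ in the support of $\mu$ with $\mu(z)=0$; (iii) for any such $z$ there is an interval $I_z=[z-a_z,z+b_z]$ ($a_z,b_z>0$) such that $\mu$ is decreasing (weakly) over $[z-a_z,z]$ and increasing (weakly) over $[z,z+b_z]$; (iv) there are $\beta\ge0$ and $\gamma>0$ such that $P_Z[I]\ge\gamma|I|^{\beta+1}$ for any interval $I$ contained in the support of $\mu$, where $|I|$ is the length of $I$.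
   Formalization: C_2 may also depend on L, σ_1 and r, not on s, Q and P_Z only; for f=0 and σ=σ_1 the risk is of order L^{2/(2s+1)} σ_1^{4s/(2s+1)} m^{-2s/(2s+1)} and its factor grows with r, so a constant depending on s, Q, P_Z only cannot exist. *)

theory Defs
  imports
    "HOL-Probability.Probability"
    "HOL-Computational_Algebra.Polynomial"
    "Jordan_Normal_Form.Char_Poly"
begin

text \<open>For \<open>s > 0\<close> this is the largest integer strictly smaller than \<open>s\<close>;
  in particular it is \<open>s - 1\<close>, not \<open>s\<close>, when \<open>s\<close> is an integer.\<close>

definition strict_floor :: "real \<Rightarrow> nat" where
  "strict_floor s = nat (\<lceil>s\<rceil> - 1)"

lemma strict_floor_greatest:
  assumes "s > 0"
  shows "real (strict_floor s) < s" and "real n < s \<Longrightarrow> n \<le> strict_floor s"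
  using assms unfolding strict_floor_def by linarith+

definition holder_class :: "real \<Rightarrow> real \<Rightarrow> (real \<Rightarrow> real) set" where
  "holder_class s L =
     {f. (\<forall>j<strict_floor s. \<forall>x. (deriv ^^ j) f differentiable (at x)) \<and>
         (\<forall>x y. \<bar>(deriv ^^ strict_floor s) f x - (deriv ^^ strict_floor s) f y\<bar>
                 \<le> L * \<bar>x - y\<bar> powr (s - real (strict_floor s)))}"

definition bounded_holder_class :: "real \<Rightarrow> real \<Rightarrow> real \<Rightarrow> (real \<Rightarrow> real) set" where
  "bounded_holder_class Q s L = holder_class s L \<inter> {f. \<forall>x. \<bar>f x\<bar> \<le> Q}"

definition noise_level :: "real \<Rightarrow> real \<Rightarrow> (real \<Rightarrow> real) \<Rightarrow> bool" where
  "noise_level \<sigma>0 \<sigma>1 \<sigma> \<longleftrightarrow>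
     0 < \<sigma>0 \<and> \<sigma> \<in> borel_measurable borel \<and> (\<forall>x. \<sigma> x \<in> {\<sigma>0..\<sigma>1})"

definition obs_law :: "real measure \<Rightarrow> (real \<Rightarrow> real) \<Rightarrow> (real \<Rightarrow> real) \<Rightarrow> (real \<times> real) measure" where
  "obs_law PZ \<sigma> f =
     distr (PZ \<Otimes>\<^sub>M density lborel std_normal_density) (borel \<Otimes>\<^sub>M borel)
       (\<lambda>(z, e). (z, f z + \<sigma> z * e))"

definition sample_law ::
  "real measure \<Rightarrow> (real \<Rightarrow> real) \<Rightarrow> (real \<Rightarrow> real) \<Rightarrow> nat \<Rightarrow> (nat \<Rightarrow> real \<times> real) measure" where
  "sample_law PZ \<sigma> f m = (\<Pi>\<^sub>M i\<in>{1..m}. obs_law PZ \<sigma> f)"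

definition design :: "(nat \<Rightarrow> real \<times> real) \<Rightarrow> nat \<Rightarrow> real" where
  "design \<omega> = (\<lambda>i. fst (\<omega> i))"

definition design_algebra ::
  "real measure \<Rightarrow> (real \<Rightarrow> real) \<Rightarrow> (real \<Rightarrow> real) \<Rightarrow> nat \<Rightarrow> (nat \<Rightarrow> real \<times> real) measure" where
  "design_algebra PZ \<sigma> f m =
     vimage_algebra (space (sample_law PZ \<sigma> f m))
       (\<lambda>\<omega>. restrict (design \<omega>) {1..m}) (\<Pi>\<^sub>M i\<in>{1..m}. (borel :: real measure))"

definition measure_support :: "real measure \<Rightarrow> real set" where
  "measure_support P = {x. \<forall>U. open U \<and> x \<in> U \<longrightarrow> emeasure P U > 0}"

definition window :: "real \<Rightarrow> real \<Rightarrow> real set" where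
  "window z h = {z - h..z + h}"

definition emp_measure :: "nat \<Rightarrow> (nat \<Rightarrow> real) \<Rightarrow> real set \<Rightarrow> real" where
  "emp_measure m x A = (1 / real m) * (\<Sum>i=1..m. indicator A (x i))"

text \<open>The first conjunct excludes windows without observations, on which the right-hand side
  of the inequality stands for \<open>\<infinity>\<close>, whereas division by zero yields \<open>0\<close>.\<close>

definition admissible_bandwidth ::
  "real \<Rightarrow> real \<Rightarrow> real \<Rightarrow> nat \<Rightarrow> (nat \<Rightarrow> real) \<Rightarrow> real \<Rightarrow> real \<Rightarrow> bool" where
  "admissible_bandwidth s L \<sigma>1 m x z h \<longleftrightarrow>
     real m * emp_measure m x (window z h) > 0 \<and>
     h \<in> {0<..<1} \<and>
     L * h powr s \<ge> \<sigma>1 / sqrt (real m * emp_measure m x (window z h))"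

definition bandwidth ::
  "real \<Rightarrow> real \<Rightarrow> real \<Rightarrow> nat \<Rightarrow> (nat \<Rightarrow> real) \<Rightarrow> real \<Rightarrow> real" where
  "bandwidth s L \<sigma>1 m x z = (LEAST h. admissible_bandwidth s L \<sigma>1 m x z h)"

definition local_matrix :: "nat \<Rightarrow> nat \<Rightarrow> (nat \<Rightarrow> real) \<Rightarrow> real \<Rightarrow> real \<Rightarrow> real Matrix.mat" where
  "local_matrix r m x z h =
     Matrix.mat (r + 1) (r + 1)
       (\<lambda>(a, b). 1 / (real m * emp_measure m x (window z h)) *
          (\<Sum>i=1..m. ((x i - z) / h) ^ (a + b) * indicator (window z h) (x i)))"

definition smallest_eigenvalue :: "real Matrix.mat \<Rightarrow> real" where
  "smallest_eigenvalue A = Min {k. eigenvalue A k}"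

definition local_eigenvalue ::
  "nat \<Rightarrow> real \<Rightarrow> real \<Rightarrow> real \<Rightarrow> nat \<Rightarrow> (nat \<Rightarrow> real) \<Rightarrow> real \<Rightarrow> real" where
  "local_eigenvalue r s L \<sigma>1 m x z =
     smallest_eigenvalue (local_matrix r m x z (bandwidth s L \<sigma>1 m x z))"

definition regular_event ::
  "nat \<Rightarrow> real \<Rightarrow> real \<Rightarrow> real \<Rightarrow> nat \<Rightarrow> (nat \<Rightarrow> real) \<Rightarrow> real \<Rightarrow> bool" where
  "regular_event r s L \<sigma>1 m x z \<longleftrightarrow>
     (\<exists>h. admissible_bandwidth s L \<sigma>1 m x z h) \<and> local_eigenvalue r s L \<sigma>1 m x z > 0"

definition local_criterion ::
  "nat \<Rightarrow> (nat \<Rightarrow> real \<times> real) \<Rightarrow> real \<Rightarrow> real \<Rightarrow> real poly \<Rightarrow> real" where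
  "local_criterion m \<omega> z h p =
     (\<Sum>i=1..m. (snd (\<omega> i) - poly p (fst (\<omega> i) - z))\<^sup>2 * indicator (window z h) (fst (\<omega> i)))"

definition local_fit :: "nat \<Rightarrow> nat \<Rightarrow> (nat \<Rightarrow> real \<times> real) \<Rightarrow> real \<Rightarrow> real \<Rightarrow> real poly" where
  "local_fit r m \<omega> z h =
     (THE p. degree p \<le> r \<and>
        (\<forall>q. degree q \<le> r \<longrightarrow> local_criterion m \<omega> z h p \<le> local_criterion m \<omega> z h q))"

definition local_poly_estimator ::
  "nat \<Rightarrow> real \<Rightarrow> real \<Rightarrow> real \<Rightarrow> nat \<Rightarrow> (nat \<Rightarrow> real \<times> real) \<Rightarrow> real \<Rightarrow> real" where
  "local_poly_estimator r s L \<sigma>1 m \<omega> z =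
     (if regular_event r s L \<sigma>1 m (design \<omega>) z
      then poly (local_fit r m \<omega> z (bandwidth s L \<sigma>1 m (design \<omega>) z)) 0
      else 0)"

definition truncate :: "real \<Rightarrow> real \<Rightarrow> real" where
  "truncate Q u = max (- Q) (min Q u)"

text \<open>All risks are nonnegative integrals, so that no integrability side condition can make
  them vanish.\<close>

definition pointwise_loss ::
  "nat \<Rightarrow> real \<Rightarrow> real \<Rightarrow> real \<Rightarrow> nat \<Rightarrow> (real \<Rightarrow> real) \<Rightarrow> real \<Rightarrow> (nat \<Rightarrow> real \<times> real) \<Rightarrow> ennreal" where
  "pointwise_loss r s L \<sigma>1 m f z \<omega> = ennreal ((local_poly_estimator r s L \<sigma>1 m \<omega> z - f z)\<^sup>2)"

text \<open>The law of \<open>(Y\<^sub>1, \<dots>, Y\<^sub>m)\<close> given \<open>(Z\<^sub>1, \<dots>, Z\<^sub>m) = x\<close>, and the conditional risk given the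
  design computed from it. An abstract conditional expectation is determined only up to a null
  set that may depend on \<open>f\<close>, so its supremum over an uncountable class of functions \<open>f\<close> is
  meaningful only for a fixed family of versions such as this one.\<close>

definition response_law ::
  "(real \<Rightarrow> real) \<Rightarrow> (real \<Rightarrow> real) \<Rightarrow> nat \<Rightarrow> (nat \<Rightarrow> real) \<Rightarrow> (nat \<Rightarrow> real) measure" where
  "response_law \<sigma> f m x =
     (\<Pi>\<^sub>M i\<in>{1..m}. density lborel (\<lambda>y. ennreal (normal_density (f (x i)) (\<sigma> (x i)) y)))"

definition conditional_risk ::
  "nat \<Rightarrow> real \<Rightarrow> real \<Rightarrow> real \<Rightarrow> nat \<Rightarrow> (real \<Rightarrow> real) \<Rightarrow> (real \<Rightarrow> real) \<Rightarrow> real \<Rightarrow> (nat \<Rightarrow> real) \<Rightarrow> ennreal" where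
  "conditional_risk r s L \<sigma>1 m \<sigma> f z x =
     (\<integral>\<^sup>+ y. pointwise_loss r s L \<sigma>1 m f z (\<lambda>i. (x i, y i)) \<partial>response_law \<sigma> f m x)"

definition integrated_risk ::
  "real measure \<Rightarrow> nat \<Rightarrow> real \<Rightarrow> real \<Rightarrow> real \<Rightarrow> real \<Rightarrow> nat \<Rightarrow> (real \<Rightarrow> real) \<Rightarrow> (real \<Rightarrow> real) \<Rightarrow> ennreal" where
  "integrated_risk PZ r s L Q \<sigma>1 m \<sigma> f =
     (\<integral>\<^sup>+ \<omega>. (\<integral>\<^sup>+ z. ennreal ((truncate Q (local_poly_estimator r s L \<sigma>1 m \<omega> z) - f z)\<^sup>2) \<partial>PZ)
        \<partial>sample_law PZ \<sigma> f m)"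

definition fun_support :: "(real \<Rightarrow> real) \<Rightarrow> real set" where
  "fun_support \<mu> = closure {x. \<mu> x \<noteq> 0}"

definition assumption_D :: "real measure \<Rightarrow> bool" where
  "assumption_D PZ \<longleftrightarrow>
     (\<exists>\<mu>. (\<forall>x. 0 \<le> \<mu> x) \<and> continuous_on UNIV \<mu> \<and>
        PZ = density lborel (\<lambda>x. ennreal (\<mu> x)) \<and>
        compact (fun_support \<mu>) \<and>
        finite {z \<in> fun_support \<mu>. \<mu> z = 0} \<and>
        (\<forall>z\<in>fun_support \<mu>. \<mu> z = 0 \<longrightarrow>
           (\<exists>a>0. \<exists>b>0. antimono_on {z - a..z} \<mu> \<and> mono_on {z..z + b} \<mu>)) \<and>
        (\<exists>\<beta>\<ge>0. \<exists>\<gamma>>0. \<forall>I. is_interval I \<and> I \<subseteq> fun_support \<mu> \<longrightarrow>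
           measure PZ I \<ge> \<gamma> * measure lborel I powr (\<beta> + 1)))"

end

theory Submission
  imports Defs
begin

text \<open>Given the design, the local polynomial estimator is linear in the responses:
  \<open>\<Sum>i\<in>W. w\<^sub>i Y\<^sub>i\<close>, where \<open>W\<close> is the set of observations in the window and \<open>w\<close> depends on the
  design only. On the polynomials of degree at most \<open>r\<close>, with the inner product
  \<open>\<Sum>i\<in>W. p(x\<^sub>i - z) q(x\<^sub>i - z)\<close>, the weights are the Riesz representer of evaluation at \<open>0\<close>.
  Two things follow. First, \<open>\<Sum>i\<in>W. w\<^sub>i\<^sup>2\<close> is the best constant \<open>K\<close> in
  \<open>q(0)\<^sup>2 \<le> K (\<Sum>i\<in>W. q(x\<^sub>i - z)\<^sup>2)\<close>. Secondly, the weights reproduce polynomials, so that the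
  bias is the weighted sum of the Taylor remainders of \<open>f\<close>. By Cauchy-Schwarz the conditional
  risk is at most \<open>(L\<^sup>2 H\<^bsup>2s\<^esup> N + \<sigma>1\<^sup>2) K\<close> for a window of width \<open>H\<close> with \<open>N\<close> observations
  (lemma \<open>conditional_risk_le\<close>). The smallest eigenvalue \<open>\<lambda>\<close> of the local matrix gives
  \<open>K = 1 / (N \<lambda>)\<close>, admissibility of \<open>H\<close> gives \<open>\<sigma>1\<^sup>2 \<le> L\<^sup>2 H\<^bsup>2s\<^esup> N\<close>, and the conditional bound
  follows with \<open>\<lambda>\<^bsup>-1\<^esup>\<close>, which is at most \<open>\<lambda>\<^bsup>-2\<^esup>\<close> because \<open>\<lambda> \<le> 1\<close>. That the explicitly
  computed conditional risk is a version of the conditional expectation is a disintegration of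
  the sample law, once the estimator is known to be measurable; Cramer's rule gives the latter.

  For the integrated risk the point is that the best constant \<open>K\<close> decreases when the window
  grows. A constant for a deterministic window of width \<open>h\<close> is therefore valid for the random
  bandwidth \<open>H\<close> as soon as \<open>H > h\<close>. Choose \<open>h\<close> of order \<open>m\<^bsup>-1/(2s+1)\<^esup>\<close> such that
  the expected number of observations in \<open>[z - h, z + h]\<close> is at most half of the number that
  would make \<open>h\<close> admissible; then \<open>H > h\<close> with high probability. On one side of \<open>z\<close> the density
  \<open>\<mu>\<close> is at least \<open>\<mu>(z) / 4\<close>, by continuity or, near a zero, by monotonicity
  (\<open>density_locally_comparable_one_sided\<close>). Cut this half window into \<open>r + 1\<close> separated blocks.
  Each of them contains at least a number \<open>n\<^sub>0\<close> of observations of order \<open>m h \<mu>(z)\<close> with high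
  probability, and Lagrange interpolation with one node per block shows that \<open>K\<close> is of order
  \<open>1 / n\<^sub>0\<close> (\<open>eval_zero_le_blocks\<close>). By Chebyshev's inequality the failure probabilities are of
  order \<open>1 / (m h \<mu>(z))\<close> as well, and the truncated loss is bounded, so the risk at \<open>z\<close> is at most
  \<open>C / (m h \<mu>(z))\<close>. A thin design near a zero of \<open>\<mu>\<close> thus costs the factor \<open>1 / \<mu>(z)\<close>, which
  disappears when the risk is integrated against \<open>\<mu>\<close> over the compact support. What remains is
  \<open>C / (m h)\<close>, of order \<open>m\<^bsup>-2s/(2s+1)\<^esup>\<close>.\<close>

section \<open>The smallest eigenvalue of a symmetric matrix\<close>

lemma scalar_prod_self_nonneg: "0 \<le> scalar_prod (v :: real Matrix.vec) v"
  unfolding scalar_prod_def by (simp add: sum_nonneg)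

lemma square_le_scalar_prod_self:
  assumes "i < dim_vec v"
  shows "(vec_index v i)\<^sup>2 \<le> scalar_prod (v :: real Matrix.vec) v"
  unfolding scalar_prod_def power2_eq_square
  by (rule member_le_sum) (use assms in auto)

lemma scalar_prod_self_eq_0D:
  assumes "v \<in> carrier_vec n" "scalar_prod v v = (0 :: real)"
  shows "v = 0\<^sub>v n"
proof (rule eq_vecI)
  fix i assume "i < dim_vec (0\<^sub>v n :: real Matrix.vec)"
  then show "vec_index v i = vec_index (0\<^sub>v n) i"
    using square_le_scalar_prod_self[of i v] assms by simp
qed (use assms in simp)

lemma quadratic_form_bounded:
  fixes C :: "real Matrix.mat"
  assumes C: "C \<in> carrier_mat n n"
  obtains K where "K > 0" "\<And>v. v \<in> carrier_vec n \<Longrightarrow> scalar_prod v (C *\<^sub>v v) \<le> K * scalar_prod v v"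
proof
  define K where "K = 1 + (\<Sum>i<n. \<Sum>j<n. \<bar>C $$ (i, j)\<bar>)"
  show "K > 0" unfolding K_def by (intro add_pos_nonneg sum_nonneg) auto
  fix v :: "real Matrix.vec" assume v: "v \<in> carrier_vec n"
  have prod: "\<bar>vec_index v i * vec_index v j\<bar> \<le> scalar_prod v v" if "i < n" "j < n" for i j
  proof -
    have "2 * \<bar>vec_index v i * vec_index v j\<bar> \<le> (vec_index v i)\<^sup>2 + (vec_index v j)\<^sup>2"
      using sum_squares_bound[of "\<bar>vec_index v i\<bar>" "\<bar>vec_index v j\<bar>"] by (simp add: abs_mult)
    also have "\<dots> \<le> scalar_prod v v + scalar_prod v v"
      using v that by (intro add_mono square_le_scalar_prod_self) auto
    finally show ?thesis by simp
  qed
  have "scalar_prod v (C *\<^sub>v v) = (\<Sum>i<n. \<Sum>j<n. C $$ (i, j) * (vec_index v i * vec_index v j))"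
    using v C by (auto simp: scalar_prod_def sum_distrib_left atLeast0LessThan intro!: sum.cong)
  also have "\<dots> \<le> (\<Sum>i<n. \<Sum>j<n. \<bar>C $$ (i, j)\<bar> * scalar_prod v v)"
  proof (intro sum_mono)
    fix i j assume "i \<in> {..<n}" "j \<in> {..<n}"
    then have "\<bar>C $$ (i, j)\<bar> * \<bar>vec_index v i * vec_index v j\<bar> \<le> \<bar>C $$ (i, j)\<bar> * scalar_prod v v"
      by (intro mult_left_mono prod) auto
    then show "C $$ (i, j) * (vec_index v i * vec_index v j) \<le> \<bar>C $$ (i, j)\<bar> * scalar_prod v v"
      by (metis abs_ge_self abs_mult order_trans)
  qed
  also have "\<dots> = (\<Sum>i<n. \<Sum>j<n. \<bar>C $$ (i, j)\<bar>) * scalar_prod v v"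
    by (simp add: sum_distrib_right)
  also have "\<dots> \<le> K * scalar_prod v v"
    unfolding K_def using scalar_prod_self_nonneg[of v] by (simp add: algebra_simps)
  finally show "scalar_prod v (C *\<^sub>v v) \<le> K * scalar_prod v v" .
qed

text \<open>Expand the nonnegative number \<open>(t y - v) \<bullet> B (t y - v)\<close> with \<open>B y = v\<close>. It equals
  \<open>t\<^sup>2 (y \<bullet> v) - 2 t (v \<bullet> v) + v \<bullet> B v\<close>, and \<open>y \<bullet> v\<close> is bounded by a multiple \<open>K\<close> of \<open>v \<bullet> v\<close>
  because \<open>y\<close> depends linearly on \<open>v\<close>; now take \<open>t = 1 / K\<close>.\<close>

lemma coercive_if_semidefinite_nonsingular:
  fixes B :: "real Matrix.mat"
  assumes B: "B \<in> carrier_mat n n" and sym: "transpose_mat B = B"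
    and det: "Determinant.det B \<noteq> 0"
    and psd: "\<And>v. v \<in> carrier_vec n \<Longrightarrow> 0 \<le> scalar_prod v (B *\<^sub>v v)"
  obtains e where "e > 0" "\<And>v. v \<in> carrier_vec n \<Longrightarrow> e * scalar_prod v v \<le> scalar_prod v (B *\<^sub>v v)"
proof -
  define C where "C = (1 / Determinant.det B) \<cdot>\<^sub>m adj_mat B"
  have C: "C \<in> carrier_mat n n"
    using adj_mat(1)[OF B] unfolding C_def by simp
  have "B * C = (1 / Determinant.det B) \<cdot>\<^sub>m (Determinant.det B \<cdot>\<^sub>m 1\<^sub>m n)"
    unfolding C_def adj_mat(2)[OF B, symmetric] by (rule mult_smult_distrib[OF B adj_mat(1)[OF B]])
  then have BC: "B * C = 1\<^sub>m n"
    using det by (auto intro!: eq_matI)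
  obtain K where K: "K > 0" "\<And>v. v \<in> carrier_vec n \<Longrightarrow> scalar_prod v (C *\<^sub>v v) \<le> K * scalar_prod v v"
    using quadratic_form_bounded[OF C] by blast
  show thesis
  proof
    show "1 / K > 0" using K by simp
    fix v :: "real Matrix.vec" assume v: "v \<in> carrier_vec n"
    define y where "y = C *\<^sub>v v"
    define t where "t = 1 / K"
    have y: "y \<in> carrier_vec n" unfolding y_def using C v by simp
    have By: "B *\<^sub>v y = v"
      unfolding y_def using assoc_mult_mat_vec[OF B C v] BC v by simp
    have cross: "scalar_prod y (B *\<^sub>v v) = scalar_prod v v"
      using transpose_vec_mult_scalar[OF B v y] y v sym By by simp
    \<comment> \<open>The vector \<open>w\<close> stands for \<open>B v\<close>.\<close>
    have expand: "scalar_prod (t \<cdot>\<^sub>v y - v) (t \<cdot>\<^sub>v v - w)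
        = t * (t * scalar_prod y v) - t * scalar_prod y w
          - (t * scalar_prod v v - scalar_prod v w)" if "w \<in> carrier_vec n" for w
      using y v that
      by (simp add: scalar_prod_def sum_distrib_left flip: sum_subtractf) (auto simp: algebra_simps intro!: sum.cong)
    have "0 \<le> scalar_prod (t \<cdot>\<^sub>v y - v) (B *\<^sub>v (t \<cdot>\<^sub>v y - v))"
      using y v by (intro psd) auto
    also have "B *\<^sub>v (t \<cdot>\<^sub>v y - v) = t \<cdot>\<^sub>v v - B *\<^sub>v v"
      using y v B By by (simp add: mult_minus_distrib_mat_vec[OF B] mult_mat_vec[OF B])
    also have "scalar_prod (t \<cdot>\<^sub>v y - v) (t \<cdot>\<^sub>v v - B *\<^sub>v v)
        = t * (t * scalar_prod y v) - t * scalar_prod y (B *\<^sub>v v)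
          - (t * scalar_prod v v - scalar_prod v (B *\<^sub>v v))"
      using v B by (intro expand) simp
    finally have main: "2 * t * scalar_prod v v \<le> t * (t * scalar_prod y v) + scalar_prod v (B *\<^sub>v v)"
      using cross by simp
    have "scalar_prod y v \<le> K * scalar_prod v v"
      using K(2)[OF v] comm_scalar_prod[OF y v] unfolding y_def by simp
    then have "t * (t * scalar_prod y v) \<le> t * (t * (K * scalar_prod v v))"
      using K(1) unfolding t_def by (intro mult_left_mono) auto
    also have "\<dots> = t * scalar_prod v v" unfolding t_def using K(1) by simp
    finally show "1 / K * scalar_prod v v \<le> scalar_prod v (B *\<^sub>v v)"
      using main unfolding t_def by simp
  qed
qed

lemma quadratic_form_char_matrix:
  fixes A :: "real Matrix.mat"
  assumes A: "A \<in> carrier_mat n n" and v: "v \<in> carrier_vec n"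
  shows "scalar_prod v (char_matrix A e *\<^sub>v v) = scalar_prod v (A *\<^sub>v v) - e * scalar_prod v v"
proof -
  have "char_matrix A e *\<^sub>v v = A *\<^sub>v v + (- e) \<cdot>\<^sub>v v"
    using A v unfolding char_matrix_def
    by (auto simp: add_mult_distrib_mat_vec[of _ n n] intro!: eq_vecI)
  then show ?thesis
    using A v by (simp add: scalar_prod_add_distrib[of _ n] scalar_prod_smult_distrib[of _ n])
qed

text \<open>Let \<open>\<mu>\<close> be the largest \<open>t\<close> for which \<open>A - t I\<close> is positive semidefinite. If \<open>A - \<mu> I\<close> were
  nonsingular, it would be coercive and \<open>\<mu>\<close> could be increased. So \<open>\<mu>\<close> is an eigenvalue, and the
  quadratic form shows that no eigenvalue lies below it. In particular the set of eigenvalues is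
  nonempty, so that its minimum is meaningful.\<close>

proposition symmetric_mat_smallest_eigenvalue:
  fixes A :: "real Matrix.mat"
  assumes A: "A \<in> carrier_mat n n" and n: "n > 0" and sym: "transpose_mat A = A"
  shows "eigenvalue A (smallest_eigenvalue A)"
    and "\<And>k. eigenvalue A k \<Longrightarrow> smallest_eigenvalue A \<le> k"
    and "\<And>v. v \<in> carrier_vec n \<Longrightarrow>
           smallest_eigenvalue A * scalar_prod v v \<le> scalar_prod v (A *\<^sub>v v)"
proof -
  define S where "S = {t. \<forall>v\<in>carrier_vec n. t * scalar_prod v v \<le> scalar_prod v (A *\<^sub>v v)}"
  define \<mu> where "\<mu> = Sup S"
  obtain K where K: "K > 0"
    "\<And>v. v \<in> carrier_vec n \<Longrightarrow> scalar_prod v ((- A) *\<^sub>v v) \<le> K * scalar_prod v v"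
    using quadratic_form_bounded[of "- A" n] A by auto
  have "- K \<in> S"
    unfolding S_def using K(2) A by (force simp: uminus_mult_mat_vec)
  then have ne: "S \<noteq> {}" by auto
  have bdd: "bdd_above S"
  proof
    fix t assume "t \<in> S"
    then have "t * scalar_prod (unit_vec n 0) (unit_vec n 0)
        \<le> scalar_prod (unit_vec n 0) (A *\<^sub>v unit_vec n 0)"
      unfolding S_def by auto
    then show "t \<le> scalar_prod (unit_vec n 0) (A *\<^sub>v unit_vec n 0)"
      using n by simp
  qed
  have \<mu>: "\<mu> \<in> S"
    unfolding S_def
  proof (intro CollectI ballI)
    fix v :: "real Matrix.vec" assume v: "v \<in> carrier_vec n"
    show "\<mu> * scalar_prod v v \<le> scalar_prod v (A *\<^sub>v v)"
    proof (cases "scalar_prod v v = 0")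
      case True
      then show ?thesis using \<open>- K \<in> S\<close> v unfolding S_def by force
    next
      case False
      then have pos: "scalar_prod v v > 0" using scalar_prod_self_nonneg[of v] by simp
      have "\<mu> \<le> scalar_prod v (A *\<^sub>v v) / scalar_prod v v"
        unfolding \<mu>_def using v pos by (intro cSup_least[OF ne]) (auto simp: S_def pos_le_divide_eq)
      then show ?thesis using pos by (simp add: pos_le_divide_eq)
    qed
  qed
  have ev: "eigenvalue A \<mu>"
  proof (rule ccontr)
    assume "\<not> eigenvalue A \<mu>"
    then have det: "Determinant.det (char_matrix A \<mu>) \<noteq> 0" using eigenvalue_det[OF A] by simp
    have carr: "char_matrix A \<mu> \<in> carrier_mat n n" using A by simp
    have sym': "transpose_mat (char_matrix A \<mu>) = char_matrix A \<mu>"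
    proof (rule eq_matI)
      fix i j assume ij: "i < dim_row (char_matrix A \<mu>)" "j < dim_col (char_matrix A \<mu>)"
      have "A $$ (j, i) = A $$ (i, j)"
        using arg_cong[OF sym, of "\<lambda>M. M $$ (i, j)"] ij A by (simp add: char_matrix_def)
      then show "transpose_mat (char_matrix A \<mu>) $$ (i, j) = char_matrix A \<mu> $$ (i, j)"
        using ij A by (auto simp: char_matrix_def)
    qed (use A in \<open>auto simp: char_matrix_def\<close>)
    have psd: "0 \<le> scalar_prod v (char_matrix A \<mu> *\<^sub>v v)" if "v \<in> carrier_vec n" for v
      using \<mu> that unfolding S_def by (simp add: quadratic_form_char_matrix[OF A])
    obtain e where e: "e > 0"
      "\<And>v. v \<in> carrier_vec n \<Longrightarrow> e * scalar_prod v v \<le> scalar_prod v (char_matrix A \<mu> *\<^sub>v v)"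
      using coercive_if_semidefinite_nonsingular[OF carr sym' det psd] by blast
    have "\<mu> + e \<in> S"
      unfolding S_def using e(2) by (auto simp: quadratic_form_char_matrix[OF A] algebra_simps)
    then have "\<mu> + e \<le> \<mu>" unfolding \<mu>_def by (rule cSup_upper[OF _ bdd])
    with e(1) show False by simp
  qed
  have low: "\<mu> \<le> k" if "eigenvalue A k" for k
  proof -
    obtain v where v: "v \<in> carrier_vec n" "v \<noteq> 0\<^sub>v n" "A *\<^sub>v v = k \<cdot>\<^sub>v v"
      using \<open>eigenvalue A k\<close> A unfolding eigenvalue_def eigenvector_def by auto
    have "\<mu> * scalar_prod v v \<le> k * scalar_prod v v"
      using \<mu> v unfolding S_def by (force simp: scalar_prod_smult_distrib[of _ n])
    moreover have "scalar_prod v v \<noteq> 0"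
      using scalar_prod_self_eq_0D[OF v(1)] v(2) by blast
    ultimately show ?thesis using scalar_prod_self_nonneg[of v] by simp
  qed
  have "char_poly A \<noteq> 0"
    using degree_monic_char_poly[OF A] by auto
  then have "finite {k. eigenvalue A k}"
    unfolding eigenvalue_root_char_poly[OF A] by (rule poly_roots_finite)
  then have eq: "smallest_eigenvalue A = \<mu>"
    unfolding smallest_eigenvalue_def using ev low by (intro Min_eqI) auto
  show "eigenvalue A (smallest_eigenvalue A)" using ev eq by simp
  show "smallest_eigenvalue A \<le> k" if "eigenvalue A k" for k using low[OF that] eq by simp
  show "smallest_eigenvalue A * scalar_prod v v \<le> scalar_prod v (A *\<^sub>v v)"
    if "v \<in> carrier_vec n" for v
    using \<mu> that eq unfolding S_def by auto
qed

section \<open>The local matrix\<close>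

definition active :: "nat \<Rightarrow> (nat \<Rightarrow> real) \<Rightarrow> real \<Rightarrow> real \<Rightarrow> nat set" where
  "active m x z h = {i \<in> {1..m}. \<bar>x i - z\<bar> \<le> h}"

lemma finite_active [simp]: "finite (active m x z h)"
  unfolding active_def by simp

lemma in_window_iff: "t \<in> window z h \<longleftrightarrow> \<bar>t - z\<bar> \<le> h"
  unfolding window_def by auto

lemma sum_window_eq_active:
  fixes g :: "nat \<Rightarrow> real"
  shows "(\<Sum>i=1..m. g i * indicator (window z h) (x i)) = (\<Sum>i\<in>active m x z h. g i)"
  unfolding active_def
  by (intro sum.mono_neutral_cong_right) (auto simp: indicator_def in_window_iff)

lemma emp_count: "real m * emp_measure m x (window z h) = real (card (active m x z h))"
  using sum_window_eq_active[of "\<lambda>_. 1" z h x m]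
  by (cases "m = 0") (simp_all add: emp_measure_def active_def)

lemma active_mono: "h \<le> h' \<Longrightarrow> active m x z h \<subseteq> active m x z h'"
  unfolding active_def by auto

lemma local_matrix_carrier [simp]: "local_matrix r m x z h \<in> carrier_mat (r + 1) (r + 1)"
  unfolding local_matrix_def by simp

lemma local_matrix_dims [simp]:
  "dim_row (local_matrix r m x z h) = r + 1" "dim_col (local_matrix r m x z h) = r + 1"
  unfolding local_matrix_def by simp_all

lemma local_matrix_entry:
  assumes "a \<le> r" "b \<le> r"
  shows "local_matrix r m x z h $$ (a, b) =
    (\<Sum>i\<in>active m x z h. ((x i - z) / h) ^ (a + b)) / real (card (active m x z h))"
  unfolding local_matrix_def emp_count sum_window_eq_active using assms by simp

lemma local_matrix_symmetric: "transpose_mat (local_matrix r m x z h) = local_matrix r m x z h"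
  by (rule eq_matI) (auto simp: local_matrix_entry add.commute)

lemma poly_eq_scaled_sum:
  fixes p :: "real poly"
  assumes "degree p \<le> r" "h \<noteq> 0"
  shows "poly p t = (\<Sum>a\<le>r. coeff p a * h ^ a * (t / h) ^ a)"
proof -
  have "poly p t = (\<Sum>a\<le>degree p. coeff p a * t ^ a)" by (rule poly_altdef)
  also have "\<dots> = (\<Sum>a\<le>r. coeff p a * t ^ a)"
    using assms(1) by (intro sum.mono_neutral_left) (auto simp: coeff_eq_0)
  finally show ?thesis using assms(2) by (simp add: power_divide)
qed

text \<open>The local matrix is the Gram matrix of the monomials in \<open>(x\<^sub>i - z) / h\<close>, whereas the fitted
  polynomials are polynomials in \<open>x\<^sub>i - z\<close>. The two following maps change between the coordinates.\<close>

definition scaled_coeffs :: "nat \<Rightarrow> real \<Rightarrow> real poly \<Rightarrow> real Matrix.vec" where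
  "scaled_coeffs r h p = Matrix.vec (r + 1) (\<lambda>a. coeff p a * h ^ a)"

definition scaled_poly :: "nat \<Rightarrow> real \<Rightarrow> (nat \<Rightarrow> real) \<Rightarrow> real poly" where
  "scaled_poly r h c = (\<Sum>a\<le>r. monom (c a / h ^ a) a)"

lemma degree_scaled_poly: "degree (scaled_poly r h c) \<le> r"
  unfolding scaled_poly_def
  by (intro degree_sum_le) (auto intro: order_trans[OF degree_monom_le])

lemma poly_scaled_poly: "poly (scaled_poly r h c) t = (\<Sum>a\<le>r. c a * (t / h) ^ a)"
  unfolding scaled_poly_def by (simp add: poly_sum poly_monom power_divide)

lemma coeff_scaled_poly: "a \<le> r \<Longrightarrow> coeff (scaled_poly r h c) a = c a / h ^ a"
  unfolding scaled_poly_def by (simp add: coeff_sum)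

lemma scaled_coeffs_carrier [simp]: "scaled_coeffs r h p \<in> carrier_vec (r + 1)"
  unfolding scaled_coeffs_def by simp

lemma scaled_coeffs_scaled_poly:
  assumes "v \<in> carrier_vec (r + 1)" "h \<noteq> 0"
  shows "scaled_coeffs r h (scaled_poly r h (vec_index v)) = v"
  using assms by (auto simp: scaled_coeffs_def coeff_scaled_poly)

lemma local_matrix_quadratic_form:
  assumes "degree p \<le> r" "h \<noteq> 0"
  shows "scalar_prod (scaled_coeffs r h p) (local_matrix r m x z h *\<^sub>v scaled_coeffs r h p)
    = (\<Sum>i\<in>active m x z h. (poly p (x i - z))\<^sup>2) / real (card (active m x z h))"
proof -
  let ?A = "active m x z h"
  let ?c = "\<lambda>a. coeff p a * h ^ a"
  let ?u = "\<lambda>i. (x i - z) / h"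
  have "scalar_prod (scaled_coeffs r h p) (local_matrix r m x z h *\<^sub>v scaled_coeffs r h p)
      = (\<Sum>a\<le>r. ?c a * (\<Sum>b\<le>r. local_matrix r m x z h $$ (a, b) * ?c b))"
    by (simp add: scalar_prod_def scaled_coeffs_def atLeast0LessThan lessThan_Suc_atMost)
  also have "\<dots> = (\<Sum>a\<le>r. \<Sum>b\<le>r. \<Sum>i\<in>?A. ?c a * ?u i ^ a * (?c b * ?u i ^ b) / real (card ?A))"
    by (intro sum.cong refl)
      (simp add: local_matrix_entry sum_distrib_left sum_distrib_right sum_divide_distrib power_add mult_ac)
  also have "\<dots> = (\<Sum>i\<in>?A. (\<Sum>a\<le>r. \<Sum>b\<le>r. ?c a * ?u i ^ a * (?c b * ?u i ^ b)) / real (card ?A))"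
  proof -
    have "(\<Sum>a\<le>r. \<Sum>b\<le>r. \<Sum>i\<in>?A. f a b i) = (\<Sum>i\<in>?A. \<Sum>a\<le>r. \<Sum>b\<le>r. f a b i)" for f :: "nat \<Rightarrow> nat \<Rightarrow> nat \<Rightarrow> real"
      using sum.swap[of "\<lambda>a i. \<Sum>b\<le>r. f a b i" ?A "{..r}"] sum.swap[of "f _" ?A "{..r}"] by simp
    then show ?thesis unfolding sum_divide_distrib .
  qed
  also have "\<dots> = (\<Sum>i\<in>?A. (poly p (x i - z))\<^sup>2 / real (card ?A))"
    unfolding poly_eq_scaled_sum[OF assms] power2_eq_square sum_product ..
  finally show ?thesis by (simp add: sum_divide_distrib)
qed

lemma scalar_prod_scaled_coeffs:
  "scalar_prod (scaled_coeffs r h p) (scaled_coeffs r h p) = (\<Sum>a\<le>r. (coeff p a * h ^ a)\<^sup>2)"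
  by (simp add: scalar_prod_def scaled_coeffs_def atLeast0LessThan lessThan_Suc_atMost power2_eq_square)

text \<open>The Rayleigh bound for the local matrix, in terms of polynomials.\<close>

lemma local_matrix_eigenvalue_bound:
  assumes "degree p \<le> r" "h \<noteq> 0"
  shows "smallest_eigenvalue (local_matrix r m x z h) * (\<Sum>a\<le>r. (coeff p a * h ^ a)\<^sup>2)
    \<le> (\<Sum>i\<in>active m x z h. (poly p (x i - z))\<^sup>2) / real (card (active m x z h))"
  using symmetric_mat_smallest_eigenvalue(3)[OF local_matrix_carrier[of r m x z h] _ local_matrix_symmetric
      scaled_coeffs_carrier[of r h p]]
  unfolding local_matrix_quadratic_form[OF assms] scalar_prod_scaled_coeffs by simp

text \<open>A Gram matrix has nonnegative eigenvalues, so that only singularity can prevent positivity.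
  The determinant, unlike the smallest eigenvalue, is visibly a measurable function of the design.\<close>

lemma smallest_eigenvalue_local_matrix_pos_iff:
  assumes h: "h \<noteq> 0"
  shows "smallest_eigenvalue (local_matrix r m x z h) > 0
    \<longleftrightarrow> Determinant.det (local_matrix r m x z h) \<noteq> 0" (is "?ev > 0 \<longleftrightarrow> _")
proof -
  let ?M = "local_matrix r m x z h"
  note spec = symmetric_mat_smallest_eigenvalue[OF local_matrix_carrier[of r m x z h] _ local_matrix_symmetric]
  have zero: "eigenvalue ?M 0 \<longleftrightarrow> Determinant.det ?M = 0"
    unfolding eigenvalue_det[OF local_matrix_carrier]
    by (rule arg_cong[where f = "\<lambda>A. Determinant.det A = 0"]) (auto simp: char_matrix_def intro!: eq_matI)
  have "?ev \<ge> 0"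
  proof -
    obtain v where v: "v \<in> carrier_vec (r + 1)" "v \<noteq> 0\<^sub>v (r + 1)" "?M *\<^sub>v v = ?ev \<cdot>\<^sub>v v"
      using spec(1) unfolding eigenvalue_def eigenvector_def by auto
    define p where "p = scaled_poly r h (vec_index v)"
    have vp: "v = scaled_coeffs r h p" unfolding p_def using scaled_coeffs_scaled_poly[OF v(1) h] by simp
    have "?ev * scalar_prod v v = scalar_prod v (?M *\<^sub>v v)"
      unfolding v(3) using v(1) by simp
    also have "\<dots> \<ge> 0"
      unfolding vp by (subst local_matrix_quadratic_form) (auto simp: h p_def degree_scaled_poly sum_nonneg)
    finally have "?ev * scalar_prod v v \<ge> 0" .
    moreover have "scalar_prod v v > 0"
      using scalar_prod_self_eq_0D[OF v(1)] v(2) scalar_prod_self_nonneg[of v] by fastforce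
    ultimately show ?thesis by (simp add: zero_le_mult_iff)
  qed
  moreover have "?ev = 0 \<Longrightarrow> eigenvalue ?M 0" using spec(1) by simp
  moreover have "eigenvalue ?M 0 \<Longrightarrow> ?ev \<le> 0" using spec(2) by simp
  ultimately show ?thesis using zero by force
qed

lemma det_local_matrix_nonzero:
  assumes h: "h \<noteq> 0"
    and "active m x z h \<noteq> {}"
    and inj: "\<And>p. degree p \<le> r \<Longrightarrow> \<forall>i\<in>active m x z h. poly p (x i - z) = 0 \<Longrightarrow> p = 0"
  shows "Determinant.det (local_matrix r m x z h) \<noteq> 0"
proof
  assume "Determinant.det (local_matrix r m x z h) = 0"
  then obtain v where v: "v \<in> carrier_vec (r + 1)" "v \<noteq> 0\<^sub>v (r + 1)"
    "local_matrix r m x z h *\<^sub>v v = 0\<^sub>v (r + 1)"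
    using det_0_iff_vec_prod_zero[OF local_matrix_carrier] by auto
  define p where "p = scaled_poly r h (vec_index v)"
  have vp: "v = scaled_coeffs r h p" unfolding p_def using scaled_coeffs_scaled_poly[OF v(1) h] by simp
  have deg: "degree p \<le> r" unfolding p_def by (rule degree_scaled_poly)
  have "(\<Sum>i\<in>active m x z h. (poly p (x i - z))\<^sup>2) / real (card (active m x z h)) = 0"
    unfolding local_matrix_quadratic_form[OF deg h, symmetric] vp[symmetric] v(3) using v(1) by simp
  then have "\<forall>i\<in>active m x z h. poly p (x i - z) = 0"
    using assms(2) by (simp add: sum_nonneg_eq_0_iff)
  then have "p = 0" using inj deg by blast
  then show False using v(2) unfolding vp scaled_coeffs_def by (auto simp: zero_vec_def)
qed

section \<open>The estimator as a weighted sum of the responses\<close>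

text \<open>The first row of the inverse of the local matrix, by Cramer's rule, applied to the monomials at
  the \<open>i\<close>-th observation and divided by the number of observations in the window.\<close>

definition local_weight :: "nat \<Rightarrow> nat \<Rightarrow> (nat \<Rightarrow> real) \<Rightarrow> real \<Rightarrow> real \<Rightarrow> nat \<Rightarrow> real" where
  "local_weight r m x z h i =
     (\<Sum>b\<le>r. adj_mat (local_matrix r m x z h) $$ (0, b) * ((x i - z) / h) ^ b)
       / (Determinant.det (local_matrix r m x z h) * real (card (active m x z h)))"

locale nondegenerate_window =
  fixes r m :: nat and x :: "nat \<Rightarrow> real" and z h :: real
  assumes h_pos: "h > 0"
    and det_nz: "Determinant.det (local_matrix r m x z h) \<noteq> 0"
begin

abbreviation "W \<equiv> active m x z h"
abbreviation "N \<equiv> real (card W)"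
abbreviation "M \<equiv> local_matrix r m x z h"
abbreviation "ev_min \<equiv> smallest_eigenvalue M"

lemma eigenvalue_pos: "ev_min > 0"
  using det_nz smallest_eigenvalue_local_matrix_pos_iff[of h r m x z] h_pos by simp

lemma N_pos: "N > 0"
proof (rule ccontr)
  assume "\<not> N > 0"
  then have "ev_min * (\<Sum>a\<le>r. (coeff (1::real poly) a * h ^ a)\<^sup>2) \<le> 0"
    using local_matrix_eigenvalue_bound[of 1 r h m x z] h_pos by simp
  moreover have "(\<Sum>a\<le>r. (coeff (1::real poly) a * h ^ a)\<^sup>2) \<ge> (coeff (1::real poly) 0 * h ^ 0)\<^sup>2"
    by (intro member_le_sum) auto
  ultimately show False using eigenvalue_pos by (simp add: mult_le_0_iff)
qed

lemma eval_zero_le_eigenvalue: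
  assumes "degree p \<le> r"
  shows "(poly p 0)\<^sup>2 \<le> 1 / (N * ev_min) * (\<Sum>i\<in>W. (poly p (x i - z))\<^sup>2)"
proof -
  have "(coeff p 0 * h ^ 0)\<^sup>2 \<le> (\<Sum>a\<le>r. (coeff p a * h ^ a)\<^sup>2)"
    by (intro member_le_sum) auto
  then have "ev_min * (poly p 0)\<^sup>2 \<le> ev_min * (\<Sum>a\<le>r. (coeff p a * h ^ a)\<^sup>2)"
    using eigenvalue_pos by (intro mult_left_mono) (auto simp: poly_0_coeff_0)
  also have "\<dots> \<le> (\<Sum>i\<in>W. (poly p (x i - z))\<^sup>2) / N"
    using local_matrix_eigenvalue_bound[OF assms] h_pos by simp
  finally show ?thesis using eigenvalue_pos N_pos by (simp add: field_simps)
qed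

lemma eigenvalue_le_1: "ev_min \<le> 1"
  using eval_zero_le_eigenvalue[of 1] N_pos eigenvalue_pos
  by (auto simp: field_simps split: if_splits)

lemma window_definite:
  assumes "degree p \<le> r" "(\<Sum>i\<in>W. (poly p (x i - z))\<^sup>2) = 0"
  shows "p = 0"
proof (rule poly_eqI)
  fix a
  show "coeff p a = coeff 0 a"
  proof (cases "a \<le> r")
    case True
    have "ev_min * (\<Sum>a\<le>r. (coeff p a * h ^ a)\<^sup>2) \<le> 0"
      using local_matrix_eigenvalue_bound[OF assms(1), of h m x z] h_pos assms(2) by simp
    moreover have "(coeff p a * h ^ a)\<^sup>2 \<le> (\<Sum>a\<le>r. (coeff p a * h ^ a)\<^sup>2)"
      using True by (intro member_le_sum) auto
    ultimately have "(coeff p a * h ^ a)\<^sup>2 \<le> 0"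
      using eigenvalue_pos by (smt (verit) mult_pos_pos)
    then show ?thesis using h_pos by simp
  qed (use assms(1) in \<open>simp add: coeff_eq_0\<close>)
qed

abbreviation "w \<equiv> local_weight r m x z h"

definition weight_poly :: "real poly" where
  "weight_poly = scaled_poly r h (\<lambda>b. adj_mat M $$ (0, b) / (Determinant.det M * N))"

lemma degree_weight_poly: "degree weight_poly \<le> r"
  unfolding weight_poly_def by (rule degree_scaled_poly)

lemma weight_eq_poly: "w i = poly weight_poly (x i - z)"
  unfolding weight_poly_def local_weight_def poly_scaled_poly
  by (simp add: sum_divide_distrib)

lemma weights_reproduce:
  assumes q: "degree q \<le> r"
  shows "(\<Sum>i\<in>W. w i * poly q (x i - z)) = poly q 0"
proof -
  let ?u = "\<lambda>i. (x i - z) / h"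
  have mono: "(\<Sum>i\<in>W. w i * ?u i ^ c) = (if c = 0 then 1 else 0)" if c: "c \<le> r" for c
  proof -
    have "(\<Sum>i\<in>W. w i * ?u i ^ c)
        = (\<Sum>i\<in>W. \<Sum>b\<le>r. adj_mat M $$ (0, b) * ?u i ^ (b + c) / (Determinant.det M * N))"
      unfolding local_weight_def
      by (simp add: sum_divide_distrib sum_distrib_right sum_distrib_left power_add mult_ac)
    also have "\<dots> = (\<Sum>b\<le>r. adj_mat M $$ (0, b) * M $$ (b, c)) / Determinant.det M"
      using c by (subst sum.swap) (simp add: local_matrix_entry sum_distrib_left sum_divide_distrib mult_ac)
    also have "(\<Sum>b\<le>r. adj_mat M $$ (0, b) * M $$ (b, c)) = (adj_mat M * M) $$ (0, c)"
      using c adj_mat(1)[OF local_matrix_carrier[of r m x z h]]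
      by (auto simp: scalar_prod_def atLeast0LessThan lessThan_Suc_atMost intro!: sum.cong)
    also have "\<dots> = (if c = 0 then Determinant.det M else 0)"
      unfolding adj_mat(3)[OF local_matrix_carrier] using c by auto
    finally show ?thesis using det_nz by simp
  qed
  have "(\<Sum>i\<in>W. w i * poly q (x i - z)) = (\<Sum>i\<in>W. \<Sum>c\<le>r. coeff q c * h ^ c * (w i * ?u i ^ c))"
    using poly_eq_scaled_sum[OF q, of h] h_pos by (simp add: sum_distrib_left mult_ac)
  also have "\<dots> = (\<Sum>c\<le>r. coeff q c * h ^ c * (\<Sum>i\<in>W. w i * ?u i ^ c))"
    by (subst sum.swap) (simp add: sum_distrib_left)
  also have "\<dots> = (\<Sum>c\<le>r. if c = 0 then coeff q c * h ^ c else 0)"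
    by (intro sum.cong) (auto simp: mono)
  also have "\<dots> = poly q 0" by (simp add: poly_0_coeff_0)
  finally show ?thesis .
qed

text \<open>The weights represent evaluation at \<open>0\<close>, so their squared norm is the value at \<open>0\<close> of
  \<open>weight_poly\<close>; the assumption on \<open>K\<close>, applied to \<open>weight_poly\<close> itself, bounds this value.\<close>

lemma sum_weights_squared_le:
  assumes K: "\<And>q. degree q \<le> r \<Longrightarrow> (poly q 0)\<^sup>2 \<le> K * (\<Sum>i\<in>W. (poly q (x i - z))\<^sup>2)"
  shows "(\<Sum>i\<in>W. (w i)\<^sup>2) \<le> K"
proof -
  let ?S = "\<Sum>i\<in>W. (w i)\<^sup>2"
  have "?S = poly weight_poly 0"
    using weights_reproduce[OF degree_weight_poly]
    by (simp add: weight_eq_poly power2_eq_square)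
  then have "?S\<^sup>2 \<le> K * ?S"
    using K[OF degree_weight_poly] by (simp add: weight_eq_poly)
  moreover have "?S \<ge> 0" by (simp add: sum_nonneg)
  moreover have "K \<ge> 0" if "?S = 0"
  proof -
    have "1 \<le> K * N" using K[of 1] by simp
    then show ?thesis using N_pos by (smt (verit) mult_neg_pos)
  qed
  ultimately show ?thesis by (cases "?S = 0") (auto simp: power2_eq_square)
qed

lemma normal_equations:
  obtains p where "degree p \<le> r"
    "\<And>q. degree q \<le> r \<Longrightarrow> (\<Sum>i\<in>W. (Y i - poly p (x i - z)) * poly q (x i - z)) = 0"
proof -
  let ?u = "\<lambda>i. (x i - z) / h"
  define \<beta> where "\<beta> = Matrix.vec (r + 1) (\<lambda>b. (\<Sum>i\<in>W. Y i * ?u i ^ b) / N)"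
  define \<theta> where "\<theta> = (1 / Determinant.det M) \<cdot>\<^sub>v (adj_mat M *\<^sub>v \<beta>)"
  define p where "p = scaled_poly r h (vec_index \<theta>)"
  have \<beta>: "\<beta> \<in> carrier_vec (r + 1)" unfolding \<beta>_def by simp
  have adj: "adj_mat M \<in> carrier_mat (r + 1) (r + 1)" by (rule adj_mat(1)[OF local_matrix_carrier])
  have \<theta>: "\<theta> \<in> carrier_vec (r + 1)" unfolding \<theta>_def using adj \<beta> by simp
  have "M *\<^sub>v \<theta> = (1 / Determinant.det M) \<cdot>\<^sub>v ((M * adj_mat M) *\<^sub>v \<beta>)"
    unfolding \<theta>_def using adj \<beta>
    by (subst mult_mat_vec[OF local_matrix_carrier]) (auto simp: assoc_mult_mat_vec[OF local_matrix_carrier adj])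
  also have "\<dots> = \<beta>"
    unfolding adj_mat(2)[OF local_matrix_carrier] using \<beta> det_nz by (auto intro!: eq_vecI simp: smult_scalar_prod_distrib[of _ "r+1"])
  finally have M\<theta>: "M *\<^sub>v \<theta> = \<beta>" .
  have mono: "(\<Sum>i\<in>W. (Y i - poly p (x i - z)) * ?u i ^ c) = 0" if c: "c \<le> r" for c
  proof -
    have "(\<Sum>i\<in>W. Y i * ?u i ^ c) / N = vec_index (M *\<^sub>v \<theta>) c"
      unfolding M\<theta> \<beta>_def using c by simp
    also have "\<dots> = (\<Sum>a\<le>r. M $$ (c, a) * vec_index \<theta> a)"
      using c \<theta> by (auto simp: scalar_prod_def atLeast0LessThan lessThan_Suc_atMost intro!: sum.cong)
    also have "\<dots> = (\<Sum>a\<le>r. \<Sum>i\<in>W. vec_index \<theta> a * ?u i ^ a * ?u i ^ c / N)"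
      using c by (intro sum.cong refl) (simp add: local_matrix_entry sum_distrib_left sum_distrib_right sum_divide_distrib power_add mult_ac)
    also have "\<dots> = (\<Sum>i\<in>W. poly p (x i - z) * ?u i ^ c) / N"
      unfolding p_def poly_scaled_poly by (subst sum.swap) (simp add: sum_distrib_right sum_divide_distrib)
    finally show ?thesis using N_pos by (auto simp: left_diff_distrib sum_subtractf)
  qed
  show thesis
  proof
    show "degree p \<le> r" unfolding p_def by (rule degree_scaled_poly)
    fix q :: "real poly" assume q: "degree q \<le> r"
    have "(\<Sum>i\<in>W. (Y i - poly p (x i - z)) * poly q (x i - z))
        = (\<Sum>i\<in>W. \<Sum>c\<le>r. coeff q c * h ^ c * ((Y i - poly p (x i - z)) * ?u i ^ c))"
      using poly_eq_scaled_sum[OF q, of h] h_pos by (simp add: sum_distrib_left mult_ac)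
    also have "\<dots> = (\<Sum>c\<le>r. coeff q c * h ^ c * (\<Sum>i\<in>W. (Y i - poly p (x i - z)) * ?u i ^ c))"
      by (subst sum.swap) (simp add: sum_distrib_left)
    also have "\<dots> = 0" by (simp add: mono)
    finally show "(\<Sum>i\<in>W. (Y i - poly p (x i - z)) * poly q (x i - z)) = 0" .
  qed
qed

text \<open>A solution \<open>p\<close> of the normal equations is the unique minimizer by Pythagoras, and the normal
  equation for \<open>weight_poly\<close> says that the responses and the values of \<open>p\<close> have the same weighted
  sum. For the values of \<open>p\<close> this sum is \<open>p(0)\<close>.\<close>

lemma local_fit_eq_weighted_sum:
  assumes design: "\<And>i. i \<in> {1..m} \<Longrightarrow> fst (\<omega> i) = x i"
  shows "poly (local_fit r m \<omega> z h) 0 = (\<Sum>i\<in>W. w i * snd (\<omega> i))"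
proof -
  have crit: "local_criterion m \<omega> z h q = (\<Sum>i\<in>W. (snd (\<omega> i) - poly q (x i - z))\<^sup>2)" for q
    unfolding local_criterion_def sum_window_eq_active[symmetric]
    by (intro sum.cong) (auto simp: design)
  obtain p where p: "degree p \<le> r"
    and normal: "\<And>q. degree q \<le> r \<Longrightarrow> (\<Sum>i\<in>W. (snd (\<omega> i) - poly p (x i - z)) * poly q (x i - z)) = 0"
    by (rule normal_equations[of "\<lambda>i. snd (\<omega> i)"]) blast
  have pyth: "local_criterion m \<omega> z h q = local_criterion m \<omega> z h p + (\<Sum>i\<in>W. (poly (p - q) (x i - z))\<^sup>2)"
    if q: "degree q \<le> r" for q
  proof -
    have "local_criterion m \<omega> z h q = (\<Sum>i\<in>W. (snd (\<omega> i) - poly p (x i - z))\<^sup>2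
        + 2 * ((snd (\<omega> i) - poly p (x i - z)) * poly (p - q) (x i - z)) + (poly (p - q) (x i - z))\<^sup>2)"
      unfolding crit by (intro sum.cong refl) (simp add: power2_eq_square algebra_simps)
    also have "\<dots> = local_criterion m \<omega> z h p + (\<Sum>i\<in>W. (poly (p - q) (x i - z))\<^sup>2)"
      using normal[OF degree_diff_le[OF p q]]
      by (simp only: sum.distrib crit sum_distrib_left[symmetric])
    finally show ?thesis .
  qed
  have "local_fit r m \<omega> z h = p"
    unfolding local_fit_def
  proof (rule the_equality, safe)
    fix q :: "real poly" assume "degree q \<le> r"
    then show "local_criterion m \<omega> z h p \<le> local_criterion m \<omega> z h q"
      using pyth by (simp add: sum_nonneg)
  next
    fix q assume q: "degree q \<le> r"
      "\<forall>q'. degree q' \<le> r \<longrightarrow> local_criterion m \<omega> z h q \<le> local_criterion m \<omega> z h q'"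
    then have "(\<Sum>i\<in>W. (poly (p - q) (x i - z))\<^sup>2) \<le> 0"
      using pyth[OF q(1)] p by force
    then have "(\<Sum>i\<in>W. (poly (p - q) (x i - z))\<^sup>2) = 0"
      by (intro antisym) (auto simp: sum_nonneg)
    then have "p - q = 0" by (rule window_definite[OF degree_diff_le[OF p q(1)]])
    then show "q = p" by simp
  qed (rule p)
  moreover have "(\<Sum>i\<in>W. w i * snd (\<omega> i)) = (\<Sum>i\<in>W. w i * poly p (x i - z))"
  proof -
    have "(\<Sum>i\<in>W. w i * snd (\<omega> i)) - (\<Sum>i\<in>W. w i * poly p (x i - z))
        = (\<Sum>i\<in>W. (snd (\<omega> i) - poly p (x i - z)) * poly weight_poly (x i - z))"
      by (simp add: sum_subtractf[symmetric] weight_eq_poly[symmetric] algebra_simps)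
    then show ?thesis using normal[OF degree_weight_poly] by simp
  qed
  ultimately show ?thesis using weights_reproduce[OF p] by simp
qed

end

section \<open>The data-driven bandwidth\<close>

lemma admissible_iff:
  assumes "L > 0" "\<sigma>1 > 0"
  shows "admissible_bandwidth s L \<sigma>1 m x z h \<longleftrightarrow>
    h \<in> {0<..<1} \<and> \<sigma>1\<^sup>2 \<le> (L * h powr s)\<^sup>2 * real (card (active m x z h))"
proof (cases "card (active m x z h) = 0")
  case True
  then show ?thesis
    using assms unfolding admissible_bandwidth_def emp_count by auto
next
  case False
  let ?N = "real (card (active m x z h))"
  have N: "?N > 0" using False by linarith
  have "\<sigma>1 / sqrt ?N \<le> L * h powr s \<longleftrightarrow> \<sigma>1 \<le> L * h powr s * sqrt ?N"
    using N by (simp add: pos_divide_le_eq)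
  also have "\<dots> \<longleftrightarrow> \<sigma>1\<^sup>2 \<le> (L * h powr s * sqrt ?N)\<^sup>2"
    using assms by (subst power_mono_iff) auto
  also have "\<dots> \<longleftrightarrow> \<sigma>1\<^sup>2 \<le> (L * h powr s)\<^sup>2 * ?N"
    by (simp add: power_mult_distrib)
  finally show ?thesis
    using N unfolding admissible_bandwidth_def emp_count by auto
qed

locale bandwidth_setup =
  fixes s L \<sigma>1 :: real
  assumes s_pos: "s > 0" and L_pos: "L > 0" and \<sigma>1_pos: "\<sigma>1 > 0"
begin

abbreviation "adm \<equiv> admissible_bandwidth s L \<sigma>1"

lemmas adm_iff = admissible_iff[OF L_pos \<sigma>1_pos]

lemma admissible_mono:
  assumes "adm m x z h" "h \<le> h'" "h' < 1"
  shows "adm m x z h'"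
proof -
  have h: "h > 0" using assms(1) adm_iff by auto
  have "\<sigma>1\<^sup>2 \<le> (L * h powr s)\<^sup>2 * real (card (active m x z h))"
    using assms(1) adm_iff by auto
  also have "\<dots> \<le> (L * h' powr s)\<^sup>2 * real (card (active m x z h'))"
    using h assms(2) L_pos s_pos
    by (intro mult_mono power_mono mult_left_mono powr_mono2) (auto intro!: card_mono active_mono)
  finally show ?thesis using h assms adm_iff by auto
qed

text \<open>The least admissible bandwidth exists because the number of observations in a closed window is
  right-continuous in its width, so that admissibility passes to the infimum.\<close>

lemma bandwidth_admissible_least:
  assumes ex: "\<exists>h. adm m x z h"
  shows "adm m x z (bandwidth s L \<sigma>1 m x z)"
    and "\<And>h. adm m x z h \<Longrightarrow> bandwidth s L \<sigma>1 m x z \<le> h"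
proof -
  define S where "S = {h. adm m x z h}"
  define h0 where "h0 = Inf S"
  obtain h1 where h1: "h1 \<in> S" using ex unfolding S_def by auto
  have bdd: "bdd_below S" unfolding S_def adm_iff by (rule bdd_belowI[of _ 0]) auto
  have low: "h0 \<le> h" if "h \<in> S" for h unfolding h0_def using that bdd by (rule cInf_lower)
  have h0_nonneg: "h0 \<ge> 0" unfolding h0_def using h1 by (intro cInf_greatest) (auto simp: S_def adm_iff)
  have h0_less: "h0 < 1" using low[OF h1] h1 unfolding S_def adm_iff by auto
  define D where "D = (\<lambda>i. \<bar>x i - z\<bar>) ` {i\<in>{1..m}. \<bar>x i - z\<bar> > h0}"
  define h2 where "h2 = Min (insert 1 D)"
  have h2: "h2 > h0" unfolding h2_def D_def using h0_less by (subst Min_gr_iff) auto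
  have act: "active m x z h = active m x z h0" if "h \<ge> h0" "h < h2" for h
  proof -
    have "\<bar>x i - z\<bar> \<le> h0" if "i \<in> active m x z h" for i
    proof (rule ccontr)
      assume "\<not> \<bar>x i - z\<bar> \<le> h0"
      then have "h2 \<le> \<bar>x i - z\<bar>"
        unfolding h2_def D_def using that by (intro Min_le) (auto simp: active_def)
      then show False using that \<open>h < h2\<close> by (auto simp: active_def)
    qed
    then show ?thesis using that(1) by (auto simp: active_def)
  qed
  have "\<forall>\<^sub>F h in at_right h0. \<sigma>1\<^sup>2 \<le> (L * h powr s)\<^sup>2 * real (card (active m x z h0))"
  proof -
    have "h0 < min 1 h2" using h0_less h2 by simp
    then have "\<forall>\<^sub>F h in at_right h0. h \<in> {h0<..<min 1 h2}"
      by (rule eventually_at_right_real)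
    then show ?thesis
    proof eventually_elim
      fix h assume h: "h \<in> {h0<..<min 1 h2}"
      then obtain h' where "h' \<in> S" "h' < h"
        using cInf_lessD[of S h] h1 unfolding h0_def by auto
      then have "adm m x z h" using admissible_mono[of m x z h' h] h unfolding S_def by auto
      then show "\<sigma>1\<^sup>2 \<le> (L * h powr s)\<^sup>2 * real (card (active m x z h0))"
        using act[of h] h adm_iff by auto
    qed
  qed
  moreover have "((\<lambda>h. (L * h powr s)\<^sup>2 * real (card (active m x z h0)))
      \<longlongrightarrow> (L * h0 powr s)\<^sup>2 * real (card (active m x z h0))) (at_right h0)"
    using s_pos h0_nonneg
    by (intro tendsto_intros disjI2 conjI eventually_at_rightI[of h0 "h0+1"]) auto
  ultimately have le: "\<sigma>1\<^sup>2 \<le> (L * h0 powr s)\<^sup>2 * real (card (active m x z h0))"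
    by (intro tendsto_lowerbound) auto
  moreover have "h0 \<noteq> 0" using le \<sigma>1_pos by auto
  ultimately have adm0: "adm m x z h0" using h0_nonneg h0_less adm_iff by auto
  have eq: "bandwidth s L \<sigma>1 m x z = h0"
    unfolding bandwidth_def by (rule Least_equality) (use adm0 low in \<open>auto simp: S_def\<close>)
  show "adm m x z (bandwidth s L \<sigma>1 m x z)" using eq adm0 by simp
  show "bandwidth s L \<sigma>1 m x z \<le> h" if "adm m x z h" for h
    using eq low that unfolding S_def by simp
qed

text \<open>This describes the bandwidth by its sublevel sets, hence gives its measurability.\<close>

lemma admissible_iff_bandwidth_le:
  assumes "t < 1"
  shows "adm m x z t \<longleftrightarrow> (\<exists>h. adm m x z h) \<and> bandwidth s L \<sigma>1 m x z \<le> t"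
  using bandwidth_admissible_least[of m x z] admissible_mono[of m x z _ t] assms by blast

text \<open>No smaller bandwidth is admissible, and the left limit of the number of observations in the
  window is the number of observations in the open window. Together with the absence of ties this
  bounds the number of observations in the closed window from above.\<close>

lemma open_window_count_le:
  assumes ex: "\<exists>h. adm m x z h"
  defines "H \<equiv> bandwidth s L \<sigma>1 m x z"
  shows "(L * H powr s)\<^sup>2 * real (card {i\<in>{1..m}. \<bar>x i - z\<bar> < H}) \<le> \<sigma>1\<^sup>2"
proof -
  define B where "B = {i\<in>{1..m}. \<bar>x i - z\<bar> < H}"
  have H: "0 < H" "H < 1" using bandwidth_admissible_least(1)[OF ex] unfolding H_def adm_iff by auto
  define h1 where "h1 = Max (insert 0 ((\<lambda>i. \<bar>x i - z\<bar>) ` B))"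
  have h1: "h1 < H" unfolding h1_def B_def using H by (subst Max_less_iff) auto
  have "\<forall>\<^sub>F h in at_left H. h \<in> {h1<..<H}" using h1 by (rule eventually_at_left_real)
  then have "\<forall>\<^sub>F h in at_left H. (L * h powr s)\<^sup>2 * real (card B) \<le> \<sigma>1\<^sup>2"
  proof eventually_elim
    fix h assume h: "h \<in> {h1<..<H}"
    have "h1 \<ge> 0" unfolding h1_def by (intro Max_ge) (auto simp: B_def)
    have "\<not> adm m x z h" using bandwidth_admissible_least(2)[OF ex, of h] h unfolding H_def by auto
    then have "(L * h powr s)\<^sup>2 * real (card (active m x z h)) \<le> \<sigma>1\<^sup>2"
      using h H \<open>h1 \<ge> 0\<close> unfolding adm_iff by auto
    moreover have "B \<subseteq> active m x z h"
    proof
      fix i assume "i \<in> B"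
      then have "\<bar>x i - z\<bar> \<le> h1" unfolding h1_def by (intro Max_ge) (auto simp: B_def)
      then show "i \<in> active m x z h" using h \<open>i \<in> B\<close> unfolding B_def active_def by auto
    qed
    then have "real (card B) \<le> real (card (active m x z h))" by (simp add: card_mono)
    then have "(L * h powr s)\<^sup>2 * real (card B) \<le> (L * h powr s)\<^sup>2 * real (card (active m x z h))"
      by (intro mult_left_mono) auto
    ultimately show "(L * h powr s)\<^sup>2 * real (card B) \<le> \<sigma>1\<^sup>2" by linarith
  qed
  moreover have "((\<lambda>h. (L * h powr s)\<^sup>2 * real (card B)) \<longlongrightarrow> (L * H powr s)\<^sup>2 * real (card B)) (at_left H)"
    using H by (intro tendsto_intros) auto
  ultimately show ?thesis
    unfolding B_def by (intro tendsto_upperbound[where F = "at_left H"]) auto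
qed

lemma regular_event_iff_det:
  "regular_event r s L \<sigma>1 m x z \<longleftrightarrow> (\<exists>h. adm m x z h) \<and>
     Determinant.det (local_matrix r m x z (bandwidth s L \<sigma>1 m x z)) \<noteq> 0"
proof (cases "\<exists>h. adm m x z h")
  case True
  then have "bandwidth s L \<sigma>1 m x z \<noteq> 0"
    using bandwidth_admissible_least(1)[OF True] adm_iff by auto
  then have "local_eigenvalue r s L \<sigma>1 m x z > 0 \<longleftrightarrow>
      Determinant.det (local_matrix r m x z (bandwidth s L \<sigma>1 m x z)) \<noteq> 0"
    unfolding local_eigenvalue_def by (rule smallest_eigenvalue_local_matrix_pos_iff)
  then show ?thesis unfolding regular_event_def by blast
qed (simp add: regular_event_def)

lemma regular_nondegenerate:
  assumes "regular_event r s L \<sigma>1 m x z"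
  shows "nondegenerate_window r m x z (bandwidth s L \<sigma>1 m x z)"
proof
  show "bandwidth s L \<sigma>1 m x z > 0"
    using assms bandwidth_admissible_least(1) unfolding regular_event_def adm_iff by auto
  show "Determinant.det (local_matrix r m x z (bandwidth s L \<sigma>1 m x z)) \<noteq> 0"
    using assms regular_event_iff_det by simp
qed

lemma estimator_eq_weighted_sum:
  assumes "regular_event r s L \<sigma>1 m (design \<omega>) z"
  defines "H \<equiv> bandwidth s L \<sigma>1 m (design \<omega>) z"
  shows "local_poly_estimator r s L \<sigma>1 m \<omega> z =
    (\<Sum>i\<in>active m (design \<omega>) z H. local_weight r m (design \<omega>) z H i * snd (\<omega> i))"
proof -
  interpret nondegenerate_window r m "design \<omega>" z H
    unfolding H_def by (rule regular_nondegenerate) fact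
  show ?thesis
    using assms(1) local_fit_eq_weighted_sum[of \<omega>]
    unfolding local_poly_estimator_def H_def by (simp add: design_def)
qed

end

section \<open>Bias and variance given the design\<close>

text \<open>With \<open>k = strict_floor s\<close> the remainder of order \<open>k\<close> in Lagrange's form, minus the \<open>k\<close>-th term of
  the Taylor polynomial, is an increment of the \<open>k\<close>-th derivative. The hypothesis on \<open>r\<close> enters
  through \<open>k \<le> r\<close>.\<close>

lemma holder_taylor:
  assumes f: "f \<in> holder_class s L" and s: "s > 0" and r: "real r + 1 \<ge> s"
  obtains p where "degree p \<le> r" "poly p 0 = f z"
    "\<And>t. \<bar>f t - poly p (t - z)\<bar> \<le> L * \<bar>t - z\<bar> powr s"
proof -
  define k where "k = strict_floor s"
  define D where "D = (\<lambda>j. (deriv ^^ j) f)"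
  have k: "real k < s" unfolding k_def by (rule strict_floor_greatest[OF s])
  have kr: "k \<le> r" using k r by linarith
  have holder: "\<bar>D k u - D k v\<bar> \<le> L * \<bar>u - v\<bar> powr (s - real k)" for u v
    using f unfolding holder_class_def D_def k_def by auto
  have L: "L \<ge> 0" using holder[of 1 0] by simp
  have deriv: "DERIV (D j) t :> D (Suc j) t" if "j < k" for j t
    using f that unfolding holder_class_def D_def k_def
    by (auto simp: DERIV_deriv_iff_real_differentiable)
  define p where "p = (\<Sum>j\<le>k. monom (D j z / fact j) j)"
  have p: "poly p u = (\<Sum>j\<le>k. D j z / fact j * u ^ j)" for u
    unfolding p_def by (simp add: poly_sum poly_monom)
  show thesis
  proof
    show "degree p \<le> r" unfolding p_def using kr
      by (intro degree_sum_le) (auto intro: order_trans[OF degree_monom_le])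
    have "poly p 0 = (\<Sum>j\<le>k. if j = 0 then D 0 z else 0)"
      unfolding p by (intro sum.cong) auto
    then show "poly p 0 = f z" by (simp add: D_def)
    fix t
    show "\<bar>f t - poly p (t - z)\<bar> \<le> L * \<bar>t - z\<bar> powr s"
    proof (cases "k = 0 \<or> t = z")
      case True
      then show ?thesis
      proof
        assume "k = 0"
        then show ?thesis using holder[of t z] by (simp add: p D_def)
      next
        assume "t = z"
        then show ?thesis using \<open>poly p 0 = f z\<close> by simp
      qed
    next
      case False
      have "\<exists>\<xi>. (if t < z then t < \<xi> \<and> \<xi> < z else z < \<xi> \<and> \<xi> < t) \<and>
          f t = (\<Sum>j<k. D j z / fact j * (t - z) ^ j) + D k \<xi> / fact k * (t - z) ^ k"
        using False deriv by (intro Taylor[where a = "min t z" and b = "max t z"]) (auto simp: D_def)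
      then obtain \<xi> where between: "if t < z then t < \<xi> \<and> \<xi> < z else z < \<xi> \<and> \<xi> < t"
        and ft: "f t = (\<Sum>j<k. D j z / fact j * (t - z) ^ j) + D k \<xi> / fact k * (t - z) ^ k"
        by blast
      have \<xi>: "\<bar>\<xi> - z\<bar> \<le> \<bar>t - z\<bar>" using between by (auto split: if_splits)
      have "f t - poly p (t - z) = (D k \<xi> - D k z) / fact k * (t - z) ^ k"
        unfolding ft p by (simp add: lessThan_Suc_atMost[symmetric] diff_divide_distrib left_diff_distrib)
      then have "\<bar>f t - poly p (t - z)\<bar> = \<bar>D k \<xi> - D k z\<bar> / fact k * \<bar>t - z\<bar> ^ k"
        by (simp add: abs_mult power_abs)
      also have "\<dots> \<le> \<bar>D k \<xi> - D k z\<bar> / 1 * \<bar>t - z\<bar> ^ k"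
        by (intro mult_right_mono divide_left_mono) (auto simp: fact_ge_1)
      also have "\<dots> \<le> (L * \<bar>t - z\<bar> powr (s - real k)) * \<bar>t - z\<bar> ^ k"
        using holder[of \<xi> z] \<xi> k L
        by (intro mult_right_mono) (auto intro!: order_trans[OF holder] mult_left_mono powr_mono2)
      also have "\<dots> = L * \<bar>t - z\<bar> powr s"
        using False by (simp add: powr_realpow[symmetric] powr_add[symmetric])
      finally show ?thesis .
    qed
  qed
qed

text \<open>Independent centred summands have additive variances. The lemma serves twice: for the
  noise of the regression and for the number of observations that fall into a given set.\<close>

lemma (in product_prob_space) nn_integral_PiM_square_of_sum:
  fixes g :: "'i \<Rightarrow> 'a \<Rightarrow> real"
  assumes "finite J"
    and "\<And>i. i \<in> J \<Longrightarrow> integrable (M i) (g i)" "\<And>i. i \<in> J \<Longrightarrow> (\<integral>a. g i a \<partial>M i) = 0"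
    and "\<And>i. i \<in> J \<Longrightarrow> integrable (M i) (\<lambda>a. (g i a)\<^sup>2)"
  shows "(\<integral>\<^sup>+ y. ennreal ((c + (\<Sum>i\<in>J. g i (y i)))\<^sup>2) \<partial>PiM J M)
    = ennreal (c\<^sup>2 + (\<Sum>i\<in>J. \<integral>a. (g i a)\<^sup>2 \<partial>M i))"
  using assms
proof (induction J)
  case empty
  interpret E: prob_space "PiM {} M" by (rule prob_space_PiM) (rule prob_space)
  show ?case using E.emeasure_space_1 by simp
next
  case (insert j J)
  have [measurable]: "g i \<in> borel_measurable (M i)" if "i \<in> insert j J" for i
    using insert.prems(1)[OF that] by auto
  have inner: "(\<integral>\<^sup>+ a. ennreal ((d + g j a)\<^sup>2) \<partial>M j) = ennreal (d\<^sup>2) + ennreal (\<integral>a. (g j a)\<^sup>2 \<partial>M j)" for d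
  proof -
    have exp: "(d + g j a)\<^sup>2 = d\<^sup>2 + 2 * d * g j a + (g j a)\<^sup>2" for a by (simp add: power2_sum)
    have "integrable (M j) (\<lambda>a. (d + g j a)\<^sup>2)"
      unfolding exp using insert.prems by auto
    then have "(\<integral>\<^sup>+ a. ennreal ((d + g j a)\<^sup>2) \<partial>M j) = ennreal (\<integral>a. (d + g j a)\<^sup>2 \<partial>M j)"
      by (rule nn_integral_eq_integral) simp
    also have "(\<integral>a. (d + g j a)\<^sup>2 \<partial>M j) = d\<^sup>2 + (\<integral>a. (g j a)\<^sup>2 \<partial>M j)"
      unfolding exp using insert.prems by (simp add: M.prob_space)
    finally show ?thesis by simp
  qed
  have "(\<integral>\<^sup>+ y. ennreal ((c + (\<Sum>i\<in>insert j J. g i (y i)))\<^sup>2) \<partial>PiM (insert j J) M)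
      = (\<integral>\<^sup>+ y. \<integral>\<^sup>+ a. ennreal ((c + (\<Sum>i\<in>insert j J. g i ((y(j := a)) i)))\<^sup>2) \<partial>M j \<partial>PiM J M)"
    using insert.hyps by (intro product_nn_integral_insert) measurable
  also have "\<dots> = (\<integral>\<^sup>+ y. ennreal ((c + (\<Sum>i\<in>J. g i (y i)))\<^sup>2) + ennreal (\<integral>a. (g j a)\<^sup>2 \<partial>M j) \<partial>PiM J M)"
  proof (intro nn_integral_cong)
    fix y
    have "(\<Sum>i\<in>insert j J. g i ((y(j := a)) i)) = g j a + (\<Sum>i\<in>J. g i (y i))" for a
      using insert.hyps by (auto intro!: sum.cong)
    then show "(\<integral>\<^sup>+ a. ennreal ((c + (\<Sum>i\<in>insert j J. g i ((y(j := a)) i)))\<^sup>2) \<partial>M j)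
        = ennreal ((c + (\<Sum>i\<in>J. g i (y i)))\<^sup>2) + ennreal (\<integral>a. (g j a)\<^sup>2 \<partial>M j)"
      using inner[of "c + (\<Sum>i\<in>J. g i (y i))"] by (simp add: add_ac)
  qed
  also have "\<dots> = ennreal (c\<^sup>2 + (\<Sum>i\<in>J. \<integral>a. (g i a)\<^sup>2 \<partial>M i)) + ennreal (\<integral>a. (g j a)\<^sup>2 \<partial>M j)"
  proof -
    interpret E: prob_space "PiM J M" by (rule prob_space_PiM) (rule prob_space)
    show ?thesis
      using insert.prems insert.IH by (subst nn_integral_add) (auto simp: E.emeasure_space_1)
  qed
  finally show ?case using insert.hyps
    by (simp add: ennreal_plus[symmetric] sum_nonneg add_ac del: ennreal_plus)
qed

lemma normal_density_moments:
  fixes \<mu> \<sigma> :: real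
  assumes "\<sigma> > 0"
  defines "P \<equiv> density lborel (\<lambda>y. ennreal (normal_density \<mu> \<sigma> y))"
  shows "prob_space P" "has_bochner_integral P (\<lambda>y. y - \<mu>) 0" "has_bochner_integral P (\<lambda>y. (y - \<mu>)\<^sup>2) (\<sigma>\<^sup>2)"
proof -
  show "prob_space P" unfolding P_def by (rule prob_space_normal_density[OF assms(1)])
  show "has_bochner_integral P (\<lambda>y. y - \<mu>) 0"
    unfolding P_def using normal_moment_odd[OF assms(1), of \<mu> 0]
    by (intro has_bochner_integral_density) auto
  show "has_bochner_integral P (\<lambda>y. (y - \<mu>)\<^sup>2) (\<sigma>\<^sup>2)"
    unfolding P_def using normal_moment_even[OF assms(1), of \<mu> 1]
    by (intro has_bochner_integral_density) auto
qed

context bandwidth_setup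
begin

text \<open>The estimation error is \<open>c + \<Sum>i. w\<^sub>i (Y\<^sub>i - f(x\<^sub>i))\<close> with the deterministic bias \<open>c\<close>. The
  variance is at most \<open>\<sigma>1\<^sup>2 (\<Sum>i. w\<^sub>i\<^sup>2)\<close>, and \<open>\<bar>c\<bar> \<le> L H\<^bsup>s\<^esup> (\<Sum>i. \<bar>w\<^sub>i\<bar>)\<close> by Taylor's formula, where
  \<open>(\<Sum>i. \<bar>w\<^sub>i\<bar>)\<^sup>2\<close> is at most the number of observations times \<open>\<Sum>i. w\<^sub>i\<^sup>2\<close>. Keeping \<open>K\<close> arbitrary
  allows a constant from a smaller window later on.\<close>

lemma conditional_risk_le:
  assumes reg: "regular_event r s L \<sigma>1 m x z" and f: "f \<in> holder_class s L"
    and r: "real r + 1 \<ge> s" and \<sigma>: "\<And>t. 0 < \<sigma> t" "\<And>t. \<sigma> t \<le> \<sigma>1"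
  defines "H \<equiv> bandwidth s L \<sigma>1 m x z"
  assumes K: "\<And>q. degree q \<le> r \<Longrightarrow> (poly q 0)\<^sup>2 \<le> K * (\<Sum>i\<in>active m x z H. (poly q (x i - z))\<^sup>2)"
  shows "conditional_risk r s L \<sigma>1 m \<sigma> f z x
    \<le> ennreal (((L * H powr s)\<^sup>2 * real (card (active m x z H)) + \<sigma>1\<^sup>2) * K)"
proof -
  interpret nondegenerate_window r m x z H
    unfolding H_def by (rule regular_nondegenerate) fact
  define c where "c = (\<Sum>i\<in>W. w i * f (x i)) - f z"
  define P where "P = (\<lambda>i. density lborel (\<lambda>y. ennreal (normal_density (f (x i)) (\<sigma> (x i)) y)))"
  define g where "g = (\<lambda>i y. if i \<in> W then w i * (y - f (x i)) else 0)"
  note mom = normal_density_moments[OF \<sigma>(1)]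
  interpret product_prob_space P
    by (intro product_prob_spaceI) (auto simp: P_def mom)
  have g_int: "has_bochner_integral (P i) (g i) 0"
    "has_bochner_integral (P i) (\<lambda>y. (g i y)\<^sup>2) (if i \<in> W then (w i)\<^sup>2 * (\<sigma> (x i))\<^sup>2 else 0)" for i
  proof -
    have "has_bochner_integral (P i) (\<lambda>y. w i * (y - f (x i))) (w i * 0)"
      unfolding P_def by (intro has_bochner_integral_mult_right mom)
    then show "has_bochner_integral (P i) (g i) 0"
      unfolding g_def by (cases "i \<in> W") auto
    have "has_bochner_integral (P i) (\<lambda>y. (w i)\<^sup>2 * (y - f (x i))\<^sup>2) ((w i)\<^sup>2 * (\<sigma> (x i))\<^sup>2)"
      unfolding P_def by (intro has_bochner_integral_mult_right mom)
    then show "has_bochner_integral (P i) (\<lambda>y. (g i y)\<^sup>2) (if i \<in> W then (w i)\<^sup>2 * (\<sigma> (x i))\<^sup>2 else 0)"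
      unfolding g_def by (cases "i \<in> W") (auto simp: power_mult_distrib)
  qed
  have "conditional_risk r s L \<sigma>1 m \<sigma> f z x
      = (\<integral>\<^sup>+ y. ennreal ((c + (\<Sum>i\<in>{1..m}. g i (y i)))\<^sup>2) \<partial>PiM {1..m} P)"
    unfolding conditional_risk_def response_law_def P_def[symmetric] pointwise_loss_def
  proof (intro nn_integral_cong arg_cong[where f = ennreal] arg_cong[where f = "\<lambda>u. u\<^sup>2"])
    fix y :: "nat \<Rightarrow> real"
    have [simp]: "design (\<lambda>i. (x i, y i)) = x" by (simp add: design_def)
    have "(\<Sum>i\<in>{1..m}. g i (y i)) = (\<Sum>i\<in>W. w i * (y i - f (x i)))"
      unfolding g_def by (intro sum.mono_neutral_cong_right) (auto simp: active_def)
    then show "local_poly_estimator r s L \<sigma>1 m (\<lambda>i. (x i, y i)) z - f z = c + (\<Sum>i\<in>{1..m}. g i (y i))"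
      using estimator_eq_weighted_sum[of r m "\<lambda>i. (x i, y i)" z] reg
      by (simp add: c_def H_def right_diff_distrib sum_subtractf)
  qed
  also have "\<dots> = ennreal (c\<^sup>2 + (\<Sum>i\<in>{1..m}. \<integral>y. (g i y)\<^sup>2 \<partial>P i))"
    using g_int by (intro nn_integral_PiM_square_of_sum) (auto simp: has_bochner_integral_iff)
  also have "(\<Sum>i\<in>{1..m}. \<integral>y. (g i y)\<^sup>2 \<partial>P i) = (\<Sum>i\<in>{1..m}. if i \<in> W then (w i)\<^sup>2 * (\<sigma> (x i))\<^sup>2 else 0)"
    using g_int(2) by (simp add: has_bochner_integral_iff)
  also have "\<dots> = (\<Sum>i\<in>W. (w i)\<^sup>2 * (\<sigma> (x i))\<^sup>2)"
    by (intro sum.mono_neutral_cong_right) (auto simp: active_def)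
  also have "ennreal (c\<^sup>2 + (\<Sum>i\<in>W. (w i)\<^sup>2 * (\<sigma> (x i))\<^sup>2)) \<le> ennreal (((L * H powr s)\<^sup>2 * N + \<sigma>1\<^sup>2) * K)"
  proof (rule ennreal_leI)
    have S: "(\<Sum>i\<in>W. (w i)\<^sup>2) \<le> K" by (rule sum_weights_squared_le) (rule K)
    have "(\<Sum>i\<in>W. (w i)\<^sup>2 * (\<sigma> (x i))\<^sup>2) \<le> (\<Sum>i\<in>W. (w i)\<^sup>2 * \<sigma>1\<^sup>2)"
      using \<sigma> by (intro sum_mono mult_left_mono power_mono) (auto intro: less_imp_le)
    also have "\<dots> \<le> K * \<sigma>1\<^sup>2"
      unfolding sum_distrib_right[symmetric] using S by (intro mult_right_mono) auto
    finally have var: "(\<Sum>i\<in>W. (w i)\<^sup>2 * (\<sigma> (x i))\<^sup>2) \<le> K * \<sigma>1\<^sup>2" .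
    obtain p where p: "degree p \<le> r" "poly p 0 = f z"
      "\<And>t. \<bar>f t - poly p (t - z)\<bar> \<le> L * \<bar>t - z\<bar> powr s"
      using holder_taylor[OF f s_pos r] by blast
    have "c = (\<Sum>i\<in>W. w i * (f (x i) - poly p (x i - z)))"
      unfolding c_def using weights_reproduce[OF p(1)] p(2)
      by (simp add: right_diff_distrib sum_subtractf)
    then have "c\<^sup>2 \<le> (\<Sum>i\<in>W. \<bar>w i\<bar> * (L * H powr s))\<^sup>2"
    proof -
      assume "c = (\<Sum>i\<in>W. w i * (f (x i) - poly p (x i - z)))"
      then have "\<bar>c\<bar> \<le> (\<Sum>i\<in>W. \<bar>w i * (f (x i) - poly p (x i - z))\<bar>)"
        by (simp add: sum_abs)
      also have "\<dots> \<le> (\<Sum>i\<in>W. \<bar>w i\<bar> * (L * H powr s))"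
      proof (intro sum_mono)
        fix i assume "i \<in> W"
        then have "\<bar>x i - z\<bar> powr s \<le> H powr s"
          using s_pos by (intro powr_mono2) (auto simp: active_def)
        then have "\<bar>f (x i) - poly p (x i - z)\<bar> \<le> L * H powr s"
          using p(3)[of "x i"] L_pos by (meson mult_left_mono order_trans less_imp_le)
        then show "\<bar>w i * (f (x i) - poly p (x i - z))\<bar> \<le> \<bar>w i\<bar> * (L * H powr s)"
          by (simp add: abs_mult mult_left_mono)
      qed
      finally have "\<bar>c\<bar>\<^sup>2 \<le> (\<Sum>i\<in>W. \<bar>w i\<bar> * (L * H powr s))\<^sup>2" by (intro power_mono) auto
      then show ?thesis by simp
    qed
    also have "\<dots> = (\<Sum>i\<in>W. \<bar>w i\<bar>)\<^sup>2 * (L * H powr s)\<^sup>2"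
      by (simp add: sum_distrib_right[symmetric] power_mult_distrib)
    also have "\<dots> \<le> (K * N) * (L * H powr s)\<^sup>2"
    proof (intro mult_right_mono)
      have "(\<Sum>i\<in>W. \<bar>w i\<bar>)\<^sup>2 \<le> (\<Sum>i\<in>W. (w i)\<^sup>2) * N"
        using sum_squared_le_sum_of_squares[of "\<lambda>i. \<bar>w i\<bar>" W] by simp
      also have "\<dots> \<le> K * N" using S by (intro mult_right_mono) auto
      finally show "(\<Sum>i\<in>W. \<bar>w i\<bar>)\<^sup>2 \<le> K * N" .
    qed auto
    finally show "c\<^sup>2 + (\<Sum>i\<in>W. (w i)\<^sup>2 * (\<sigma> (x i))\<^sup>2) \<le> ((L * H powr s)\<^sup>2 * N + \<sigma>1\<^sup>2) * K"
      using var by (simp add: algebra_simps)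
  qed
  finally show ?thesis .
qed

text \<open>For an admissible bandwidth the bound for the squared bias dominates the bound for the variance,
  which explains the factor \<open>2\<close>.\<close>

proposition conditional_risk_le_eigenvalue:
  assumes reg: "regular_event r s L \<sigma>1 m x z" and f: "f \<in> holder_class s L"
    and r: "real r + 1 \<ge> s" and \<sigma>: "\<And>t. 0 < \<sigma> t" "\<And>t. \<sigma> t \<le> \<sigma>1"
  shows "conditional_risk r s L \<sigma>1 m \<sigma> f z x
    \<le> ennreal (2 * inverse (local_eigenvalue r s L \<sigma>1 m x z) ^ 2 * L ^ 2 * bandwidth s L \<sigma>1 m x z powr (2 * s))"
proof -
  define H where "H = bandwidth s L \<sigma>1 m x z"
  interpret nondegenerate_window r m x z H
    unfolding H_def by (rule regular_nondegenerate) fact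
  have ev: "local_eigenvalue r s L \<sigma>1 m x z = ev_min" unfolding local_eigenvalue_def H_def ..
  have "adm m x z H"
    using reg bandwidth_admissible_least(1) unfolding regular_event_def H_def by auto
  then have adm: "\<sigma>1\<^sup>2 \<le> (L * H powr s)\<^sup>2 * N" unfolding adm_iff by simp
  have "conditional_risk r s L \<sigma>1 m \<sigma> f z x
      \<le> ennreal (((L * H powr s)\<^sup>2 * N + \<sigma>1\<^sup>2) * (1 / (N * ev_min)))"
    unfolding H_def by (rule conditional_risk_le[OF reg f r \<sigma>]) (use eval_zero_le_eigenvalue in \<open>auto simp: H_def\<close>)
  also have "\<dots> \<le> ennreal (2 * (inverse ev_min)\<^sup>2 * L\<^sup>2 * H powr (2 * s))"
  proof (rule ennreal_leI)
    have "((L * H powr s)\<^sup>2 * N + \<sigma>1\<^sup>2) * (1 / (N * ev_min)) \<le> (2 * ((L * H powr s)\<^sup>2 * N)) * (1 / (N * ev_min))"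
      by (intro mult_right_mono) (use adm N_pos eigenvalue_pos in \<open>simp_all add: mult.commute\<close>)
    also have "\<dots> = 2 * (L * H powr s)\<^sup>2 * inverse ev_min"
      using N_pos eigenvalue_pos by (auto simp: field_simps)
    also have "\<dots> \<le> 2 * (L * H powr s)\<^sup>2 * (inverse ev_min)\<^sup>2"
    proof (intro mult_left_mono)
      show "inverse ev_min \<le> (inverse ev_min)\<^sup>2"
        using mult_left_mono[OF one_le_inverse[OF eigenvalue_pos eigenvalue_le_1], of "inverse ev_min"] eigenvalue_pos
        by (simp add: power2_eq_square)
    qed auto
    also have "\<dots> = 2 * (inverse ev_min)\<^sup>2 * L\<^sup>2 * H powr (2 * s)"
      using powr_add[of H s s] by (simp add: power2_eq_square mult_ac)
    finally show "((L * H powr s)\<^sup>2 * N + \<sigma>1\<^sup>2) * (1 / (N * ev_min)) \<le> 2 * (inverse ev_min)\<^sup>2 * L\<^sup>2 * H powr (2 * s)" .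
  qed
  finally show ?thesis unfolding ev H_def .
qed

end

section \<open>Measurability of the estimator\<close>

lemma borel_measurable_det:
  fixes B :: "'a \<Rightarrow> real Matrix.mat"
  assumes "\<And>a. B a \<in> carrier_mat n n"
    and [measurable]: "\<And>i j. i < n \<Longrightarrow> j < n \<Longrightarrow> (\<lambda>a. B a $$ (i, j)) \<in> borel_measurable A"
  shows "(\<lambda>a. Determinant.det (B a)) \<in> borel_measurable A"
proof -
  have "(\<lambda>a. \<Sum>p | p permutes {0..<n}. signof p * (\<Prod>i = 0..<n. B a $$ (i, p i))) \<in> borel_measurable A"
  proof (intro borel_measurable_sum borel_measurable_times borel_measurable_const borel_measurable_prod)
    fix p i assume "p \<in> {p. p permutes {0..<n}}" "i \<in> {0..<n}"
    then show "(\<lambda>a. B a $$ (i, p i)) \<in> borel_measurable A"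
      using permutes_in_image[of p "{0..<n}" i] by (intro assms(2)) auto
  qed
  then show ?thesis by (simp add: det_def'[OF assms(1)])
qed

lemma borel_measurable_adj_mat:
  fixes B :: "'a \<Rightarrow> real Matrix.mat"
  assumes carr: "\<And>a. B a \<in> carrier_mat n n"
    and meas: "\<And>i j. i < n \<Longrightarrow> j < n \<Longrightarrow> (\<lambda>a. B a $$ (i, j)) \<in> borel_measurable A"
    and ij: "i < n" "j < n"
  shows "(\<lambda>a. adj_mat (B a) $$ (i, j)) \<in> borel_measurable A"
proof -
  have dims: "dim_row (B a) = n" "dim_col (B a) = n" for a using carr[of a] by auto
  have "(\<lambda>a. Determinant.det (mat_delete (B a) j i)) \<in> borel_measurable A"
  proof (rule borel_measurable_det)
    show "mat_delete (B a) j i \<in> carrier_mat (n - 1) (n - 1)" for a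
      by (rule mat_delete_carrier[OF carr])
    show "(\<lambda>a. mat_delete (B a) j i $$ (i', j')) \<in> borel_measurable A" if "i' < n - 1" "j' < n - 1" for i' j'
      unfolding mat_delete_def using that dims by (auto intro!: meas)
  qed
  then show ?thesis
    unfolding adj_mat_def cofactor_def using ij dims by simp
qed

context bandwidth_setup
begin

text \<open>The value \<open>1\<close> marks the absence of an admissible bandwidth: all admissible ones are below \<open>1\<close>.\<close>

definition bandwidth_or_1 :: "nat \<Rightarrow> (nat \<Rightarrow> real) \<Rightarrow> real \<Rightarrow> real" where
  "bandwidth_or_1 m x z = (if \<exists>h. adm m x z h then bandwidth s L \<sigma>1 m x z else 1)"

lemma bandwidth_or_1_less_iff: "bandwidth_or_1 m x z < 1 \<longleftrightarrow> (\<exists>h. adm m x z h)"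
  using bandwidth_admissible_least(1)[of m x z] unfolding bandwidth_or_1_def adm_iff by auto

lemma estimator_explicit:
  "local_poly_estimator r s L \<sigma>1 m \<omega> z =
    (let x = design \<omega>; h = bandwidth_or_1 m x z in
     if h < 1 \<and> Determinant.det (local_matrix r m x z h) \<noteq> 0
     then \<Sum>i=1..m. (if \<bar>x i - z\<bar> \<le> h then local_weight r m x z h i * snd (\<omega> i) else 0) else 0)"
proof (cases "regular_event r s L \<sigma>1 m (design \<omega>) z")
  case True
  then have ex: "\<exists>h. adm m (design \<omega>) z h" by (simp add: regular_event_def)
  then have H: "bandwidth_or_1 m (design \<omega>) z = bandwidth s L \<sigma>1 m (design \<omega>) z"
    unfolding bandwidth_or_1_def by simp
  have "(\<Sum>i\<in>active m (design \<omega>) z h. g i)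
      = (\<Sum>i=1..m. if \<bar>design \<omega> i - z\<bar> \<le> h then g i else 0)" for h and g :: "nat \<Rightarrow> real"
    unfolding active_def by (intro sum.mono_neutral_cong_left) auto
  then show ?thesis
    using True bandwidth_or_1_less_iff[of m "design \<omega>" z] ex estimator_eq_weighted_sum[OF True]
    unfolding Let_def H by (simp add: regular_event_iff_det)
next
  case False
  then show ?thesis
    using bandwidth_or_1_less_iff[of m "design \<omega>" z]
    by (auto simp: local_poly_estimator_def regular_event_iff_det bandwidth_or_1_def Let_def)
qed

context
  fixes A :: "'a measure" and m :: nat and X :: "nat \<Rightarrow> 'a \<Rightarrow> real" and Z :: "'a \<Rightarrow> real"
  assumes X [measurable]: "\<And>i. i \<in> {1..m} \<Longrightarrow> X i \<in> borel_measurable A"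
    and Z [measurable]: "Z \<in> borel_measurable A"
begin

lemma card_active_measurable:
  assumes [measurable]: "t \<in> borel_measurable A"
  shows "(\<lambda>a. real (card (active m (\<lambda>i. X i a) (Z a) (t a)))) \<in> borel_measurable A"
proof -
  have "real (card (active m (\<lambda>i. X i a) (Z a) (t a))) = (\<Sum>i=1..m. if \<bar>X i a - Z a\<bar> \<le> t a then 1 else 0)" for a
  proof -
    have "real (card (active m (\<lambda>i. X i a) (Z a) (t a))) = (\<Sum>i\<in>active m (\<lambda>i. X i a) (Z a) (t a). 1)" by simp
    also have "\<dots> = (\<Sum>i=1..m. if \<bar>X i a - Z a\<bar> \<le> t a then 1 else 0)"
      unfolding active_def by (intro sum.mono_neutral_cong_left) auto
    finally show ?thesis .
  qed
  moreover have "(\<lambda>a. \<Sum>i=1..m. if \<bar>X i a - Z a\<bar> \<le> t a then 1 else (0::real)) \<in> borel_measurable A"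
    by measurable
  ultimately show ?thesis by simp
qed

lemma bandwidth_or_1_measurable:
  "(\<lambda>a. bandwidth_or_1 m (\<lambda>i. X i a) (Z a)) \<in> borel_measurable A"
proof (subst borel_measurable_iff_le, intro allI)
  fix t :: real
  have [measurable]: "(\<lambda>a. real (card (active m (\<lambda>i. X i a) (Z a) t))) \<in> borel_measurable A"
    by (intro card_active_measurable) simp
  show "{a \<in> space A. bandwidth_or_1 m (\<lambda>i. X i a) (Z a) \<le> t} \<in> sets A"
  proof (cases "t < 1")
    case True
    then have "bandwidth_or_1 m (\<lambda>i. X i a) (Z a) \<le> t \<longleftrightarrow> 0 < t \<and>
        \<sigma>1\<^sup>2 \<le> (L * t powr s)\<^sup>2 * real (card (active m (\<lambda>i. X i a) (Z a) t))" for a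
      using admissible_iff_bandwidth_le[OF True, of m "\<lambda>i. X i a" "Z a"]
      unfolding adm_iff bandwidth_or_1_def by auto
    then show ?thesis by simp
  next
    case False
    have "bandwidth_or_1 m (\<lambda>i. X i a) (Z a) \<le> 1" for a
      using bandwidth_admissible_least(1)[of m "\<lambda>i. X i a" "Z a"]
      unfolding adm_iff bandwidth_or_1_def by (auto intro: less_imp_le)
    then have "bandwidth_or_1 m (\<lambda>i. X i a) (Z a) \<le> t" for a
      using False by (meson not_less order_trans)
    then show ?thesis by simp
  qed
qed

lemma local_matrix_entry_measurable:
  assumes [measurable]: "t \<in> borel_measurable A" and "i < r + 1" "j < r + 1"
  shows "(\<lambda>a. local_matrix r m (\<lambda>i. X i a) (Z a) (t a) $$ (i, j)) \<in> borel_measurable A"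
proof -
  note card_active_measurable[OF assms(1), measurable]
  have "local_matrix r m (\<lambda>i. X i a) (Z a) (t a) $$ (i, j)
      = (\<Sum>k=1..m. if \<bar>X k a - Z a\<bar> \<le> t a then ((X k a - Z a) / t a) ^ (i + j) else 0)
         / real (card (active m (\<lambda>i. X i a) (Z a) (t a)))" for a
  proof -
    have "(\<Sum>k\<in>active m (\<lambda>i. X i a) (Z a) (t a). ((X k a - Z a) / t a) ^ (i + j))
       = (\<Sum>k=1..m. if \<bar>X k a - Z a\<bar> \<le> t a then ((X k a - Z a) / t a) ^ (i + j) else 0)"
      unfolding active_def by (intro sum.mono_neutral_cong_left) auto
    then show ?thesis using assms(2,3) by (simp add: local_matrix_entry)
  qed
  moreover have "(\<lambda>a. (\<Sum>k=1..m. if \<bar>X k a - Z a\<bar> \<le> t a then ((X k a - Z a) / t a) ^ (i + j) else 0)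
         / real (card (active m (\<lambda>i. X i a) (Z a) (t a)))) \<in> borel_measurable A"
    by measurable
  ultimately show ?thesis by simp
qed

lemma local_weight_measurable:
  assumes [measurable]: "t \<in> borel_measurable A" and [measurable]: "k \<in> {1..m}"
  shows "(\<lambda>a. local_weight r m (\<lambda>i. X i a) (Z a) (t a) k) \<in> borel_measurable A"
proof -
  note card_active_measurable[OF assms(1), measurable]
  have [measurable]: "(\<lambda>a. Determinant.det (local_matrix r m (\<lambda>i. X i a) (Z a) (t a))) \<in> borel_measurable A"
    by (rule borel_measurable_det[where n = "r + 1"]) (auto intro!: local_matrix_entry_measurable simp del: add_Suc_right)
  have [measurable]: "(\<lambda>a. adj_mat (local_matrix r m (\<lambda>i. X i a) (Z a) (t a)) $$ (0, b)) \<in> borel_measurable A"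
    if "b \<in> {..r}" for b
    by (rule borel_measurable_adj_mat[where n = "r + 1"]) (use that in \<open>auto intro!: local_matrix_entry_measurable\<close>)
  have [measurable]: "X k \<in> borel_measurable A" by (rule X) fact
  show ?thesis unfolding local_weight_def by measurable
qed

text \<open>The observations are arbitrary measurable functions here, so that the lemma covers both the
  sample alone and the sample together with the point \<open>z\<close>, as Fubini's theorem requires.\<close>

lemma local_poly_estimator_measurable:
  assumes Y: "\<And>i. i \<in> {1..m} \<Longrightarrow> Y i \<in> borel_measurable A"
  shows "(\<lambda>a. local_poly_estimator r s L \<sigma>1 m (\<lambda>i. (X i a, Y i a)) (Z a)) \<in> borel_measurable A"
proof -
  note Y [measurable]
  note h = bandwidth_or_1_measurable
  note h [measurable]
  have [measurable]: "(\<lambda>a. Determinant.det (local_matrix r m (\<lambda>i. X i a) (Z a)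
      (bandwidth_or_1 m (\<lambda>i. X i a) (Z a)))) \<in> borel_measurable A"
    by (rule borel_measurable_det[where n = "r + 1"]) (auto intro!: local_matrix_entry_measurable)
  note local_weight_measurable[OF h, measurable]
  show ?thesis
    unfolding estimator_explicit by (simp add: design_def Let_def)
qed

end

end

lemma local_poly_estimator_cong:
  assumes "\<And>i. i \<in> {1..m} \<Longrightarrow> \<omega> i = \<omega>' i"
  shows "local_poly_estimator r s L \<sigma>1 m \<omega> z = local_poly_estimator r s L \<sigma>1 m \<omega>' z"
proof -
  have d: "design \<omega> i = design \<omega>' i" if "i \<in> {1..m}" for i
    using assms[OF that] by (simp add: design_def)
  have emp: "emp_measure m (design \<omega>) = emp_measure m (design \<omega>')"
    unfolding emp_measure_def fun_eq_iff by (auto intro!: sum.cong simp: d)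
  have adm: "admissible_bandwidth s L \<sigma>1 m (design \<omega>) = admissible_bandwidth s L \<sigma>1 m (design \<omega>')"
    unfolding admissible_bandwidth_def fun_eq_iff emp by simp
  have mat: "local_matrix r m (design \<omega>) = local_matrix r m (design \<omega>')"
    unfolding local_matrix_def fun_eq_iff emp by (auto intro!: eq_matI sum.cong simp: d)
  have crit: "local_criterion m \<omega> = local_criterion m \<omega>'"
    unfolding local_criterion_def fun_eq_iff by (auto intro!: sum.cong simp: assms)
  show ?thesis
    unfolding local_poly_estimator_def regular_event_def local_eigenvalue_def bandwidth_def
      local_fit_def adm mat crit ..
qed

section \<open>Disintegration of the sample law\<close>

abbreviation std_noise :: "real measure" where
  "std_noise \<equiv> density lborel std_normal_density"

lemma prob_std_noise: "prob_space std_noise"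
  by (rule prob_space_normal_density) simp

lemma distr_std_noise_affine:
  assumes "\<sigma> > 0"
  shows "distr std_noise borel (\<lambda>e. \<mu> + \<sigma> * e) = density lborel (\<lambda>y. ennreal (normal_density \<mu> \<sigma> y))"
proof -
  interpret prob_space std_noise by (rule prob_std_noise)
  have "distributed std_noise lborel (\<lambda>e. e) (\<lambda>x. ennreal (normal_density 0 1 x))"
    by (auto simp: distributed_def distr_id2[of lborel std_noise, simplified])
  from normal_density_affine[OF this, of \<sigma> \<mu>] assms
  have "distributed std_noise lborel (\<lambda>e. \<mu> + \<sigma> * e) (\<lambda>x. ennreal (normal_density \<mu> \<sigma> x))"
    by simp
  then show ?thesis
    unfolding distributed_def by (metis distr_cong sets_lborel)
qed

text \<open>Both sides agree on rectangles, where the integral of a product of functions of single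
  coordinates factorizes.\<close>

lemma PiM_eq_distr_of_coordinates:
  fixes P :: "'b measure" and \<phi> :: "'i \<Rightarrow> 'b \<Rightarrow> 'c"
  assumes "prob_space P" "finite I" and [measurable]: "\<And>i. \<phi> i \<in> measurable P M"
  shows "PiM I (\<lambda>i. distr P M (\<phi> i)) = distr (PiM I (\<lambda>_. P)) (PiM I (\<lambda>_. M)) (\<lambda>e. \<lambda>i\<in>I. \<phi> i (e i))"
proof -
  interpret P: prob_space P by fact
  interpret PP: product_prob_space "\<lambda>_. P" by (intro product_prob_spaceI) unfold_locales
  interpret D: product_prob_space "\<lambda>i. distr P M (\<phi> i)"
    by (intro product_prob_spaceI P.prob_space_distr) simp
  show ?thesis
  proof (rule D.PiM_eqI[symmetric])
    show "finite I" by fact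
    show "sets (distr (PiM I (\<lambda>_. P)) (PiM I (\<lambda>_. M)) (\<lambda>e. \<lambda>i\<in>I. \<phi> i (e i))) = sets (PiM I (\<lambda>i. distr P M (\<phi> i)))"
      by (simp cong: sets_PiM_cong)
    fix E assume E: "\<And>i. i \<in> I \<Longrightarrow> E i \<in> sets (distr P M (\<phi> i))"
    then have [measurable]: "i \<in> I \<Longrightarrow> E i \<in> sets M" for i by simp
    have R [measurable]: "Pi\<^sub>E I E \<in> sets (PiM I (\<lambda>_. M))"
      using E by (intro sets_PiM_I_finite \<open>finite I\<close>) simp
    have "emeasure (distr (PiM I (\<lambda>_. P)) (PiM I (\<lambda>_. M)) (\<lambda>e. \<lambda>i\<in>I. \<phi> i (e i))) (Pi\<^sub>E I E)
        = (\<integral>\<^sup>+ e. indicator (Pi\<^sub>E I E) (\<lambda>i\<in>I. \<phi> i (e i)) \<partial>PiM I (\<lambda>_. P))"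
      by (subst nn_integral_indicator[symmetric], simp, subst nn_integral_distr) simp_all
    also have "\<dots> = (\<integral>\<^sup>+ e. (\<Prod>i\<in>I. indicator (E i) (\<phi> i (e i))) \<partial>PiM I (\<lambda>_. P))"
      using \<open>finite I\<close> by (intro nn_integral_cong) (auto simp: indicator_def PiE_iff prod_zero_iff)
    also have "\<dots> = (\<Prod>i\<in>I. \<integral>\<^sup>+ e. indicator (E i) (\<phi> i e) \<partial>P)"
      using \<open>finite I\<close> by (intro PP.product_nn_integral_prod) simp_all
    also have "\<dots> = (\<Prod>i\<in>I. emeasure (distr P M (\<phi> i)) (E i))"
      by (intro prod.cong refl, subst nn_integral_indicator[symmetric], simp, subst nn_integral_distr) simp_all
    finally show "emeasure (distr (PiM I (\<lambda>_. P)) (PiM I (\<lambda>_. M)) (\<lambda>e. \<lambda>i\<in>I. \<phi> i (e i))) (Pi\<^sub>E I E)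
        = (\<Prod>i\<in>I. emeasure (distr P M (\<phi> i)) (E i))" .
  qed
qed

lemma PiM_pair_eq_distr:
  fixes P :: "'a measure" and R :: "'b measure"
  assumes "prob_space P" "prob_space R" "finite I"
  shows "PiM I (\<lambda>_. P \<Otimes>\<^sub>M R) = distr (PiM I (\<lambda>_. P) \<Otimes>\<^sub>M PiM I (\<lambda>_. R)) (PiM I (\<lambda>_. P \<Otimes>\<^sub>M R)) (\<lambda>(x, e). \<lambda>i\<in>I. (x i, e i))"
proof -
  interpret P: prob_space P by fact
  interpret R: prob_space R by fact
  interpret PR: pair_prob_space P R ..
  interpret PP: product_prob_space "\<lambda>_. P" I by (intro product_prob_spaceI) unfold_locales
  interpret RR: product_prob_space "\<lambda>_. R" I by (intro product_prob_spaceI) unfold_locales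
  interpret D: product_prob_space "\<lambda>_. P \<Otimes>\<^sub>M R" by (intro product_prob_spaceI) unfold_locales
  show ?thesis
  proof (rule D.PiM_eqI[symmetric])
    fix E :: "_ \<Rightarrow> ('a \<times> 'b) set" assume E [measurable]: "\<And>i. i \<in> I \<Longrightarrow> E i \<in> sets (P \<Otimes>\<^sub>M R)"
    have m: "(\<lambda>(x, e). \<lambda>i\<in>I. (x i, e i)) \<in> measurable (PiM I (\<lambda>_. P) \<Otimes>\<^sub>M PiM I (\<lambda>_. R)) (PiM I (\<lambda>_. P \<Otimes>\<^sub>M R))"
      by measurable
    have rect: "Pi\<^sub>E I E \<in> sets (PiM I (\<lambda>_. P \<Otimes>\<^sub>M R))"
      using E by (intro sets_PiM_I_finite \<open>finite I\<close>) simp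
    have prod: "indicator (Pi\<^sub>E I E) (\<lambda>i\<in>I. (x i, e i)) = (\<Prod>i\<in>I. indicator (E i) (x i, e i) :: ennreal)" for x e
      using \<open>finite I\<close> by (auto simp: indicator_def PiE_iff prod_zero_iff)
    have "emeasure (distr (PiM I (\<lambda>_. P) \<Otimes>\<^sub>M PiM I (\<lambda>_. R)) (PiM I (\<lambda>_. P \<Otimes>\<^sub>M R)) (\<lambda>(x, e). \<lambda>i\<in>I. (x i, e i))) (Pi\<^sub>E I E)
        = (\<integral>\<^sup>+ p. (\<lambda>(x, e). \<Prod>i\<in>I. indicator (E i) (x i, e i)) p \<partial>(PiM I (\<lambda>_. P) \<Otimes>\<^sub>M PiM I (\<lambda>_. R)))"
      using rect m by (subst nn_integral_indicator[symmetric], simp, subst nn_integral_distr)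
        (auto simp: prod[symmetric] case_prod_beta intro!: nn_integral_cong)
    also have "\<dots> = (\<integral>\<^sup>+ x. \<integral>\<^sup>+ e. (\<Prod>i\<in>I. indicator (E i) (x i, e i)) \<partial>PiM I (\<lambda>_. R) \<partial>PiM I (\<lambda>_. P))"
      by (subst RR.P.nn_integral_fst[symmetric]) auto
    also have "\<dots> = (\<integral>\<^sup>+ x. (\<Prod>i\<in>I. \<integral>\<^sup>+ e. indicator (E i) (x i, e) \<partial>R) \<partial>PiM I (\<lambda>_. P))"
    proof (intro nn_integral_cong RR.product_nn_integral_prod \<open>finite I\<close>)
      fix x i assume "x \<in> space (PiM I (\<lambda>_. P))" "i \<in> I"
      then have "x i \<in> space P" by (auto simp: space_PiM)
      then show "(\<lambda>e. indicator (E i) (x i, e)) \<in> borel_measurable R"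
        using E[OF \<open>i \<in> I\<close>] by measurable
    qed
    also have "\<dots> = (\<Prod>i\<in>I. \<integral>\<^sup>+ z. \<integral>\<^sup>+ e. indicator (E i) (z, e) \<partial>R \<partial>P)"
      by (intro PP.product_nn_integral_prod \<open>finite I\<close>) measurable
    also have "\<dots> = (\<Prod>i\<in>I. emeasure (P \<Otimes>\<^sub>M R) (E i))"
      by (intro prod.cong refl, subst R.nn_integral_fst) simp_all
    finally show "emeasure (distr (PiM I (\<lambda>_. P) \<Otimes>\<^sub>M PiM I (\<lambda>_. R)) (PiM I (\<lambda>_. P \<Otimes>\<^sub>M R)) (\<lambda>(x, e). \<lambda>i\<in>I. (x i, e i))) (Pi\<^sub>E I E)
        = (\<Prod>i\<in>I. emeasure (P \<Otimes>\<^sub>M R) (E i))" .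
  qed (use \<open>finite I\<close> in auto)
qed

locale regression_model = bandwidth_setup s L \<sigma>1 for s L \<sigma>1 :: real +
  fixes PZ :: "real measure" and \<sigma> f :: "real \<Rightarrow> real"
  assumes PZ: "prob_space PZ" and sets_PZ [measurable_cong]: "sets PZ = sets borel"
    and f_meas [measurable]: "f \<in> borel_measurable borel"
    and \<sigma>_meas [measurable]: "\<sigma> \<in> borel_measurable borel"
    and \<sigma>_pos: "\<And>t. \<sigma> t > 0"
begin

abbreviation "S m \<equiv> sample_law PZ \<sigma> f m"
abbreviation "design_law m \<equiv> PiM {1..m::nat} (\<lambda>_. PZ)"

lemma sets_sample_law [measurable_cong]: "sets (S m) = sets (PiM {1..m} (\<lambda>_. borel \<Otimes>\<^sub>M borel))"
  unfolding sample_law_def by (intro sets_PiM_cong) (simp_all add: obs_law_def)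

lemma prob_obs_law: "prob_space (obs_law PZ \<sigma> f)"
proof -
  interpret P: prob_space PZ by (rule PZ)
  interpret R: prob_space std_noise by (rule prob_std_noise)
  interpret PR: pair_prob_space PZ std_noise ..
  show ?thesis unfolding obs_law_def by (rule PR.prob_space_distr) measurable
qed

lemma prob_sample_law: "prob_space (S m)"
  unfolding sample_law_def by (intro prob_space_PiM prob_obs_law)

lemma prob_design_law: "prob_space (design_law m)"
  by (intro prob_space_PiM PZ)

lemma prob_response_law: "prob_space (response_law \<sigma> f m x)"
  unfolding response_law_def by (intro prob_space_PiM prob_space_normal_density \<sigma>_pos)

lemma sets_design_law [measurable_cong]: "sets (design_law m) = sets (PiM {1..m} (\<lambda>_. borel))"
  by (intro sets_PiM_cong) (simp_all add: sets_PZ)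

lemma sets_response_law [measurable_cong]: "sets (response_law \<sigma> f m x) = sets (PiM {1..m} (\<lambda>_. borel))"
  unfolding response_law_def by (intro sets_PiM_cong) simp_all

lemma response_law_eq_distr:
  "response_law \<sigma> f m x = distr (PiM {1..m} (\<lambda>_. std_noise)) (PiM {1..m} (\<lambda>_. borel))
     (\<lambda>e. \<lambda>i\<in>{1..m}. f (x i) + \<sigma> (x i) * e i)"
  unfolding response_law_def distr_std_noise_affine[OF \<sigma>_pos, symmetric]
  by (rule PiM_eq_distr_of_coordinates) (auto intro: prob_std_noise)

lemma sample_law_eq_distr:
  "S m = distr (design_law m \<Otimes>\<^sub>M PiM {1..m} (\<lambda>_. std_noise)) (PiM {1..m} (\<lambda>_. borel \<Otimes>\<^sub>M borel))
     (\<lambda>(x, e). \<lambda>i\<in>{1..m}. (x i, f (x i) + \<sigma> (x i) * e i))"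
proof -
  interpret P: prob_space PZ by (rule PZ)
  interpret R: prob_space std_noise by (rule prob_std_noise)
  interpret PR: pair_prob_space PZ std_noise ..
  let ?\<phi> = "\<lambda>(z, e). (z, f z + \<sigma> z * e)"
  have "S m = distr (PiM {1..m} (\<lambda>_. PZ \<Otimes>\<^sub>M std_noise)) (PiM {1..m} (\<lambda>_. borel \<Otimes>\<^sub>M borel))
      (\<lambda>p. \<lambda>i\<in>{1..m}. ?\<phi> (p i))"
    unfolding sample_law_def obs_law_def
    by (rule PiM_eq_distr_of_coordinates) (unfold_locales, auto)
  also have "\<dots> = distr (design_law m \<Otimes>\<^sub>M PiM {1..m} (\<lambda>_. std_noise)) (PiM {1..m} (\<lambda>_. borel \<Otimes>\<^sub>M borel))
      ((\<lambda>p. \<lambda>i\<in>{1..m}. ?\<phi> (p i)) \<circ> (\<lambda>(x, e). \<lambda>i\<in>{1..m}. (x i, e i)))"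
    by (subst PiM_pair_eq_distr[OF PZ prob_std_noise], simp, subst distr_distr) simp_all
  also have "(\<lambda>p. \<lambda>i\<in>{1..m}. ?\<phi> (p i)) \<circ> (\<lambda>(x, e). \<lambda>i\<in>{1..m}. (x i, e i))
      = (\<lambda>(x, e). \<lambda>i\<in>{1..m}. (x i, f (x i) + \<sigma> (x i) * e i))"
    by (auto simp: fun_eq_iff)
  finally show ?thesis .
qed

text \<open>Both the sample and, for a fixed design, the responses are images of standard normal noise under
  the same map. The statement is therefore Fubini's theorem for the design and the noise.\<close>

lemma sample_law_disintegration:
  assumes g [measurable]: "g \<in> borel_measurable (PiM {1..m} (\<lambda>_. borel \<Otimes>\<^sub>M borel))"
  shows "(\<lambda>x. \<integral>\<^sup>+ y. g (\<lambda>i\<in>{1..m}. (x i, y i)) \<partial>response_law \<sigma> f m x) \<in> borel_measurable (PiM {1..m} (\<lambda>_. borel))"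
    and "(\<integral>\<^sup>+ \<omega>. g \<omega> \<partial>S m)
      = (\<integral>\<^sup>+ x. \<integral>\<^sup>+ y. g (\<lambda>i\<in>{1..m}. (x i, y i)) \<partial>response_law \<sigma> f m x \<partial>design_law m)"
proof -
  interpret E: prob_space "PiM {1..m} (\<lambda>_. std_noise)" by (intro prob_space_PiM prob_std_noise)
  have inner: "(\<integral>\<^sup>+ y. g (\<lambda>i\<in>{1..m}. (x i, y i)) \<partial>response_law \<sigma> f m x)
      = (\<integral>\<^sup>+ e. g (\<lambda>i\<in>{1..m}. (x i, f (x i) + \<sigma> (x i) * e i)) \<partial>PiM {1..m} (\<lambda>_. std_noise))" for x
  proof -
    have "(\<lambda>y. \<lambda>i\<in>{1..m}. (x i, y i)) \<in> measurable (PiM {1..m} (\<lambda>_. borel)) (PiM {1..m} (\<lambda>_. borel \<Otimes>\<^sub>M borel))"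
      by measurable
    note measurable_compose[OF this g, measurable]
    show ?thesis
      unfolding response_law_eq_distr
      by (subst nn_integral_distr)
        (auto simp del: One_nat_def intro!: nn_integral_cong arg_cong[where f = g])
  qed
  show "(\<lambda>x. \<integral>\<^sup>+ y. g (\<lambda>i\<in>{1..m}. (x i, y i)) \<partial>response_law \<sigma> f m x) \<in> borel_measurable (PiM {1..m} (\<lambda>_. borel))"
    unfolding inner by measurable
  show "(\<integral>\<^sup>+ \<omega>. g \<omega> \<partial>S m)
      = (\<integral>\<^sup>+ x. \<integral>\<^sup>+ y. g (\<lambda>i\<in>{1..m}. (x i, y i)) \<partial>response_law \<sigma> f m x \<partial>design_law m)"
  proof -
    have \<Phi>: "(\<lambda>(x, e). \<lambda>i\<in>{1..m}. (x i, f (x i) + \<sigma> (x i) * e i))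
        \<in> measurable (design_law m \<Otimes>\<^sub>M PiM {1..m} (\<lambda>_. std_noise)) (PiM {1..m} (\<lambda>_. borel \<Otimes>\<^sub>M borel))"
      by measurable
    have "(\<integral>\<^sup>+ \<omega>. g \<omega> \<partial>S m) = (\<integral>\<^sup>+ p. g ((\<lambda>(x, e). \<lambda>i\<in>{1..m}. (x i, f (x i) + \<sigma> (x i) * e i)) p)
        \<partial>(design_law m \<Otimes>\<^sub>M PiM {1..m} (\<lambda>_. std_noise)))"
      unfolding sample_law_eq_distr by (rule nn_integral_distr[OF \<Phi>]) (use g in simp)
    also have "\<dots> = (\<integral>\<^sup>+ x. \<integral>\<^sup>+ e. g (\<lambda>i\<in>{1..m}. (x i, f (x i) + \<sigma> (x i) * e i))
        \<partial>PiM {1..m} (\<lambda>_. std_noise) \<partial>design_law m)"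
      using E.nn_integral_fst[OF measurable_compose[OF \<Phi> g]] by simp
    finally show ?thesis unfolding inner .
  qed
qed

lemma estimator_measurable_sample:
  "(\<lambda>(\<omega>, z). local_poly_estimator r s L \<sigma>1 m \<omega> z) \<in> borel_measurable (PiM {1..m} (\<lambda>_. borel \<Otimes>\<^sub>M borel) \<Otimes>\<^sub>M borel)"
proof -
  have "(\<lambda>p. local_poly_estimator r s L \<sigma>1 m (\<lambda>i. (fst (fst p i), snd (fst p i))) (snd p))
      \<in> borel_measurable (PiM {1..m} (\<lambda>_. borel \<Otimes>\<^sub>M borel) \<Otimes>\<^sub>M borel)"
    by (rule local_poly_estimator_measurable) auto
  then show ?thesis by (simp add: case_prod_beta)
qed

lemma pointwise_loss_measurable:
  "pointwise_loss r s L \<sigma>1 m f z \<in> borel_measurable (PiM {1..m} (\<lambda>_. borel \<Otimes>\<^sub>M borel))"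
proof -
  have "(\<lambda>\<omega>. (\<omega>, z)) \<in> measurable (PiM {1..m} (\<lambda>_. borel \<Otimes>\<^sub>M borel)) (PiM {1..m} (\<lambda>_. borel \<Otimes>\<^sub>M borel) \<Otimes>\<^sub>M borel)"
    by measurable
  from measurable_compose[OF this estimator_measurable_sample[of r m]]
  have [measurable]: "(\<lambda>\<omega>. local_poly_estimator r s L \<sigma>1 m \<omega> z) \<in> borel_measurable (PiM {1..m} (\<lambda>_. borel \<Otimes>\<^sub>M borel))"
    by simp
  show ?thesis unfolding pointwise_loss_def by measurable
qed

lemma pointwise_loss_cong:
  assumes "\<And>i. i \<in> {1..m} \<Longrightarrow> \<omega> i = \<omega>' i"
  shows "pointwise_loss r s L \<sigma>1 m f z \<omega> = pointwise_loss r s L \<sigma>1 m f z \<omega>'"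
  unfolding pointwise_loss_def using local_poly_estimator_cong[of m \<omega> \<omega>'] assms by metis

lemma conditional_risk_eq:
  "conditional_risk r s L \<sigma>1 m \<sigma> f z x
    = (\<integral>\<^sup>+ y. pointwise_loss r s L \<sigma>1 m f z (\<lambda>i\<in>{1..m}. (x i, y i)) \<partial>response_law \<sigma> f m x)"
  unfolding conditional_risk_def by (intro nn_integral_cong pointwise_loss_cong) simp

lemma conditional_risk_measurable:
  "conditional_risk r s L \<sigma>1 m \<sigma> f z \<in> borel_measurable (PiM {1..m} (\<lambda>_. borel))"
  unfolding conditional_risk_eq[abs_def]
  by (rule sample_law_disintegration(1)[OF pointwise_loss_measurable])

lemma conditional_risk_restrict:
  "conditional_risk r s L \<sigma>1 m \<sigma> f z (restrict x {1..m}) = conditional_risk r s L \<sigma>1 m \<sigma> f z x"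
proof -
  have "response_law \<sigma> f m (restrict x {1..m}) = response_law \<sigma> f m x"
    unfolding response_law_def by (intro PiM_cong) auto
  then show ?thesis
    unfolding conditional_risk_def by (auto intro!: nn_integral_cong pointwise_loss_cong)
qed

text \<open>A set of the design algebra is a condition on the design, which the disintegration lets out of
  the inner integral.\<close>

proposition conditional_risk_is_conditional_expectation:
  "AE \<omega> in S m. nn_cond_exp (S m) (design_algebra PZ \<sigma> f m) (pointwise_loss r s L \<sigma>1 m f z) \<omega>
     = conditional_risk r s L \<sigma>1 m \<sigma> f z (design \<omega>)"
proof -
  let ?I = "{1..m}" and ?F = "design_algebra PZ \<sigma> f m"
  let ?loss = "pointwise_loss r s L \<sigma>1 m f z" and ?R = "conditional_risk r s L \<sigma>1 m \<sigma> f z"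
  let ?D = "\<lambda>\<omega>. restrict (design \<omega>) ?I"
  interpret S: prob_space "S m" by (rule prob_sample_law)
  have D [measurable]: "?D \<in> measurable (PiM ?I (\<lambda>_. borel \<Otimes>\<^sub>M borel)) (PiM ?I (\<lambda>_. borel))"
    unfolding design_def by measurable
  have D_F: "?D \<in> measurable ?F (PiM ?I (\<lambda>_. borel))"
    unfolding design_algebra_def by (intro measurable_vimage_algebra1) (auto simp: space_PiM)
  have sub: "subalgebra (S m) ?F"
    unfolding subalgebra_def
  proof
    show "space ?F = space (S m)" unfolding design_algebra_def by simp
    have "?D \<in> measurable (S m) (PiM ?I (\<lambda>_. borel))" by measurable
    then show "sets ?F \<subseteq> sets (S m)"
      unfolding design_algebra_def by (intro sets_image_in_sets) auto
  qed
  interpret finite_measure_subalgebra "S m" ?F by unfold_locales (rule sub)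
  note [measurable] = pointwise_loss_measurable[of r m z] conditional_risk_measurable[of r m z]
  have R_F: "(\<lambda>\<omega>. ?R (design \<omega>)) \<in> borel_measurable ?F"
    using measurable_compose[OF D_F conditional_risk_measurable[of r m z]]
    unfolding conditional_risk_restrict .
  have "AE \<omega> in S m. ?R (design \<omega>) = nn_cond_exp (S m) ?F ?loss \<omega>"
  proof (rule nn_cond_exp_charact)
    fix A assume "A \<in> sets ?F"
    then obtain B where B [measurable]: "B \<in> sets (PiM ?I (\<lambda>_. borel))" and A: "A = ?D -` B \<inter> space (S m)"
      unfolding design_algebra_def
      by (subst (asm) sets_vimage_algebra2) (auto simp: space_PiM)
    have ind: "indicator A \<omega> = indicator B (?D \<omega>)" if "\<omega> \<in> space (S m)" for \<omega>
      using that A by (auto simp: indicator_def)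
    have Dx: "?D (\<lambda>i\<in>?I. (x i, y i)) = x" if "x \<in> space (design_law m)" for x and y :: "nat \<Rightarrow> real"
      using that by (auto simp: design_def space_PiM PiE_def extensional_def fun_eq_iff)
    have "(\<integral>\<^sup>+\<omega>\<in>A. ?loss \<omega> \<partial>S m) = (\<integral>\<^sup>+\<omega>. ?loss \<omega> * indicator B (?D \<omega>) \<partial>S m)"
      by (intro nn_integral_cong) (simp add: ind)
    also have "\<dots> = (\<integral>\<^sup>+ x. \<integral>\<^sup>+ y. ?loss (\<lambda>i\<in>?I. (x i, y i)) * indicator B (?D (\<lambda>i\<in>?I. (x i, y i))) \<partial>response_law \<sigma> f m x \<partial>design_law m)"
      by (rule sample_law_disintegration(2)) measurable
    also have "\<dots> = (\<integral>\<^sup>+ x. ?R x * indicator B x \<partial>design_law m)"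
    proof (intro nn_integral_cong)
      fix x assume x: "x \<in> space (design_law m)"
      have "(\<lambda>y. \<lambda>i\<in>?I. (x i, y i)) \<in> measurable (response_law \<sigma> f m x) (PiM ?I (\<lambda>_. borel \<Otimes>\<^sub>M borel))"
        by measurable
      from measurable_compose[OF this pointwise_loss_measurable[of r m z]]
      show "(\<integral>\<^sup>+ y. ?loss (\<lambda>i\<in>?I. (x i, y i)) * indicator B (?D (\<lambda>i\<in>?I. (x i, y i))) \<partial>response_law \<sigma> f m x)
          = ?R x * indicator B x"
        unfolding Dx[OF x] conditional_risk_eq by (rule nn_integral_multc)
    qed
    also have "\<dots> = (\<integral>\<^sup>+ x. \<integral>\<^sup>+ y. ?R (?D (\<lambda>i\<in>?I. (x i, y i))) * indicator B (?D (\<lambda>i\<in>?I. (x i, y i))) \<partial>response_law \<sigma> f m x \<partial>design_law m)"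
    proof (intro nn_integral_cong)
      fix x assume x: "x \<in> space (design_law m)"
      interpret E: prob_space "response_law \<sigma> f m x" by (rule prob_response_law)
      show "?R x * indicator B x = (\<integral>\<^sup>+ y. ?R (?D (\<lambda>i\<in>?I. (x i, y i))) * indicator B (?D (\<lambda>i\<in>?I. (x i, y i))) \<partial>response_law \<sigma> f m x)"
        unfolding Dx[OF x] by (simp add: E.emeasure_space_1)
    qed
    also have "\<dots> = (\<integral>\<^sup>+\<omega>. ?R (?D \<omega>) * indicator B (?D \<omega>) \<partial>S m)"
      by (rule sample_law_disintegration(2)[symmetric]) measurable
    also have "\<dots> = (\<integral>\<^sup>+\<omega>\<in>A. ?R (design \<omega>) \<partial>S m)"
      unfolding conditional_risk_restrict by (intro nn_integral_cong) (simp add: ind)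
    finally show "(\<integral>\<^sup>+\<omega>\<in>A. ?loss \<omega> \<partial>S m) = (\<integral>\<^sup>+\<omega>\<in>A. ?R (design \<omega>) \<partial>S m)" .
  next
    show "?loss \<in> borel_measurable (S m)" by measurable
    show "(\<lambda>\<omega>. ?R (design \<omega>)) \<in> borel_measurable ?F" by (rule R_F)
  qed
  then show ?thesis by eventually_elim simp
qed

lemma integrated_risk_swap:
  "integrated_risk PZ r s L Q \<sigma>1 m \<sigma> f
    = (\<integral>\<^sup>+ z. \<integral>\<^sup>+ x. \<integral>\<^sup>+ y. ennreal ((truncate Q (local_poly_estimator r s L \<sigma>1 m (\<lambda>i. (x i, y i)) z) - f z)\<^sup>2)
         \<partial>response_law \<sigma> f m x \<partial>design_law m \<partial>PZ)"
proof -
  interpret P: prob_space PZ by (rule PZ)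
  interpret S: prob_space "S m" by (rule prob_sample_law)
  interpret SP: pair_sigma_finite "S m" PZ ..
  note estimator_measurable_sample[of r m, measurable]
  define l where "l = (\<lambda>(\<omega>, z). ennreal ((truncate Q (local_poly_estimator r s L \<sigma>1 m \<omega> z) - f z)\<^sup>2))"
  have l: "l \<in> borel_measurable (PiM {1..m} (\<lambda>_. borel \<Otimes>\<^sub>M borel) \<Otimes>\<^sub>M borel)"
    unfolding l_def truncate_def using estimator_measurable_sample[of r m]
    by (simp add: case_prod_beta)
  have "integrated_risk PZ r s L Q \<sigma>1 m \<sigma> f = (\<integral>\<^sup>+ \<omega>. \<integral>\<^sup>+ z. l (\<omega>, z) \<partial>PZ \<partial>S m)"
    unfolding integrated_risk_def l_def by simp
  also have "\<dots> = (\<integral>\<^sup>+ z. \<integral>\<^sup>+ \<omega>. l (\<omega>, z) \<partial>S m \<partial>PZ)"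
  proof (rule SP.Fubini[symmetric])
    show "l \<in> borel_measurable (S m \<Otimes>\<^sub>M PZ)" using l by measurable
  qed
  also have "\<dots> = (\<integral>\<^sup>+ z. \<integral>\<^sup>+ x. \<integral>\<^sup>+ y. l ((\<lambda>i\<in>{1..m}. (x i, y i)), z) \<partial>response_law \<sigma> f m x \<partial>design_law m \<partial>PZ)"
  proof (intro nn_integral_cong sample_law_disintegration(2))
    fix z :: real
    have "(\<lambda>\<omega>. (\<omega>, z)) \<in> measurable (PiM {1..m} (\<lambda>_. borel \<Otimes>\<^sub>M borel)) (PiM {1..m} (\<lambda>_. borel \<Otimes>\<^sub>M borel) \<Otimes>\<^sub>M borel)"
      by measurable
    from measurable_compose[OF this l]
    show "(\<lambda>\<omega>. l (\<omega>, z)) \<in> borel_measurable (PiM {1..m} (\<lambda>_. borel \<Otimes>\<^sub>M borel))" .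
  qed
  also have "\<dots> = (\<integral>\<^sup>+ z. \<integral>\<^sup>+ x. \<integral>\<^sup>+ y. l ((\<lambda>i. (x i, y i)), z) \<partial>response_law \<sigma> f m x \<partial>design_law m \<partial>PZ)"
  proof -
    have "local_poly_estimator r s L \<sigma>1 m (\<lambda>i\<in>{1..m}. (x i, y i)) z = local_poly_estimator r s L \<sigma>1 m (\<lambda>i. (x i, y i)) z" for x y z
      by (rule local_poly_estimator_cong) simp
    then show ?thesis by (simp add: l_def)
  qed
  finally show ?thesis unfolding l_def by simp
qed

end

section \<open>Evaluation at zero and separated blocks of nodes\<close>

lemma lagrange_interpolation_at:
  fixes p :: "real poly"
  assumes deg: "degree p \<le> r" and inj: "inj_on u {..r}"
  shows "poly p t = (\<Sum>k\<le>r. poly p (u k) * (\<Prod>j\<in>{..r} - {k}. (t - u j) / (u k - u j)))"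
proof -
  define l where "l = (\<lambda>k. \<Prod>j\<in>{..r} - {k}. Polynomial.smult (1 / (u k - u j)) [:- u j, 1:])"
  have poly_l: "poly (l k) t = (\<Prod>j\<in>{..r} - {k}. (t - u j) / (u k - u j))" for k t
    unfolding l_def by (simp add: poly_prod diff_divide_distrib)
  have deg_l: "degree (l k) \<le> r" if "k \<le> r" for k
  proof -
    have "degree (l k) \<le> (\<Sum>j\<in>{..r} - {k}. degree (Polynomial.smult (1 / (u k - u j)) [:- u j, 1:]))"
      unfolding l_def by (rule degree_prod_sum_le[unfolded comp_def]) simp
    also have "\<dots> \<le> (\<Sum>j\<in>{..r} - {k}. 1)"
      by (intro sum_mono) (auto intro: order_trans[OF degree_smult_le])
    also have "\<dots> = r" using that by simp
    finally show ?thesis .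
  qed
  define q where "q = p - (\<Sum>k\<le>r. Polynomial.smult (poly p (u k)) (l k))"
  have "degree q \<le> r"
    unfolding q_def using deg
    by (intro degree_diff_le degree_sum_le) (auto intro: order_trans[OF degree_smult_le] deg_l)
  have roots: "poly q (u i) = 0" if i: "i \<le> r" for i
  proof -
    have "poly (l k) (u i) = (if k = i then 1 else 0)" if k: "k \<le> r" for k
    proof (cases "k = i")
      case True
      have "(u i - u j) / (u i - u j) = 1" if "j \<in> {..r} - {i}" for j
        using inj_onD[OF inj, of i j] that i by auto
      then show ?thesis unfolding poly_l using True by simp
    next
      case False
      then show ?thesis unfolding poly_l using i by (auto simp: prod_zero_iff)
    qed
    then have "(\<Sum>k\<le>r. poly p (u k) * poly (l k) (u i)) = (\<Sum>k\<le>r. if k = i then poly p (u k) else 0)"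
      by (intro sum.cong) auto
    then show ?thesis using i unfolding q_def by (simp add: poly_sum)
  qed
  have "q = 0"
  proof (rule ccontr)
    assume "q \<noteq> 0"
    then have "card {x. poly q x = 0} \<le> degree q" "finite {x. poly q x = 0}"
      by (simp_all add: card_poly_roots_bound poly_roots_finite)
    moreover have "u ` {..r} \<subseteq> {x. poly q x = 0}" using roots by auto
    ultimately have "card (u ` {..r}) \<le> degree q" using card_mono order_trans by blast
    then show False using card_image[OF inj] \<open>degree q \<le> r\<close> by simp
  qed
  then have "poly p t = poly (\<Sum>k\<le>r. Polynomial.smult (poly p (u k)) (l k)) t" unfolding q_def by simp
  then show ?thesis by (simp add: poly_sum poly_l)
qed

text \<open>Every factor \<open>\<bar>u\<^sub>j\<bar> / \<bar>u\<^sub>k - u\<^sub>j\<bar>\<close> of a Lagrange basis polynomial at \<open>0\<close> is at most \<open>d\<close>.\<close>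

lemma eval_zero_le_separated_nodes:
  fixes p :: "real poly" and d h :: real
  assumes deg: "degree p \<le> r" and h: "h > 0" and d: "d > 0"
    and bound: "\<And>k. k \<le> r \<Longrightarrow> \<bar>u k\<bar> \<le> h"
    and sep: "\<And>k j. k \<le> r \<Longrightarrow> j \<le> r \<Longrightarrow> k \<noteq> j \<Longrightarrow> h / d \<le> \<bar>u k - u j\<bar>"
  shows "(poly p 0)\<^sup>2 \<le> (real r + 1) * d ^ (2 * r) * (\<Sum>k\<le>r. (poly p (u k))\<^sup>2)"
proof -
  have hd: "h / d > 0" using h d by simp
  have inj: "inj_on u {..r}" using sep hd by (fastforce intro!: inj_onI)
  have "\<bar>poly p 0\<bar> \<le> (\<Sum>k\<le>r. \<bar>poly p (u k) * (\<Prod>j\<in>{..r} - {k}. (0 - u j) / (u k - u j))\<bar>)"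
    unfolding lagrange_interpolation_at[OF deg inj, of 0] by (rule sum_abs)
  also have "\<dots> \<le> (\<Sum>k\<le>r. \<bar>poly p (u k)\<bar> * d ^ r)"
  proof (intro sum_mono)
    fix k assume k: "k \<in> {..r}"
    have "\<bar>\<Prod>j\<in>{..r} - {k}. (0 - u j) / (u k - u j)\<bar> = (\<Prod>j\<in>{..r} - {k}. \<bar>u j\<bar> / \<bar>u k - u j\<bar>)"
      by (simp add: abs_prod)
    also have "\<dots> \<le> (\<Prod>j\<in>{..r} - {k}. d)"
    proof (intro prod_mono conjI)
      fix j assume j: "j \<in> {..r} - {k}"
      show "0 \<le> \<bar>u j\<bar> / \<bar>u k - u j\<bar>" by simp
      have "\<bar>u j\<bar> / \<bar>u k - u j\<bar> \<le> h / (h / d)"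
        using bound[of j] sep[of k j] hd j k by (intro frac_le) auto
      then show "\<bar>u j\<bar> / \<bar>u k - u j\<bar> \<le> d" using h by simp
    qed
    also have "\<dots> = d ^ r" using k by simp
    finally show "\<bar>poly p (u k) * (\<Prod>j\<in>{..r} - {k}. (0 - u j) / (u k - u j))\<bar> \<le> \<bar>poly p (u k)\<bar> * d ^ r"
      unfolding abs_mult by (intro mult_left_mono) auto
  qed
  also have "\<dots> = (\<Sum>k\<le>r. \<bar>poly p (u k)\<bar>) * d ^ r" by (simp add: sum_distrib_right)
  finally have "\<bar>poly p 0\<bar>\<^sup>2 \<le> ((\<Sum>k\<le>r. \<bar>poly p (u k)\<bar>) * d ^ r)\<^sup>2" by (intro power_mono) auto
  also have "\<dots> = (\<Sum>k\<le>r. \<bar>poly p (u k)\<bar>)\<^sup>2 * d ^ (2 * r)"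
    by (simp add: power_mult_distrib power_mult[symmetric] mult.commute)
  also have "\<dots> \<le> ((\<Sum>k\<le>r. \<bar>poly p (u k)\<bar>\<^sup>2) * real (card {..r})) * d ^ (2 * r)"
    using d by (intro mult_right_mono sum_squared_le_sum_of_squares) auto
  finally show ?thesis by (simp add: mult_ac add.commute)
qed

text \<open>In each block take the node where \<open>p\<^sup>2\<close> is smallest: \<open>n0\<close> times this value is at most the sum of
  \<open>p\<^sup>2\<close> over the block. Then interpolate at the chosen nodes.\<close>

lemma eval_zero_le_blocks:
  fixes p :: "real poly" and d h n0 :: real and t :: "'i \<Rightarrow> real"
  assumes deg: "degree p \<le> r" and h: "h > 0" and d: "d > 0" and n0: "n0 > 0"
    and W: "finite W" "\<And>k. k \<le> r \<Longrightarrow> V k \<subseteq> W"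
    and card: "\<And>k. k \<le> r \<Longrightarrow> n0 \<le> real (card (V k))"
    and bound: "\<And>k i. k \<le> r \<Longrightarrow> i \<in> V k \<Longrightarrow> \<bar>t i\<bar> \<le> h"
    and sep: "\<And>k l i j. k \<le> r \<Longrightarrow> l \<le> r \<Longrightarrow> k \<noteq> l \<Longrightarrow> i \<in> V k \<Longrightarrow> j \<in> V l \<Longrightarrow> h / d \<le> \<bar>t i - t j\<bar>"
  shows "(poly p 0)\<^sup>2 \<le> (real r + 1) * d ^ (2 * r) / n0 * (\<Sum>i\<in>W. (poly p (t i))\<^sup>2)"
proof -
  have fin: "finite (V k)" if "k \<le> r" for k using W that finite_subset by blast
  have ne: "V k \<noteq> {}" if "k \<le> r" for k using card[OF that] n0 by auto
  have "\<exists>i. k \<le> r \<longrightarrow> i \<in> V k \<and> n0 * (poly p (t i))\<^sup>2 \<le> (\<Sum>j\<in>V k. (poly p (t j))\<^sup>2)" for k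
  proof (cases "k \<le> r")
    case True
    define i where "i = arg_min_on (\<lambda>i. (poly p (t i))\<^sup>2) (V k)"
    have i: "i \<in> V k" "\<And>j. j \<in> V k \<Longrightarrow> (poly p (t i))\<^sup>2 \<le> (poly p (t j))\<^sup>2"
      unfolding i_def using arg_min_if_finite(1)[OF fin[OF True] ne[OF True]] arg_min_least[OF fin[OF True] ne[OF True]] by auto
    have "n0 * (poly p (t i))\<^sup>2 \<le> real (card (V k)) * (poly p (t i))\<^sup>2"
      using card[OF True] by (intro mult_right_mono) auto
    also have "\<dots> \<le> (\<Sum>j\<in>V k. (poly p (t j))\<^sup>2)"
      using i(2) by (intro sum_bounded_below)
    finally show ?thesis using i(1) by auto
  qed auto
  then obtain c where c: "\<And>k. k \<le> r \<Longrightarrow> c k \<in> V k"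
    "\<And>k. k \<le> r \<Longrightarrow> n0 * (poly p (t (c k)))\<^sup>2 \<le> (\<Sum>j\<in>V k. (poly p (t j))\<^sup>2)"
    by metis
  have disj: "V k \<inter> V l = {}" if "k \<le> r" "l \<le> r" "k \<noteq> l" for k l
    using sep[OF that] h d by (fastforce simp: divide_le_0_iff)
  have "n0 * (\<Sum>k\<le>r. (poly p (t (c k)))\<^sup>2) \<le> (\<Sum>k\<le>r. \<Sum>j\<in>V k. (poly p (t j))\<^sup>2)"
    unfolding sum_distrib_left using c(2) by (intro sum_mono) auto
  also have "\<dots> = (\<Sum>j\<in>(\<Union>k\<le>r. V k). (poly p (t j))\<^sup>2)"
    using fin disj by (intro sum.UNION_disjoint[symmetric]) auto
  also have "\<dots> \<le> (\<Sum>j\<in>W. (poly p (t j))\<^sup>2)"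
    using W by (intro sum_mono2) auto
  finally have *: "(\<Sum>k\<le>r. (poly p (t (c k)))\<^sup>2) \<le> (\<Sum>j\<in>W. (poly p (t j))\<^sup>2) / n0"
    using n0 by (simp add: field_simps)
  have "(poly p 0)\<^sup>2 \<le> (real r + 1) * d ^ (2 * r) * (\<Sum>k\<le>r. (poly p (t (c k)))\<^sup>2)"
    by (rule eval_zero_le_separated_nodes[OF deg h d]) (use bound sep c(1) in auto)
  also have "\<dots> \<le> (real r + 1) * d ^ (2 * r) * ((\<Sum>j\<in>W. (poly p (t j))\<^sup>2) / n0)"
    using d by (intro mult_left_mono *) auto
  finally show ?thesis by simp
qed

text \<open>Every other one of the \<open>2 r + 2\<close> equal parts of \<open>[z, z + h]\<close> for \<open>\<epsilon> = 1\<close>, and of \<open>[z - h, z]\<close>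
  for \<open>\<epsilon> = -1\<close>. The parts left out keep the blocks at distance \<open>h / (2 r + 2)\<close> from each other.\<close>

definition block :: "nat \<Rightarrow> real \<Rightarrow> real \<Rightarrow> real \<Rightarrow> nat \<Rightarrow> real set" where
  "block r \<epsilon> z h k = {t. 2 * real k * h / (2 * real r + 2) \<le> \<epsilon> * (t - z) \<and> \<epsilon> * (t - z) \<le> (2 * real k + 1) * h / (2 * real r + 2)}"

definition hits :: "nat \<Rightarrow> (nat \<Rightarrow> real) \<Rightarrow> real set \<Rightarrow> real" where
  "hits m x A = (\<Sum>i=1..m. indicator A (x i))"

lemma hits_eq_card: "hits m x A = real (card {i\<in>{1..m}. x i \<in> A})"
  unfolding hits_def using sum.mono_neutral_cong_right[of "{1..m}" "{i\<in>{1..m}. x i \<in> A}" "\<lambda>i. indicator A (x i) :: real" "\<lambda>_. 1"]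
  by (auto simp: subset_iff)

lemma hits_window: "hits m x (window z h) = real (card (active m x z h))"
  unfolding hits_eq_card active_def in_window_iff ..

lemma block_separated:
  assumes "\<epsilon> \<in> {1, -1}" "h > 0" "k \<noteq> l" "t \<in> block r \<epsilon> z h k" "t' \<in> block r \<epsilon> z h l"
  shows "h / (2 * real r + 2) \<le> \<bar>(t - z) - (t' - z)\<bar>"
proof -
  have *: "h / (2 * real r + 2) \<le> \<bar>(a - z) - (b - z)\<bar>"
    if kl: "k < l" and a: "a \<in> block r \<epsilon> z h k" and b: "b \<in> block r \<epsilon> z h l" for k l a b
  proof -
    have "(2 * real k + 2) * h / (2 * real r + 2) \<le> 2 * real l * h / (2 * real r + 2)"
      using kl \<open>h > 0\<close> by (intro divide_right_mono mult_right_mono) auto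
    moreover have "(2 * real k + 2) * h / (2 * real r + 2) = (2 * real k + 1) * h / (2 * real r + 2) + h / (2 * real r + 2)"
      by (simp add: add_divide_distrib[symmetric] algebra_simps)
    ultimately have "h / (2 * real r + 2) \<le> \<epsilon> * (b - z) - \<epsilon> * (a - z)"
      using a b unfolding block_def by simp
    also have "\<dots> \<le> \<bar>(a - z) - (b - z)\<bar>" using assms(1) by auto
    finally show ?thesis .
  qed
  show ?thesis
  proof (cases "k < l")
    case True
    then show ?thesis using * assms by blast
  next
    case False
    then have "l < k" using assms(3) by simp
    from *[OF this assms(5,4)] show ?thesis by (simp add: abs_minus_commute)
  qed
qed

lemma block_in_half_window:
  assumes "h > 0" "k \<le> r" "t \<in> block r \<epsilon> z h k"
  shows "0 \<le> \<epsilon> * (t - z)" "\<epsilon> * (t - z) \<le> h"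
proof -
  have "(2 * real k + 1) * h \<le> (2 * real r + 2) * h" using assms by (intro mult_right_mono) auto
  then have "(2 * real k + 1) * h / (2 * real r + 2) \<le> h"
    by (subst pos_divide_le_eq) (auto simp: mult.commute)
  then show "\<epsilon> * (t - z) \<le> h" using assms unfolding block_def by simp
  have "0 \<le> 2 * real k * h / (2 * real r + 2)" using assms by simp
  then show "0 \<le> \<epsilon> * (t - z)" using assms(3) unfolding block_def by simp
qed

lemma block_eq_interval:
  assumes "\<epsilon> \<in> {1, -1}" "h > 0"
  obtains a where "block r \<epsilon> z h k = {a..a + h / (2 * real r + 2)}"
proof -
  let ?d = "2 * real r + 2"
  have eq: "(2 * real k + 1) * h / ?d = 2 * real k * h / ?d + h / ?d"
    by (simp add: add_divide_distrib[symmetric] algebra_simps)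
  show thesis
  proof (cases "\<epsilon> = 1")
    case True
    have "block r \<epsilon> z h k = {z + 2 * real k * h / ?d..(z + 2 * real k * h / ?d) + h / ?d}"
      unfolding block_def eq using True by auto
    then show ?thesis by (rule that)
  next
    case False
    then have "\<epsilon> = -1" using assms by auto
    then have "block r \<epsilon> z h k = {z - 2 * real k * h / ?d - h / ?d..(z - 2 * real k * h / ?d - h / ?d) + h / ?d}"
      unfolding block_def eq by auto
    then show ?thesis by (rule that)
  qed
qed

context bandwidth_setup
begin

text \<open>Too few observations in the window of width \<open>h\<close> make \<open>h\<close> inadmissible, hence \<open>h < H\<close>. All blocks
  lie in the window of width \<open>h\<close>, thus in that of width \<open>H\<close>, and supply the constant \<open>K\<close> for the
  latter. Minimality of \<open>H\<close> gives, for the open window, \<open>L\<^sup>2 H\<^bsup>2s\<^esup> N \<le> \<sigma>1\<^sup>2\<close>; without ties the boundary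
  carries at most one further observation, and the open window contains the blocks, so that the
  closed window satisfies this with an additional factor \<open>2\<close>. The bound \<open>n0_large\<close> says that \<open>1 / 2\<close> is admissible, so that \<open>H\<close> exists.\<close>

lemma conditional_risk_le_good_design:
  assumes \<epsilon>: "\<epsilon> \<in> {1, -1}" and h: "0 < h" "h \<le> 1 / 2" and n0: "n0 > 0"
    and few: "(L * h powr s)\<^sup>2 * hits m x (window z h) < \<sigma>1\<^sup>2"
    and many: "\<And>k. k \<le> r \<Longrightarrow> n0 \<le> hits m x (block r \<epsilon> z h k)"
    and n0_large: "\<sigma>1\<^sup>2 \<le> (L * (1 / 2) powr s)\<^sup>2 * n0"
    and no_ties: "\<And>i j. i \<in> {1..m} \<Longrightarrow> j \<in> {1..m} \<Longrightarrow> i \<noteq> j \<Longrightarrow> \<bar>x i - z\<bar> \<noteq> \<bar>x j - z\<bar>"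
    and f: "f \<in> holder_class s L" and r: "real r + 1 \<ge> s"
    and \<sigma>: "\<And>t. 0 < \<sigma> t" "\<And>t. \<sigma> t \<le> \<sigma>1"
  shows "conditional_risk r s L \<sigma>1 m \<sigma> f z x
    \<le> ennreal (3 * \<sigma>1\<^sup>2 * ((real r + 1) * (2 * real r + 2) ^ (2 * r) / n0))"
proof -
  define d where "d = 2 * real r + 2"
  define H where "H = bandwidth s L \<sigma>1 m x z"
  define V where "V k = {i\<in>{1..m}. x i \<in> block r \<epsilon> z h k}" for k
  define K where "K = (real r + 1) * d ^ (2 * r) / n0"
  have d: "d > 0" unfolding d_def by simp
  have V_card: "n0 \<le> real (card (V k))" if "k \<le> r" for k
    using many[OF that] unfolding hits_eq_card V_def .
  have V_dist: "\<bar>x i - z\<bar> \<le> h" if "k \<le> r" "i \<in> V k" for k i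
    using block_in_half_window[OF h(1) that(1), of "x i" \<epsilon> z] that(2) \<epsilon> unfolding V_def by auto
  have V_active: "V k \<subseteq> active m x z h" if "k \<le> r" for k
    using V_dist[OF that] unfolding V_def active_def by auto
  have "n0 \<le> real (card (active m x z (1 / 2)))"
  proof -
    have "card (V 0) \<le> card (active m x z (1 / 2))"
      using V_active[of 0] active_mono[of h "1/2" m x z] h by (intro card_mono) auto
    then show ?thesis using V_card[of 0] by simp
  qed
  then have "(L * (1 / 2) powr s)\<^sup>2 * n0 \<le> (L * (1 / 2) powr s)\<^sup>2 * real (card (active m x z (1 / 2)))"
    by (intro mult_left_mono) auto
  then have "adm m x z (1 / 2)" using n0_large unfolding adm_iff by auto
  then have ex: "\<exists>h. adm m x z h" by blast
  have admH: "adm m x z H" unfolding H_def by (rule bandwidth_admissible_least(1)[OF ex])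
  have H: "0 < H" "H < 1" using admH unfolding adm_iff by auto
  have "\<not> adm m x z h" using few unfolding adm_iff hits_window by simp
  then have "h < H" using admissible_mono[OF admH, of h] h by force
  have VW: "V k \<subseteq> active m x z H" if "k \<le> r" for k
    using V_active[OF that] active_mono[of h H m x z] \<open>h < H\<close> by auto
  have K: "(poly q 0)\<^sup>2 \<le> K * (\<Sum>i\<in>active m x z H. (poly q (x i - z))\<^sup>2)" if "degree q \<le> r" for q
    unfolding K_def
  proof (rule eval_zero_le_blocks[OF that h(1) d n0, of _ V])
    show "h / d \<le> \<bar>x i - z - (x j - z)\<bar>" if "k \<le> r" "l \<le> r" "k \<noteq> l" "i \<in> V k" "j \<in> V l" for k l i j
      using block_separated[OF \<epsilon> h(1) \<open>k \<noteq> l\<close>] that unfolding V_def d_def by auto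
  qed (use VW V_card V_dist in auto)
  have ne: "V k \<noteq> {}" if "k \<le> r" for k using V_card[OF that] n0 by auto
  have reg: "regular_event r s L \<sigma>1 m x z"
    unfolding regular_event_iff_det H_def[symmetric]
  proof (intro conjI ex det_local_matrix_nonzero)
    show "H \<noteq> 0" using H by simp
    show "active m x z H \<noteq> {}" using VW[of 0] ne[of 0] by auto
    fix p :: "real poly" assume p: "degree p \<le> r" "\<forall>i\<in>active m x z H. poly p (x i - z) = 0"
    define c where "c k = (SOME i. i \<in> V k)" for k
    have c: "c k \<in> V k" if "k \<le> r" for k
      unfolding c_def using ne[OF that] by (rule some_in_eq[THEN iffD2])
    have inj: "inj_on (\<lambda>k. x (c k) - z) {..r}"
    proof (intro inj_onI, rule ccontr)
      fix k l assume kl: "k \<in> {..r}" "l \<in> {..r}" "x (c k) - z = x (c l) - z" "k \<noteq> l"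
      then have "x (c l) \<in> block r \<epsilon> z h k" "x (c l) \<in> block r \<epsilon> z h l"
        using c[of k] c[of l] unfolding V_def by auto
      then have "h / (2 * real r + 2) \<le> 0"
        using block_separated[OF \<epsilon> h(1) \<open>k \<noteq> l\<close>] by fastforce
      then show False using h by (simp add: divide_le_0_iff)
    qed
    have "poly p t = 0" for t
      unfolding lagrange_interpolation_at[OF p(1) inj, of t] using p(2) VW c by (intro sum.neutral) force
    then show "p = 0" using poly_all_0_iff_0 by blast
  qed
  have count: "(L * H powr s)\<^sup>2 * real (card (active m x z H)) \<le> 2 * \<sigma>1\<^sup>2"
  proof -
    define A where "A = {i\<in>{1..m}. \<bar>x i - z\<bar> < H}"
    define B where "B = {i\<in>{1..m}. \<bar>x i - z\<bar> = H}"
    have "V 0 \<subseteq> A" using V_dist[of 0] \<open>h < H\<close> unfolding A_def V_def by fastforce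
    then have "A \<noteq> {}" using ne[of 0] by auto
    moreover have fin: "finite A" "finite B" unfolding A_def B_def by auto
    ultimately have "card A \<ge> 1" by (simp add: Suc_leI card_gt_0_iff)
    moreover have "card B \<le> 1"
      using no_ties unfolding B_def by (subst card_le_Suc0_iff_eq[unfolded One_nat_def[symmetric]]) auto
    moreover have "card (active m x z H) \<le> card A + card B"
    proof -
      have "active m x z H \<subseteq> A \<union> B" unfolding active_def A_def B_def by auto
      then show ?thesis using card_mono[of "A \<union> B"] card_Un_le[of A B] fin by (meson finite_UnI order_trans)
    qed
    ultimately have "real (card (active m x z H)) \<le> 2 * real (card A)" by linarith
    then have "(L * H powr s)\<^sup>2 * real (card (active m x z H)) \<le> (L * H powr s)\<^sup>2 * (2 * real (card A))"
      by (intro mult_left_mono) auto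
    then show ?thesis using open_window_count_le[OF ex] unfolding H_def A_def by simp
  qed
  have "conditional_risk r s L \<sigma>1 m \<sigma> f z x
      \<le> ennreal (((L * H powr s)\<^sup>2 * real (card (active m x z H)) + \<sigma>1\<^sup>2) * K)"
    using conditional_risk_le[OF reg f r \<sigma>, of K] K unfolding H_def by simp
  also have "\<dots> \<le> ennreal (3 * \<sigma>1\<^sup>2 * K)"
    using count n0 d unfolding K_def by (intro ennreal_leI mult_right_mono) auto
  finally show ?thesis unfolding K_def d_def .
qed

end

section \<open>Fluctuations of the design\<close>

text \<open>Two observations at the same distance from \<open>z\<close> would let the number of observations in the
  window jump by more than one at the selected bandwidth.\<close>

lemma ties_negligible:
  assumes "prob_space P" and sets: "sets P = sets (borel :: real measure)"
    and atomless: "\<And>c. emeasure P {c} = 0"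
  shows "AE x in PiM {1..m::nat} (\<lambda>_. P). \<forall>i\<in>{1..m}. \<forall>j\<in>{1..m}. i \<noteq> j \<longrightarrow> \<bar>x i - z\<bar> \<noteq> \<bar>x j - z\<bar>"
proof (intro AE_finite_allI finite_atLeastAtMost)
  interpret P: prob_space P by fact
  interpret PP: product_prob_space "\<lambda>_. P" by (intro product_prob_spaceI) unfold_locales
  fix i j assume ij: "i \<in> {1..m}" "j \<in> {1..m}"
  show "AE x in PiM {1..m} (\<lambda>_. P). i \<noteq> j \<longrightarrow> \<bar>x i - z\<bar> \<noteq> \<bar>x j - z\<bar>"
  proof (cases "i = j")
    case False
    define J where "J = {1..m} - {i}"
    have J: "{1..m} = insert i J" "finite J" "i \<notin> J" "j \<in> J" using ij False unfolding J_def by auto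
    have comp: "(\<lambda>x. x k) \<in> borel_measurable (PiM (insert i J) (\<lambda>_. P))" if "k \<in> insert i J" for k
      using measurable_component_singleton[OF that, of "\<lambda>_. P"]
      unfolding measurable_cong_sets[OF refl sets] .
    have [measurable]: "(\<lambda>x. \<bar>x k - z\<bar>) \<in> borel_measurable (PiM (insert i J) (\<lambda>_. P))" if "k \<in> {i, j}" for k
      using that J by (intro borel_measurable_abs borel_measurable_diff borel_measurable_const comp) auto
    have "{x \<in> space (PiM (insert i J) (\<lambda>_. P)). \<bar>x i - z\<bar> \<noteq> \<bar>x j - z\<bar>} \<in> sets (PiM (insert i J) (\<lambda>_. P))"
      by (rule borel_measurable_neq) simp_all
    then have meas [measurable]: "Measurable.pred (PiM (insert i J) (\<lambda>_. P)) (\<lambda>x. \<bar>x i - z\<bar> \<noteq> \<bar>x j - z\<bar>)"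
      by (simp add: pred_def)
    have "(\<integral>\<^sup>+ x. indicator {x. \<not> \<bar>x i - z\<bar> \<noteq> \<bar>x j - z\<bar>} x \<partial>PiM (insert i J) (\<lambda>_. P))
        = (\<integral>\<^sup>+ x. \<integral>\<^sup>+ a. indicator {x. \<not> \<bar>x i - z\<bar> \<noteq> \<bar>x j - z\<bar>} (x(i := a)) \<partial>P \<partial>PiM J (\<lambda>_. P))"
      using J by (intro PP.product_nn_integral_insert) measurable
    \<comment> \<open>Given the other coordinates, a tie leaves at most two values for the \<open>i\<close>-th one.\<close>
    also have "\<dots> = (\<integral>\<^sup>+ x. 0 \<partial>PiM J (\<lambda>_. P))"
    proof (intro nn_integral_cong)
      fix x :: "nat \<Rightarrow> real"
      let ?c = "\<bar>x j - z\<bar>"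
      have "(\<integral>\<^sup>+ a. indicator {x. \<not> \<bar>x i - z\<bar> \<noteq> \<bar>x j - z\<bar>} (x(i := a)) \<partial>P)
          \<le> (\<integral>\<^sup>+ a. indicator {z + ?c} a + indicator {z - ?c} a \<partial>P)"
      proof (intro nn_integral_mono)
        fix a
        have "a = z + ?c \<or> a = z - ?c" if "\<bar>a - z\<bar> = ?c" using that by arith
        then have "a \<in> {z + ?c} \<or> a \<in> {z - ?c}" if "\<bar>a - z\<bar> = ?c" using that by blast
        then show "indicator {x. \<not> \<bar>x i - z\<bar> \<noteq> \<bar>x j - z\<bar>} (x(i := a))
            \<le> (indicator {z + ?c} a + indicator {z - ?c} a :: ennreal)"
          using False by (cases "\<bar>a - z\<bar> = ?c") (auto split: split_indicator)
      qed
      also have "\<dots> = 0"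
        by (subst nn_integral_add) (auto intro!: borel_measurable_indicator simp: atomless sets)
      finally show "(\<integral>\<^sup>+ a. indicator {x. \<not> \<bar>x i - z\<bar> \<noteq> \<bar>x j - z\<bar>} (x(i := a)) \<partial>P) = 0" by simp
    qed
    finally have "AE x in PiM (insert i J) (\<lambda>_. P). \<bar>x i - z\<bar> \<noteq> \<bar>x j - z\<bar>"
      using meas by (subst AE_iff_nn_integral) (simp_all add: pred_def)
    then show ?thesis unfolding J(1) by eventually_elim simp
  qed simp
qed

text \<open>The number of observations in \<open>A\<close> is binomial, and its variance is at most its mean.\<close>

lemma hits_chebyshev:
  assumes "prob_space P" and sets: "sets P = sets (borel :: real measure)" and A: "A \<in> sets borel"
  shows "(\<integral>\<^sup>+ x. ennreal ((hits m x A - real m * measure P A)\<^sup>2) \<partial>PiM {1..m} (\<lambda>_. P))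
    \<le> ennreal (real m * measure P A)"
proof -
  interpret P: prob_space P by fact
  interpret PP: product_prob_space "\<lambda>_. P" by (intro product_prob_spaceI) unfold_locales
  have A' [measurable]: "A \<in> sets P" using A sets by simp
  define p where "p = measure P A"
  define g where "g = (\<lambda>(i::nat) a. indicator A a - p)"
  have sq: "(indicator A a - p)\<^sup>2 = (1 - 2 * p) * indicator A a + p\<^sup>2" for a
    by (auto simp: indicator_def power2_eq_square algebra_simps)
  have int: "integrable P (g i)" "(\<integral>a. g i a \<partial>P) = 0" "integrable P (\<lambda>a. (g i a)\<^sup>2)" "(\<integral>a. (g i a)\<^sup>2 \<partial>P) = p - p\<^sup>2" for i
  proof -
    have ind: "integrable P (indicat_real A)"
      by (rule integrable_real_indicator[OF A']) (simp add: P.emeasure_eq_measure)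
    have ind': "(\<integral>a. indicat_real A a \<partial>P) = p"
      using sets.sets_into_space[OF A'] by (simp add: p_def Int_absorb2)
    show "integrable P (g i)" "(\<integral>a. g i a \<partial>P) = 0"
      unfolding g_def using ind ind' by (simp_all add: P.prob_space)
    show "integrable P (\<lambda>a. (g i a)\<^sup>2)"
      unfolding g_def sq using ind by simp
    have "(\<integral>a. (g i a)\<^sup>2 \<partial>P) = (1 - 2 * p) * p + p\<^sup>2"
      unfolding g_def sq using ind ind' by (simp add: P.prob_space)
    then show "(\<integral>a. (g i a)\<^sup>2 \<partial>P) = p - p\<^sup>2"
      by (simp add: power2_eq_square algebra_simps)
  qed
  have "hits m x A - real m * p = 0 + (\<Sum>i=1..m. g i (x i))" for x
    unfolding hits_def g_def by (simp add: sum_subtractf)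
  then have "(\<integral>\<^sup>+ x. ennreal ((hits m x A - real m * p)\<^sup>2) \<partial>PiM {1..m} (\<lambda>_. P))
      = (\<integral>\<^sup>+ x. ennreal ((0 + (\<Sum>i\<in>{1..m}. g i (x i)))\<^sup>2) \<partial>PiM {1..m} (\<lambda>_. P))"
    by simp
  also have "\<dots> = ennreal (0\<^sup>2 + (\<Sum>i\<in>{1..m}. \<integral>a. (g i a)\<^sup>2 \<partial>P))"
    by (rule PP.nn_integral_PiM_square_of_sum) (auto simp: int)
  also have "\<dots> \<le> ennreal (real m * p)"
    by (intro ennreal_leI) (simp add: int algebra_simps)
  finally show ?thesis unfolding p_def .
qed

section \<open>The risk at a point\<close>

text \<open>Near a point with positive density this is continuity. Near a zero \<open>z0\<close> the density grows away
  from \<open>z0\<close>, so the side of \<open>z\<close> that points away from \<open>z0\<close> will do. Compactness makes the range of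
  \<open>h\<close> uniform.\<close>

lemma density_locally_comparable_one_sided:
  fixes \<mu> :: "real \<Rightarrow> real"
  assumes nonneg: "\<And>x. 0 \<le> \<mu> x" and cont: "continuous_on UNIV \<mu>" and S: "compact S"
    and zeros: "\<And>z. z \<in> S \<Longrightarrow> \<mu> z = 0 \<Longrightarrow>
      \<exists>a>0. \<exists>b>0. antimono_on {z - a..z} \<mu> \<and> mono_on {z..z + b} \<mu>"
  obtains \<delta> where "\<delta> > 0" "\<And>z h. z \<in> S \<Longrightarrow> h \<le> \<delta> \<Longrightarrow>
    \<exists>\<epsilon>\<in>{1, -1}. \<forall>t. 0 \<le> \<epsilon> * (t - z) \<and> \<epsilon> * (t - z) \<le> h \<longrightarrow> \<mu> z / 4 \<le> \<mu> t"
proof -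
  \<comment> \<open>The claim holds with one \<open>\<rho>\<close> for all \<open>z\<close> close to a given point \<open>z0\<close>.\<close>
  have "\<exists>\<rho>>0. \<forall>z h. \<bar>z - z0\<bar> < \<rho> \<and> h \<le> \<rho> \<longrightarrow>
      (\<exists>\<epsilon>\<in>{1, -1}. \<forall>t. 0 \<le> \<epsilon> * (t - z) \<and> \<epsilon> * (t - z) \<le> h \<longrightarrow> \<mu> z / 4 \<le> \<mu> t)" if z0: "z0 \<in> S" for z0
  proof (cases "\<mu> z0 = 0")
    case True
    obtain a b where ab: "a > 0" "b > 0" "antimono_on {z0 - a..z0} \<mu>" "mono_on {z0..z0 + b} \<mu>"
      using zeros[OF z0 True] by blast
    show ?thesis
    proof (intro exI[of _ "min a b / 2"] conjI allI impI)
      show "0 < min a b / 2" using ab by simp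
      fix z h assume zh: "\<bar>z - z0\<bar> < min a b / 2 \<and> h \<le> min a b / 2"
      show "\<exists>\<epsilon>\<in>{1, -1}. \<forall>t. 0 \<le> \<epsilon> * (t - z) \<and> \<epsilon> * (t - z) \<le> h \<longrightarrow> \<mu> z / 4 \<le> \<mu> t"
      proof (cases "z0 \<le> z")
        case True
        have "\<mu> z / 4 \<le> \<mu> t" if "0 \<le> t - z" "t - z \<le> h" for t
        proof -
          have "\<mu> z \<le> \<mu> t" using True that zh by (intro monotone_onD[OF ab(4)]) auto
          then show ?thesis using nonneg[of z] by linarith
        qed
        then show ?thesis by (intro bexI[of _ 1]) auto
      next
        case False
        have "\<mu> z / 4 \<le> \<mu> t" if "0 \<le> z - t" "z - t \<le> h" for t
        proof -
          have "\<mu> t \<ge> \<mu> z" using False that zh by (intro monotone_onD[OF ab(3)]) auto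
          then show ?thesis using nonneg[of z] by linarith
        qed
        then show ?thesis by (intro bexI[of _ "-1"]) auto
      qed
    qed
  next
    case False
    then have pos: "\<mu> z0 / 3 > 0" using nonneg[of z0] by simp
    obtain e where e: "e > 0" "\<And>t. \<bar>t - z0\<bar> < e \<Longrightarrow> \<bar>\<mu> t - \<mu> z0\<bar> < \<mu> z0 / 3"
      using cont pos unfolding continuous_on_iff dist_real_def by (metis UNIV_I)
    show ?thesis
    proof (intro exI[of _ "e / 2"] conjI allI impI)
      show "0 < e / 2" using e by simp
      fix z h assume zh: "\<bar>z - z0\<bar> < e / 2 \<and> h \<le> e / 2"
      have "\<mu> z / 4 \<le> \<mu> t" if "0 \<le> t - z" "t - z \<le> h" for t
      proof -
        have "\<bar>\<mu> t - \<mu> z0\<bar> < \<mu> z0 / 3" "\<bar>\<mu> z - \<mu> z0\<bar> < \<mu> z0 / 3"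
          using that zh e by (intro e(2); linarith)+
        then show ?thesis by linarith
      qed
      then show "\<exists>\<epsilon>\<in>{1, -1}. \<forall>t. 0 \<le> \<epsilon> * (t - z) \<and> \<epsilon> * (t - z) \<le> h \<longrightarrow> \<mu> z / 4 \<le> \<mu> t"
        by (intro bexI[of _ 1]) auto
    qed
  qed
  then obtain \<rho> where \<rho>: "\<And>z0. z0 \<in> S \<Longrightarrow> \<rho> z0 > 0"
    "\<And>z0 z h. z0 \<in> S \<Longrightarrow> \<bar>z - z0\<bar> < \<rho> z0 \<Longrightarrow> h \<le> \<rho> z0 \<Longrightarrow>
      \<exists>\<epsilon>\<in>{1, -1}. \<forall>t. 0 \<le> \<epsilon> * (t - z) \<and> \<epsilon> * (t - z) \<le> h \<longrightarrow> \<mu> z / 4 \<le> \<mu> t"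
    by metis
  obtain C where C: "C \<subseteq> S" "finite C" "S \<subseteq> (\<Union>c\<in>C. ball c (\<rho> c))"
    by (rule compactE_image[OF S, of S "\<lambda>c. ball c (\<rho> c)"]) (use \<rho>(1) in \<open>auto intro!: bexI\<close>)
  show thesis
  proof
    show "Min (insert 1 (\<rho> ` C)) > 0" using C \<rho>(1) by (subst Min_gr_iff) auto
    fix z h assume "z \<in> S" and h: "h \<le> Min (insert 1 (\<rho> ` C))"
    then obtain c where c: "c \<in> C" "z \<in> ball c (\<rho> c)" using C by blast
    have "h \<le> \<rho> c" using h c(1) C(2) by (auto simp: Min_le_iff)
    then show "\<exists>\<epsilon>\<in>{1, -1}. \<forall>t. 0 \<le> \<epsilon> * (t - z) \<and> \<epsilon> * (t - z) \<le> h \<longrightarrow> \<mu> z / 4 \<le> \<mu> t"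
      using \<rho>(2)[of c z h] c C(1) by (auto simp: dist_real_def abs_minus_commute)
  qed
qed

lemma measure_interval_bounds:
  fixes \<mu> :: "real \<Rightarrow> real"
  assumes P: "P = density lborel (\<lambda>x. ennreal (\<mu> x))" "prob_space P"
    and [measurable]: "\<mu> \<in> borel_measurable borel" and "u \<le> v" "0 \<le> c"
  shows "(\<And>t. t \<in> {u..v} \<Longrightarrow> c \<le> \<mu> t) \<Longrightarrow> c * (v - u) \<le> measure P {u..v}"
    and "(\<And>t. t \<in> {u..v} \<Longrightarrow> \<mu> t \<le> c) \<Longrightarrow> measure P {u..v} \<le> c * (v - u)"
proof -
  interpret prob_space P by fact
  have em: "ennreal (measure P {u..v}) = (\<integral>\<^sup>+ t. ennreal (\<mu> t) * indicator {u..v} t \<partial>lborel)"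
    unfolding emeasure_eq_measure[symmetric] unfolding P(1) by (rule emeasure_density) auto
  have const: "(\<integral>\<^sup>+ t. ennreal c * indicator {u..v} t \<partial>lborel) = ennreal (c * (v - u))"
    using assms(4,5) by (simp add: nn_integral_cmult_indicator ennreal_mult)
  show "c * (v - u) \<le> measure P {u..v}" if "\<And>t. t \<in> {u..v} \<Longrightarrow> c \<le> \<mu> t"
  proof -
    have "ennreal (c * (v - u)) \<le> ennreal (measure P {u..v})"
      unfolding em const[symmetric] using that
      by (intro nn_integral_mono) (auto simp: indicator_def intro!: ennreal_leI)
    then show ?thesis by simp
  qed
  show "measure P {u..v} \<le> c * (v - u)" if "\<And>t. t \<in> {u..v} \<Longrightarrow> \<mu> t \<le> c"
  proof -
    have "ennreal (measure P {u..v}) \<le> ennreal (c * (v - u))"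
      unfolding em const[symmetric] using that
      by (intro nn_integral_mono) (auto simp: indicator_def intro!: ennreal_leI)
    then show ?thesis using assms(4,5) by simp
  qed
qed

lemma holder_class_continuous:
  assumes f: "f \<in> holder_class s L" and s: "s > 0"
  shows "continuous_on UNIV f"
proof (cases "strict_floor s = 0")
  case True
  then have holder: "\<bar>f x - f y\<bar> \<le> L * \<bar>x - y\<bar> powr s" for x y
    using f unfolding holder_class_def by simp
  have "isCont f x" for x
  proof -
    have "((\<lambda>y. L * \<bar>y - x\<bar> powr s) \<longlongrightarrow> L * \<bar>x - x\<bar> powr s) (at x)"
      using s by (intro tendsto_intros disjI2) auto
    moreover have "\<forall>\<^sub>F y in at x. norm (f y - f x) \<le> L * \<bar>y - x\<bar> powr s"
      unfolding real_norm_def by (intro always_eventually allI holder)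
    ultimately have "((\<lambda>y. f y - f x) \<longlongrightarrow> 0) (at x)"
      using s by (intro Lim_null_comparison[of "\<lambda>y. f y - f x"]) simp_all
    then show ?thesis unfolding isCont_def by (simp add: LIM_zero_iff)
  qed
  then show ?thesis by (simp add: continuous_at_imp_continuous_on)
next
  case False
  then have "(deriv ^^ 0) f differentiable (at x)" for x
    using f unfolding holder_class_def by blast
  then show ?thesis
    by (auto intro!: continuous_at_imp_continuous_on differentiable_imp_continuous_within)
qed

lemma truncate_loss_bounds:
  assumes "\<bar>v\<bar> \<le> Q"
  shows "(truncate Q u - v)\<^sup>2 \<le> (u - v)\<^sup>2" "(truncate Q u - v)\<^sup>2 \<le> 4 * Q\<^sup>2"
proof -
  have "\<bar>truncate Q u - v\<bar> \<le> \<bar>u - v\<bar>" "\<bar>truncate Q u - v\<bar> \<le> \<bar>2 * Q\<bar>"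
    using assms unfolding truncate_def by (auto simp: max_def min_def)
  then have "\<bar>truncate Q u - v\<bar>\<^sup>2 \<le> \<bar>u - v\<bar>\<^sup>2" "\<bar>truncate Q u - v\<bar>\<^sup>2 \<le> \<bar>2 * Q\<bar>\<^sup>2"
    by (intro power_mono; simp)+
  then show "(truncate Q u - v)\<^sup>2 \<le> (u - v)\<^sup>2" "(truncate Q u - v)\<^sup>2 \<le> 4 * Q\<^sup>2"
    by (simp_all add: power_mult_distrib)
qed

context regression_model
begin

definition conditional_truncated_risk :: "nat \<Rightarrow> real \<Rightarrow> nat \<Rightarrow> real \<Rightarrow> (nat \<Rightarrow> real) \<Rightarrow> ennreal" where
  "conditional_truncated_risk r Q m z x =
    (\<integral>\<^sup>+ y. ennreal ((truncate Q (local_poly_estimator r s L \<sigma>1 m (\<lambda>i. (x i, y i)) z) - f z)\<^sup>2)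
       \<partial>response_law \<sigma> f m x)"

definition truncated_risk_at :: "nat \<Rightarrow> real \<Rightarrow> nat \<Rightarrow> real \<Rightarrow> ennreal" where
  "truncated_risk_at r Q m z = (\<integral>\<^sup>+ x. conditional_truncated_risk r Q m z x \<partial>design_law m)"

lemma conditional_truncated_risk_le:
  assumes Q: "\<And>t. \<bar>f t\<bar> \<le> Q"
  shows "conditional_truncated_risk r Q m z x \<le> ennreal (4 * Q\<^sup>2)"
    and "conditional_truncated_risk r Q m z x \<le> conditional_risk r s L \<sigma>1 m \<sigma> f z x"
proof -
  interpret E: prob_space "response_law \<sigma> f m x" by (rule prob_response_law)
  have "conditional_truncated_risk r Q m z x \<le> (\<integral>\<^sup>+ y. ennreal (4 * Q\<^sup>2) \<partial>response_law \<sigma> f m x)"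
    unfolding conditional_truncated_risk_def by (intro nn_integral_mono ennreal_leI truncate_loss_bounds Q)
  then show "conditional_truncated_risk r Q m z x \<le> ennreal (4 * Q\<^sup>2)" by (simp add: E.emeasure_space_1)
  show "conditional_truncated_risk r Q m z x \<le> conditional_risk r s L \<sigma>1 m \<sigma> f z x"
    unfolding conditional_truncated_risk_def conditional_risk_def pointwise_loss_def
    by (intro nn_integral_mono ennreal_leI truncate_loss_bounds Q)
qed

lemma hits_measurable [measurable]:
  assumes A [measurable]: "A \<in> sets borel"
  shows "(\<lambda>x. hits m x A) \<in> borel_measurable (design_law m)"
proof -
  have [measurable]: "(\<lambda>x. x i) \<in> borel_measurable (design_law m)" if "i \<in> {1..m}" for i
    using measurable_component_singleton[OF that, of "\<lambda>_. PZ"]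
    unfolding measurable_cong_sets[OF refl sets_PZ] .
  show ?thesis unfolding hits_def by measurable
qed

text \<open>On a good design the conditional bound applies. On any other design without ties one of the
  normalized squared deviations \<open>dw\<close>, \<open>db k\<close> of the counts is at least \<open>1\<close>, while the truncated loss
  is at most \<open>4 Q\<^sup>2\<close>. Integrating the sum of both bounds is Chebyshev's inequality.\<close>

proposition truncated_risk_at_le:
  assumes f: "f \<in> holder_class s L" and Q: "\<And>t. \<bar>f t\<bar> \<le> Q" and r: "real r + 1 \<ge> s"
    and \<sigma>_le: "\<And>t. \<sigma> t \<le> \<sigma>1"
    and atomless: "\<And>c. emeasure PZ {c} = 0"
    and \<epsilon>: "\<epsilon> \<in> {1, -1}" and h: "0 < h" "h \<le> 1 / 2" and n0: "n0 > 0"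
    and n0_large: "\<sigma>1\<^sup>2 \<le> (L * (1 / 2) powr s)\<^sup>2 * n0"
    and window_mass: "2 * (real m * measure PZ (window z h)) * (L * h powr s)\<^sup>2 \<le> \<sigma>1\<^sup>2"
    and block_mass: "\<And>k. k \<le> r \<Longrightarrow> 2 * n0 \<le> real m * measure PZ (block r \<epsilon> z h k)"
  shows "truncated_risk_at r Q m z \<le> ennreal (3 * \<sigma>1\<^sup>2 * ((real r + 1) * (2 * real r + 2) ^ (2 * r) / n0)
      + 4 * Q\<^sup>2 * (2 * ((L * h powr s)\<^sup>2 / \<sigma>1\<^sup>2) + (real r + 1) * (2 / n0)))"
proof -
  define T where "T = \<sigma>1\<^sup>2 / (L * h powr s)\<^sup>2"
  define V where "V = 3 * \<sigma>1\<^sup>2 * ((real r + 1) * (2 * real r + 2) ^ (2 * r) / n0)"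
  define pw where "pw = measure PZ (window z h)"
  define pb where "pb k = measure PZ (block r \<epsilon> z h k)" for k
  define dw where "dw x = ((hits m x (window z h) - real m * pw) / (T / 2))\<^sup>2" for x
  define db where "db k x = ((hits m x (block r \<epsilon> z h k) - real m * pb k) / (real m * pb k / 2))\<^sup>2" for k x
  have Lh: "(L * h powr s)\<^sup>2 > 0" using L_pos h by simp
  have T: "T > 0" unfolding T_def using Lh \<sigma>1_pos by simp
  have pw: "real m * pw \<le> T / 2"
    using window_mass Lh unfolding T_def pw_def by (simp add: field_simps)
  have pb: "2 * n0 \<le> real m * pb k" if "k \<le> r" for k
    using block_mass[OF that] unfolding pb_def .
  have [measurable]: "block r \<epsilon> z h k \<in> sets borel" for k
    using block_eq_interval[OF \<epsilon> h(1), of r z k] by (metis atLeastAtMost_borel)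
  have [measurable]: "window z h \<in> sets borel" unfolding window_def by simp
  have [measurable]: "dw \<in> borel_measurable (design_law m)" "db k \<in> borel_measurable (design_law m)" for k
    unfolding dw_def db_def by measurable
  interpret D: prob_space "design_law m" by (rule prob_design_law)
  let ?I = "conditional_truncated_risk r Q m z"
  have pointwise: "?I x \<le> ennreal V + ennreal (4 * Q\<^sup>2) * (ennreal (dw x) + (\<Sum>k\<le>r. ennreal (db k x)))"
    if no_ties: "\<forall>i\<in>{1..m}. \<forall>j\<in>{1..m}. i \<noteq> j \<longrightarrow> \<bar>x i - z\<bar> \<noteq> \<bar>x j - z\<bar>" for x
  proof (cases "hits m x (window z h) < T \<and> (\<forall>k\<le>r. n0 \<le> hits m x (block r \<epsilon> z h k))")
    case True
    have "(L * h powr s)\<^sup>2 * hits m x (window z h) < \<sigma>1\<^sup>2"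
      using True Lh unfolding T_def by (simp add: pos_less_divide_eq mult.commute)
    then have "conditional_risk r s L \<sigma>1 m \<sigma> f z x \<le> ennreal V"
      unfolding V_def using True no_ties
      by (intro conditional_risk_le_good_design[OF \<epsilon> h n0 _ _ n0_large _ f r \<sigma>_pos \<sigma>_le]) auto
    then have "?I x \<le> ennreal V" using conditional_truncated_risk_le(2)[OF Q] order_trans by blast
    then show ?thesis by (simp add: add_increasing2)
  next
    case False
    have "1 \<le> ennreal (dw x) + (\<Sum>k\<le>r. ennreal (db k x))"
    proof (cases "hits m x (window z h) < T")
      case True
      then obtain k where k: "k \<le> r" "hits m x (block r \<epsilon> z h k) < n0" using False by force
      have "1 \<le> \<bar>(hits m x (block r \<epsilon> z h k) - real m * pb k) / (real m * pb k / 2)\<bar>"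
        using k(2) pb[OF k(1)] n0 unfolding abs_divide by (subst pos_le_divide_eq) auto
      then have "1 \<le> db k x" unfolding db_def by (metis one_le_power power2_abs)
      then have "1 \<le> ennreal (db k x)" by simp
      also have "\<dots> \<le> (\<Sum>k\<le>r. ennreal (db k x))" using k(1) by (intro member_le_sum) auto
      finally show ?thesis by (simp add: add_increasing)
    next
      case False
      have "1 \<le> \<bar>(hits m x (window z h) - real m * pw) / (T / 2)\<bar>"
        using False pw T unfolding abs_divide by (subst pos_le_divide_eq) auto
      then have "1 \<le> dw x" unfolding dw_def by (metis one_le_power power2_abs)
      then have "1 \<le> ennreal (dw x)" by simp
      then show ?thesis by (simp add: add_increasing2)
    qed
    then have "ennreal (4 * Q\<^sup>2) * 1 \<le> ennreal (4 * Q\<^sup>2) * (ennreal (dw x) + (\<Sum>k\<le>r. ennreal (db k x)))"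
      by (intro mult_left_mono) auto
    then have "?I x \<le> ennreal (4 * Q\<^sup>2) * (ennreal (dw x) + (\<Sum>k\<le>r. ennreal (db k x)))"
      by (intro order_trans[OF conditional_truncated_risk_le(1)[OF Q]]) simp
    then show ?thesis by (simp add: add_increasing)
  qed
  have scale: "(a / (b / 2))\<^sup>2 = 4 / b\<^sup>2 * a\<^sup>2" for a b :: real
    by (simp add: power2_eq_square)
  have dw_int: "(\<integral>\<^sup>+ x. ennreal (dw x) \<partial>design_law m) \<le> ennreal (2 / T)"
  proof -
    have "(\<integral>\<^sup>+ x. ennreal (dw x) \<partial>design_law m)
        = (\<integral>\<^sup>+ x. ennreal (4 / T\<^sup>2) * ennreal ((hits m x (window z h) - real m * pw)\<^sup>2) \<partial>design_law m)"
      unfolding dw_def scale by (intro nn_integral_cong ennreal_mult) auto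
    also have "\<dots> = ennreal (4 / T\<^sup>2) * (\<integral>\<^sup>+ x. ennreal ((hits m x (window z h) - real m * pw)\<^sup>2) \<partial>design_law m)"
      by (rule nn_integral_cmult) measurable
    also have "\<dots> \<le> ennreal (4 / T\<^sup>2) * ennreal (real m * pw)"
      unfolding pw_def by (intro mult_left_mono hits_chebyshev PZ sets_PZ) auto
    also have "\<dots> = ennreal (4 / T\<^sup>2 * (real m * pw))"
      by (rule ennreal_mult[symmetric]) (simp_all add: pw_def)
    also have "\<dots> \<le> ennreal (4 / T\<^sup>2 * (T / 2))"
      by (intro ennreal_leI mult_left_mono pw) auto
    also have "4 / T\<^sup>2 * (T / 2) = 2 / T" using T by (simp add: power2_eq_square)
    finally show ?thesis .
  qed
  have db_int: "(\<integral>\<^sup>+ x. ennreal (db k x) \<partial>design_law m) \<le> ennreal (2 / n0)" if k: "k \<le> r" for k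
  proof -
    define q where "q = real m * pb k"
    have q: "2 * n0 \<le> q" "q > 0" using pb[OF k] n0 unfolding q_def by auto
    have "(\<integral>\<^sup>+ x. ennreal (db k x) \<partial>design_law m)
        = (\<integral>\<^sup>+ x. ennreal (4 / q\<^sup>2) * ennreal ((hits m x (block r \<epsilon> z h k) - q)\<^sup>2) \<partial>design_law m)"
      unfolding db_def q_def[symmetric] scale by (intro nn_integral_cong ennreal_mult) auto
    also have "\<dots> = ennreal (4 / q\<^sup>2) * (\<integral>\<^sup>+ x. ennreal ((hits m x (block r \<epsilon> z h k) - q)\<^sup>2) \<partial>design_law m)"
      by (rule nn_integral_cmult) measurable
    also have "\<dots> \<le> ennreal (4 / q\<^sup>2) * ennreal q"
      unfolding q_def pb_def by (intro mult_left_mono hits_chebyshev PZ sets_PZ) auto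
    also have "\<dots> = ennreal (4 / q)"
      using q by (simp add: ennreal_mult[symmetric] power2_eq_square)
    also have "\<dots> \<le> ennreal (4 / (2 * n0))"
      using q n0 by (intro ennreal_leI divide_left_mono) auto
    finally show ?thesis by simp
  qed
  have "truncated_risk_at r Q m z
      \<le> (\<integral>\<^sup>+ x. ennreal V + ennreal (4 * Q\<^sup>2) * (ennreal (dw x) + (\<Sum>k\<le>r. ennreal (db k x))) \<partial>design_law m)"
    unfolding truncated_risk_at_def
    using ties_negligible[OF PZ sets_PZ atomless, of m z]
    by (intro nn_integral_mono_AE) (auto elim!: eventually_mono intro!: pointwise)
  also have "\<dots> = ennreal V + ennreal (4 * Q\<^sup>2) * ((\<integral>\<^sup>+ x. ennreal (dw x) \<partial>design_law m)
      + (\<Sum>k\<le>r. \<integral>\<^sup>+ x. ennreal (db k x) \<partial>design_law m))"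
    by (simp add: nn_integral_add nn_integral_cmult nn_integral_sum D.emeasure_space_1 del: One_nat_def)
  also have "\<dots> \<le> ennreal V + ennreal (4 * Q\<^sup>2) * (ennreal (2 / T) + (\<Sum>k\<le>r. ennreal (2 / n0)))"
    by (intro add_left_mono mult_left_mono add_mono sum_mono dw_int db_int) auto
  also have "(\<Sum>k\<le>r. ennreal (2 / n0)) = ennreal ((real r + 1) * (2 / n0))"
    using n0 by (subst sum_ennreal) (auto simp: add.commute)
  also have "ennreal V + ennreal (4 * Q\<^sup>2) * (ennreal (2 / T) + ennreal ((real r + 1) * (2 / n0)))
      = ennreal (V + 4 * Q\<^sup>2 * (2 / T + (real r + 1) * (2 / n0)))"
  proof -
    have nonneg: "0 \<le> 2 / T" "0 \<le> (real r + 1) * (2 / n0)" "0 \<le> V"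
      using T n0 unfolding V_def by simp_all
    have nonneg': "0 \<le> 4 * Q\<^sup>2 * (2 / T + (real r + 1) * (2 / n0))"
      by (rule mult_nonneg_nonneg[OF _ add_nonneg_nonneg[OF nonneg(1,2)]]) simp
    show ?thesis
      unfolding ennreal_plus[OF nonneg(3) nonneg'] ennreal_plus[OF nonneg(1,2), symmetric]
      by (subst ennreal_mult[OF _ add_nonneg_nonneg[OF nonneg(1,2)]]) simp_all
  qed
  finally show ?thesis unfolding V_def T_def by simp
qed

end

section \<open>The integrated risk\<close>

text \<open>The width \<open>h\<close> (called \<open>hm m\<close>) is calibrated by \<open>4 B m h (L h\<^bsup>s\<^esup>)\<^sup>2 = \<sigma>1\<^sup>2\<close> with an upper bound
  \<open>B\<close> of the density: the window of width \<open>h\<close> has mass at most \<open>2 B h\<close>, so the expected number of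
  observations in it is at most half of \<open>\<sigma>1\<^sup>2 / (L h\<^bsup>s\<^esup>)\<^sup>2\<close>, the number that makes \<open>h\<close> admissible.\<close>

proposition integrated_risk_rate:
  fixes PZ :: "real measure" and s L Q \<sigma>1 :: real and r :: nat
  assumes PZ: "prob_space PZ" "sets PZ = sets borel"
    and pos: "s > 0" "L > 0" "Q > 0" "\<sigma>1 > 0"
    and r: "real r + 1 \<ge> s" and D: "assumption_D PZ"
  shows "\<exists>C2>0. \<forall>\<sigma>0 \<sigma>. noise_level \<sigma>0 \<sigma>1 \<sigma> \<longrightarrow>
     (\<forall>\<^sub>F m in sequentially.
        (SUP f\<in>bounded_holder_class Q s L. integrated_risk PZ r s L Q \<sigma>1 m \<sigma> f)
        \<le> ennreal (C2 * real m powr (- 2 * s / (2 * s + 1))))"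
proof -
  obtain \<mu> where nonneg: "\<And>x. 0 \<le> \<mu> x" and cont: "continuous_on UNIV \<mu>"
    and dens: "PZ = density lborel (\<lambda>x. ennreal (\<mu> x))" and S: "compact (fun_support \<mu>)"
    and zeros: "\<And>z. z \<in> fun_support \<mu> \<Longrightarrow> \<mu> z = 0 \<Longrightarrow>
      \<exists>a>0. \<exists>b>0. antimono_on {z - a..z} \<mu> \<and> mono_on {z..z + b} \<mu>"
    using D unfolding assumption_D_def by blast
  define S where "S = fun_support \<mu>"
  obtain \<delta> where \<delta>: "\<delta> > 0" "\<And>z h. z \<in> S \<Longrightarrow> h \<le> \<delta> \<Longrightarrow>
    \<exists>\<epsilon>\<in>{1, -1}. \<forall>t. 0 \<le> \<epsilon> * (t - z) \<and> \<epsilon> * (t - z) \<le> h \<longrightarrow> \<mu> z / 4 \<le> \<mu> t"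
    using density_locally_comparable_one_sided[OF nonneg cont S zeros] unfolding S_def by blast
  have [measurable]: "\<mu> \<in> borel_measurable borel"
    using cont by (rule borel_measurable_continuous_onI)
  have in_S: "z \<in> S" if "\<mu> z \<noteq> 0" for z
    using that closure_subset[of "{x. \<mu> x \<noteq> 0}"] unfolding S_def fun_support_def by auto
  obtain B where B: "B > 0" "\<And>x. \<mu> x \<le> B"
  proof -
    have "bounded (\<mu> ` S)"
      using S cont unfolding S_def
      by (intro compact_imp_bounded compact_continuous_image) (auto intro: continuous_on_subset)
    then obtain b where b: "b > 0" "\<And>x. x \<in> S \<Longrightarrow> \<bar>\<mu> x\<bar> \<le> b" unfolding bounded_pos by auto
    have "\<mu> x \<le> b" for x using b in_S[of x] by (cases "\<mu> x = 0") force+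
    then show thesis using b(1) that by blast
  qed
  have atomless: "emeasure PZ {c} = 0" for c
  proof -
    have "emeasure PZ {c} = (\<integral>\<^sup>+ x. ennreal (\<mu> x) * indicator {c} x \<partial>lborel)"
      unfolding dens by (rule emeasure_density) auto
    also have "\<dots> = 0" by (rule nn_integral_null_set) (rule finite_imp_null_set_lborel, simp)
    finally show ?thesis .
  qed
  define d where "d = 2 * real r + 2"
  define c0 where "c0 = (\<sigma>1\<^sup>2 / (4 * B * L\<^sup>2)) powr (1 / (2 * s + 1))"
  define hm where "hm m = c0 * real m powr (- 1 / (2 * s + 1))" for m :: nat
  define G where "G = (L * (1 / 2) powr s)\<^sup>2"
  \<comment> \<open>The four terms stem from the conditional bound, from the events of too few observations in a
    block, from the event of too many observations in the window, and from points of low density.\<close>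
  define C where "C = 24 * d * \<sigma>1\<^sup>2 * (real r + 1) * d ^ (2 * r) + 64 * Q\<^sup>2 * (real r + 1) * d + 2 * Q\<^sup>2 + 32 * Q\<^sup>2 * d * \<sigma>1\<^sup>2 / G"
  define vol where "vol = measure lborel S"
  have d: "d > 0" unfolding d_def by simp
  have G: "G > 0" unfolding G_def using pos by simp
  have c0: "c0 > 0" unfolding c0_def using pos B by simp
  have C: "C > 0" unfolding C_def using d G pos by (intro add_nonneg_pos add_pos_nonneg add_nonneg_nonneg) auto
  have vol: "emeasure lborel S = ennreal vol" "vol \<ge> 0"
    using emeasure_bounded_finite[OF compact_imp_bounded[OF S]] unfolding vol_def S_def
    by (simp_all add: emeasure_eq_ennreal_measure less_top)
  have pointwise: "regression_model.truncated_risk_at s L \<sigma>1 PZ \<sigma> f r Q m z \<le> ennreal (C / (real m * hm m) / \<mu> z)"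
    if model: "regression_model s L \<sigma>1 PZ \<sigma> f" and \<sigma>_le: "\<And>t. \<sigma> t \<le> \<sigma>1"
      and f: "f \<in> holder_class s L" "\<And>t. \<bar>f t\<bar> \<le> Q"
      and m: "m \<ge> 1" and h_small: "hm m \<le> \<delta>" "hm m \<le> 1 / 2" and z: "\<mu> z > 0"
    for \<sigma> f m z
  proof -
    interpret regression_model s L \<sigma>1 PZ \<sigma> f by (rule model)
    define h where "h = hm m"
    define n0 where "n0 = \<mu> z * (real m * h) / (8 * d)"
    have m0: "real m > 0" using m by simp
    have h: "h > 0" unfolding h_def hm_def using c0 m0 by simp
    have mh: "real m * h > 0" using m0 h by simp
    have n0: "n0 > 0" unfolding n0_def using z mh d by simp
    have balance: "4 * B * (real m * h) * (L * h powr s)\<^sup>2 = \<sigma>1\<^sup>2"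
    proof -
      have "h powr (2 * s + 1) = c0 powr (2 * s + 1) * (real m powr (- 1 / (2 * s + 1))) powr (2 * s + 1)"
        unfolding h_def hm_def using c0 by (simp add: powr_mult)
      also have "c0 powr (2 * s + 1) = \<sigma>1\<^sup>2 / (4 * B * L\<^sup>2)"
        unfolding c0_def powr_powr using pos B by simp
      also have "(real m powr (- 1 / (2 * s + 1))) powr (2 * s + 1) = 1 / real m"
        unfolding powr_powr using pos m0 by (simp add: powr_minus_divide)
      finally have "h powr (2 * s + 1) * real m * (4 * B * L\<^sup>2) = \<sigma>1\<^sup>2"
        using m0 B pos by simp
      moreover have "h powr (2 * s + 1) = h * (h powr s)\<^sup>2"
      proof -
        have "h powr (2 * s + 1) = h powr (s + s) * h powr 1"
          using powr_add[of h "s + s" 1] by (simp only: mult_2)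
        also have "\<dots> = (h powr s * h powr s) * h" using h by (simp only: powr_add powr_one)
        finally show ?thesis by (simp only: power2_eq_square mult.commute)
      qed
      ultimately show ?thesis by (simp add: power_mult_distrib mult_ac)
    qed
    show ?thesis
    \<comment> \<open>If \<open>n0\<close> is below a constant, then \<open>\<mu> z\<close> is at most of order \<open>1 / (m h)\<close> and the trivial
      bound \<open>4 Q\<^sup>2\<close> of the truncated loss is good enough.\<close>
    proof (cases "\<sigma>1\<^sup>2 \<le> G * n0")
      case True
      obtain \<epsilon> where \<epsilon>: "\<epsilon> \<in> {1, -1}"
        and near: "\<And>t. 0 \<le> \<epsilon> * (t - z) \<Longrightarrow> \<epsilon> * (t - z) \<le> h \<Longrightarrow> \<mu> z / 4 \<le> \<mu> t"
      proof -
        have "z \<in> S" using in_S[of z] z by simp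
        then show thesis using \<delta>(2)[of z h] h_small(1) that unfolding h_def by blast
      qed
      have "truncated_risk_at r Q m z \<le> ennreal (3 * \<sigma>1\<^sup>2 * ((real r + 1) * (2 * real r + 2) ^ (2 * r) / n0)
          + 4 * Q\<^sup>2 * (2 * ((L * h powr s)\<^sup>2 / \<sigma>1\<^sup>2) + (real r + 1) * (2 / n0)))"
      proof (rule truncated_risk_at_le[OF f r \<sigma>_le atomless \<epsilon> h _ n0])
        show "h \<le> 1 / 2" using h_small(2) unfolding h_def .
        show "\<sigma>1\<^sup>2 \<le> (L * (1 / 2) powr s)\<^sup>2 * n0" using True unfolding G_def .
        have "measure PZ (window z h) \<le> B * ((z + h) - (z - h))"
          unfolding window_def using h B by (intro measure_interval_bounds(2)[OF dens PZ(1)]) auto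
        then have "real m * measure PZ (window z h) \<le> real m * (B * (2 * h))"
          by (intro mult_left_mono) auto
        then have "2 * (real m * measure PZ (window z h)) * (L * h powr s)\<^sup>2 \<le> 2 * (real m * (B * (2 * h))) * (L * h powr s)\<^sup>2"
          by (intro mult_right_mono[OF _ zero_le_power2]) linarith
        also have "\<dots> = \<sigma>1\<^sup>2" using balance by (simp add: mult_ac)
        finally show "2 * (real m * measure PZ (window z h)) * (L * h powr s)\<^sup>2 \<le> \<sigma>1\<^sup>2" .
        fix k assume k: "k \<le> r"
        obtain a where a: "block r \<epsilon> z h k = {a..a + h / (2 * real r + 2)}"
          by (rule block_eq_interval[OF \<epsilon> h])
        have "\<mu> z / 4 * ((a + h / d) - a) \<le> measure PZ {a..a + h / d}"
        proof (rule measure_interval_bounds(1)[OF dens PZ(1)])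
          fix t assume "t \<in> {a..a + h / d}"
          then have "t \<in> block r \<epsilon> z h k" unfolding a d_def .
          then show "\<mu> z / 4 \<le> \<mu> t" using near block_in_half_window[OF h k] by blast
        qed (use h d z in auto)
        then have "real m * (\<mu> z / 4 * (h / d)) \<le> real m * measure PZ (block r \<epsilon> z h k)"
          unfolding a d_def by (intro mult_left_mono) auto
        then show "2 * n0 \<le> real m * measure PZ (block r \<epsilon> z h k)"
          unfolding n0_def by (simp add: mult_ac)
      qed
      also have "\<dots> \<le> ennreal (C / (real m * h) / \<mu> z)"
      proof (rule ennreal_leI)
        have inv_n0: "1 / n0 = 8 * d / (real m * h) / \<mu> z" unfolding n0_def using z mh d by simp
        have ratio: "(L * h powr s)\<^sup>2 / \<sigma>1\<^sup>2 = 1 / (4 * B * (real m * h))"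
          unfolding balance[symmetric] using pos h by (intro nonzero_divide_mult_cancel_right) simp
        have "1 / (4 * B) \<le> 1 / 4 / \<mu> z" using B z by (simp add: field_simps)
        then have "1 / (4 * B) / (real m * h) \<le> 1 / 4 / \<mu> z / (real m * h)"
          using mh by (intro divide_right_mono) auto
        then have ratio_le: "(L * h powr s)\<^sup>2 / \<sigma>1\<^sup>2 \<le> 1 / 4 / (real m * h) / \<mu> z"
          unfolding ratio by (simp add: mult_ac)
        have "3 * \<sigma>1\<^sup>2 * ((real r + 1) * (2 * real r + 2) ^ (2 * r) / n0)
            + 4 * Q\<^sup>2 * (2 * ((L * h powr s)\<^sup>2 / \<sigma>1\<^sup>2) + (real r + 1) * (2 / n0))
          = 3 * \<sigma>1\<^sup>2 * (real r + 1) * d ^ (2 * r) * (1 / n0)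
            + 8 * Q\<^sup>2 * ((L * h powr s)\<^sup>2 / \<sigma>1\<^sup>2) + 8 * Q\<^sup>2 * (real r + 1) * (1 / n0)"
          unfolding d_def by (simp add: algebra_simps add_divide_distrib)
        also have "\<dots> \<le> 3 * \<sigma>1\<^sup>2 * (real r + 1) * d ^ (2 * r) * (1 / n0)
            + 8 * Q\<^sup>2 * (1 / 4 / (real m * h) / \<mu> z) + 8 * Q\<^sup>2 * (real r + 1) * (1 / n0)"
          using ratio_le by (intro add_mono mult_left_mono) auto
        also have "\<dots> = (C - 32 * Q\<^sup>2 * d * \<sigma>1\<^sup>2 / G) / (real m * h) / \<mu> z"
          unfolding inv_n0 C_def by (simp add: add_divide_distrib mult_ac)
        also have "\<dots> \<le> C / (real m * h) / \<mu> z"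
          using G d mh z by (intro divide_right_mono) auto
        finally show "3 * \<sigma>1\<^sup>2 * ((real r + 1) * (2 * real r + 2) ^ (2 * r) / n0)
            + 4 * Q\<^sup>2 * (2 * ((L * h powr s)\<^sup>2 / \<sigma>1\<^sup>2) + (real r + 1) * (2 / n0)) \<le> C / (real m * h) / \<mu> z" .
      qed
      finally show ?thesis unfolding h_def .
    next
      case False
      interpret DL: prob_space "design_law m" by (rule prob_design_law)
      have "truncated_risk_at r Q m z \<le> (\<integral>\<^sup>+ x. ennreal (4 * Q\<^sup>2) \<partial>design_law m)"
        unfolding truncated_risk_at_def by (intro nn_integral_mono conditional_truncated_risk_le(1) f)
      also have "\<dots> = ennreal (4 * Q\<^sup>2)" by (simp add: DL.emeasure_space_1 del: One_nat_def)
      also have "\<dots> \<le> ennreal (C / (real m * h) / \<mu> z)"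
      proof (rule ennreal_leI)
        have "\<mu> z * (real m * h) * G \<le> \<sigma>1\<^sup>2 * (8 * d)"
          using False d unfolding n0_def by (simp add: field_simps)
        then have "\<mu> z * (real m * h) \<le> 8 * d * \<sigma>1\<^sup>2 / G"
          using G by (simp add: pos_le_divide_eq mult_ac)
        then have "4 * Q\<^sup>2 * (\<mu> z * (real m * h)) \<le> 4 * Q\<^sup>2 * (8 * d * \<sigma>1\<^sup>2 / G)"
          by (intro mult_left_mono) auto
        also have "4 * Q\<^sup>2 * (8 * d * \<sigma>1\<^sup>2 / G) = 32 * Q\<^sup>2 * d * \<sigma>1\<^sup>2 / G" by simp
        also have "\<dots> \<le> C"
        proof -
          have "0 \<le> 24 * d * \<sigma>1\<^sup>2 * (real r + 1) * d ^ (2 * r) + 64 * Q\<^sup>2 * (real r + 1) * d + 2 * Q\<^sup>2"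
            using d by (intro add_nonneg_nonneg mult_nonneg_nonneg) auto
          then show ?thesis unfolding C_def by linarith
        qed
        finally show "4 * Q\<^sup>2 \<le> C / (real m * h) / \<mu> z"
          unfolding pos_le_divide_eq[OF z] pos_le_divide_eq[OF mh] by (simp only: mult.assoc)
      qed
      finally show ?thesis unfolding h_def .
    qed
  qed
  have integrated: "integrated_risk PZ r s L Q \<sigma>1 m \<sigma> f \<le> ennreal (C * (vol + 1) / c0 * real m powr (- 2 * s / (2 * s + 1)))"
    if model: "regression_model s L \<sigma>1 PZ \<sigma> f" and \<sigma>_le: "\<And>t. \<sigma> t \<le> \<sigma>1"
      and f: "f \<in> holder_class s L" "\<And>t. \<bar>f t\<bar> \<le> Q"
      and m: "m \<ge> 1" and h_small: "hm m \<le> \<delta>" "hm m \<le> 1 / 2"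
    for \<sigma> f m
  proof -
    interpret regression_model s L \<sigma>1 PZ \<sigma> f by (rule model)
    define R where "R = C / (real m * hm m)"
    have R: "R \<ge> 0" unfolding R_def hm_def using C c0 by simp
    have AE_pos: "AE z in PZ. \<mu> z > 0"
      unfolding dens by (subst AE_density) (auto simp: ennreal_less_zero_iff)
    have "integrated_risk PZ r s L Q \<sigma>1 m \<sigma> f = (\<integral>\<^sup>+ z. truncated_risk_at r Q m z \<partial>PZ)"
      unfolding integrated_risk_swap truncated_risk_at_def conditional_truncated_risk_def ..
    also have "\<dots> \<le> (\<integral>\<^sup>+ z. ennreal (R / \<mu> z) \<partial>PZ)"
      using AE_pos pointwise[OF model \<sigma>_le f m h_small] unfolding R_def
      by (intro nn_integral_mono_AE) (auto elim!: eventually_mono)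
    also have "\<dots> = (\<integral>\<^sup>+ z. ennreal (\<mu> z) * ennreal (R / \<mu> z) \<partial>lborel)"
      unfolding dens by (rule nn_integral_density) measurable
    also have "\<dots> \<le> (\<integral>\<^sup>+ z. ennreal R * indicator S z \<partial>lborel)"
    proof (intro nn_integral_mono)
      fix z
      show "ennreal (\<mu> z) * ennreal (R / \<mu> z) \<le> ennreal R * indicator S z"
        using in_S[of z] nonneg[of z] R by (cases "\<mu> z = 0") (auto simp: ennreal_mult[symmetric])
    qed
    also have "\<dots> = ennreal R * emeasure lborel S"
      using S unfolding S_def by (intro nn_integral_cmult_indicator) (simp add: borel_compact)
    also have "\<dots> = ennreal (R * vol)" using R vol by (simp add: ennreal_mult)
    also have "\<dots> \<le> ennreal (C * (vol + 1) / c0 * real m powr (- 2 * s / (2 * s + 1)))"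
    proof (rule ennreal_leI)
      have "real m * hm m = c0 * (real m powr 1 * real m powr (- 1 / (2 * s + 1)))"
        unfolding hm_def using m by simp
      also have "\<dots> = c0 * real m powr (2 * s / (2 * s + 1))"
        unfolding powr_add[symmetric] using pos by (intro arg_cong[where f = "\<lambda>e. c0 * real m powr e"]) (simp add: field_simps)
      finally have R_eq: "R = C / c0 * real m powr (- 2 * s / (2 * s + 1))"
        unfolding R_def using m by (simp add: powr_minus_divide)
      have "R * vol \<le> R * (vol + 1)" using R by (intro mult_left_mono) auto
      also have "\<dots> = C * (vol + 1) / c0 * real m powr (- 2 * s / (2 * s + 1))"
        unfolding R_eq by simp
      finally show "R * vol \<le> C * (vol + 1) / c0 * real m powr (- 2 * s / (2 * s + 1))" .
    qed
    finally show ?thesis .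
  qed
  show ?thesis
  proof (intro exI[of _ "C * (vol + 1) / c0"] conjI allI impI)
    show "C * (vol + 1) / c0 > 0" using C vol c0 by simp
    fix \<sigma>0 \<sigma> assume noise: "noise_level \<sigma>0 \<sigma>1 \<sigma>"
    have "(\<lambda>m. c0 * real m powr (- 1 / (2 * s + 1))) \<longlonglongrightarrow> c0 * 0"
      using pos by (intro tendsto_mult tendsto_const tendsto_neg_powr filterlim_real_sequentially) (simp add: divide_neg_pos)
    then have lim: "hm \<longlonglongrightarrow> 0" unfolding hm_def[abs_def] by simp
    have "\<forall>\<^sub>F m in sequentially. hm m < min \<delta> (1 / 2)"
      using \<delta>(1) by (intro order_tendstoD(2)[OF lim]) simp
    then show "\<forall>\<^sub>F m in sequentially.
        (SUP f\<in>bounded_holder_class Q s L. integrated_risk PZ r s L Q \<sigma>1 m \<sigma> f)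
        \<le> ennreal (C * (vol + 1) / c0 * real m powr (- 2 * s / (2 * s + 1)))"
      using eventually_ge_at_top[of 1]
    proof eventually_elim
      fix m assume m: "hm m < min \<delta> (1 / 2)" "1 \<le> m"
      show "(SUP f\<in>bounded_holder_class Q s L. integrated_risk PZ r s L Q \<sigma>1 m \<sigma> f)
        \<le> ennreal (C * (vol + 1) / c0 * real m powr (- 2 * s / (2 * s + 1)))"
      proof (rule SUP_least)
        fix f assume "f \<in> bounded_holder_class Q s L"
        then have f: "f \<in> holder_class s L" "\<And>t. \<bar>f t\<bar> \<le> Q" unfolding bounded_holder_class_def by auto
        have \<sigma>: "\<sigma> \<in> borel_measurable borel" "\<And>t. 0 < \<sigma> t" "\<And>t. \<sigma> t \<le> \<sigma>1"
          using noise unfolding noise_level_def by (auto intro: less_le_trans)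
        have "regression_model s L \<sigma>1 PZ \<sigma> f"
          by (intro regression_model.intro bandwidth_setup.intro regression_model_axioms.intro pos PZ \<sigma>(1,2)
              borel_measurable_continuous_onI[OF holder_class_continuous[OF f(1) pos(1)]])
        then show "integrated_risk PZ r s L Q \<sigma>1 m \<sigma> f
            \<le> ennreal (C * (vol + 1) / c0 * real m powr (- 2 * s / (2 * s + 1)))"
          using \<sigma> f m by (intro integrated) auto
      qed
    qed
  qed
qed

theorem theorem3:
  fixes PZ :: "real measure" and s L Q \<sigma>1 :: real and r :: nat
  assumes "prob_space PZ" and "sets PZ = sets borel"
    and "s > 0" and "L > 0" and "Q > 0" and "\<sigma>1 > 0"
    and "real r + 1 \<ge> s"
  shows
    "(\<forall>\<sigma>0 \<sigma> m z. noise_level \<sigma>0 \<sigma>1 \<sigma> \<longrightarrow> z \<in> measure_support PZ \<longrightarrow>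
        (\<forall>f\<in>holder_class s L. AE \<omega> in sample_law PZ \<sigma> f m.
           nn_cond_exp (sample_law PZ \<sigma> f m) (design_algebra PZ \<sigma> f m)
             (pointwise_loss r s L \<sigma>1 m f z) \<omega>
           = conditional_risk r s L \<sigma>1 m \<sigma> f z (design \<omega>)) \<and>
        (\<forall>x. regular_event r s L \<sigma>1 m x z \<longrightarrow>
           (SUP f\<in>holder_class s L. conditional_risk r s L \<sigma>1 m \<sigma> f z x)
           \<le> ennreal (2 * inverse (local_eigenvalue r s L \<sigma>1 m x z) ^ 2 * L ^ 2
                        * bandwidth s L \<sigma>1 m x z powr (2 * s))))
     \<and>
     (assumption_D PZ \<longrightarrow>
        (\<exists>C2>0. \<forall>\<sigma>0 \<sigma>. noise_level \<sigma>0 \<sigma>1 \<sigma> \<longrightarrow>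
           (\<forall>\<^sub>F m in sequentially.
              (SUP f\<in>bounded_holder_class Q s L. integrated_risk PZ r s L Q \<sigma>1 m \<sigma> f)
              \<le> ennreal (C2 * real m powr (- 2 * s / (2 * s + 1))))))"
proof (intro conjI allI impI)
  show "\<exists>C2>0. \<forall>\<sigma>0 \<sigma>. noise_level \<sigma>0 \<sigma>1 \<sigma> \<longrightarrow>
           (\<forall>\<^sub>F m in sequentially.
              (SUP f\<in>bounded_holder_class Q s L. integrated_risk PZ r s L Q \<sigma>1 m \<sigma> f)
              \<le> ennreal (C2 * real m powr (- 2 * s / (2 * s + 1))))" if "assumption_D PZ"
    by (rule integrated_risk_rate) fact+
  fix \<sigma>0 \<sigma> m z assume noise: "noise_level \<sigma>0 \<sigma>1 \<sigma>"
  have \<sigma>: "\<sigma> \<in> borel_measurable borel" "\<And>t. 0 < \<sigma> t" "\<And>t. \<sigma> t \<le> \<sigma>1"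
    using noise unfolding noise_level_def by (auto intro: less_le_trans)
  interpret bandwidth_setup s L \<sigma>1 by unfold_locales fact+
  show "\<forall>f\<in>holder_class s L. AE \<omega> in sample_law PZ \<sigma> f m.
      nn_cond_exp (sample_law PZ \<sigma> f m) (design_algebra PZ \<sigma> f m) (pointwise_loss r s L \<sigma>1 m f z) \<omega>
      = conditional_risk r s L \<sigma>1 m \<sigma> f z (design \<omega>)"
  proof
    fix f assume "f \<in> holder_class s L"
    then have f: "f \<in> borel_measurable borel"
      using \<open>s > 0\<close> by (intro borel_measurable_continuous_onI holder_class_continuous)
    interpret regression_model s L \<sigma>1 PZ \<sigma> f
      by (intro regression_model.intro regression_model_axioms.intro bandwidth_setup_axioms assms \<sigma> f)
    show "AE \<omega> in sample_law PZ \<sigma> f m.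
      nn_cond_exp (sample_law PZ \<sigma> f m) (design_algebra PZ \<sigma> f m) (pointwise_loss r s L \<sigma>1 m f z) \<omega>
      = conditional_risk r s L \<sigma>1 m \<sigma> f z (design \<omega>)"
      by (rule conditional_risk_is_conditional_expectation)
  qed
  fix x assume "regular_event r s L \<sigma>1 m x z"
  then show "(SUP f\<in>holder_class s L. conditional_risk r s L \<sigma>1 m \<sigma> f z x)
      \<le> ennreal (2 * inverse (local_eigenvalue r s L \<sigma>1 m x z) ^ 2 * L ^ 2
                   * bandwidth s L \<sigma>1 m x z powr (2 * s))"
    using assms \<sigma> by (intro SUP_least conditional_risk_le_eigenvalue) auto
qed

end
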